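(* Let $E$ be a complex Banach lattice and let $T \in \mathcal{L}(E)$ be uniformly eventually positive. Assume that the spectral value $r(T)$ is a pole of the resolvent $R(\cdot,T)$ of pole order $1$ and that the corresponding spectral space $F \subseteq E$ (the range of the spectral projection of $T$ associated with $r(T)$) is finite-dimensional. Then every spectral value $\lambda$ of $T$ with $|\lambda| = r(T)$ is also a pole of order $1$ of the resolvent $R(\cdot,T)$, and the dimension of its spectral space is at most $\dim F$.
   Context: A bounded linear operator $T$ on a complex Banach lattice $E$ is called uniformly eventually positive if there exists $n_0 \in \mathbb{N}_0$ such that $T^n$ is a positive operator (i.e. $T^n f \ge 0$ for all $0 \le f \in E$) for each $n \ge n_0$. $r(T)$ denotes the spectral radius of $T$ (for such $T$, $r(T)$ is known to belong to $\sigma(T)$). *)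

theory Defs
  imports "HOL-Analysis.Analysis"
begin

class banach_lattice = banach + ordered_real_vector + lattice +
  assumes lattice_norm: "sup x (- x) \<le> sup y (- y) \<Longrightarrow> norm x \<le> norm y"

text \<open>The complex Banach lattice E is the complexification E_R + i E_R of a real
  Banach lattice E_R, realised as the product E_R x E_R with the pair (x,y)
  standing for x + i y.  Complex scalar multiplication:\<close>
definition cmult :: "complex \<Rightarrow> 'a::real_vector \<times> 'a \<Rightarrow> 'a \<times> 'a" where
  "cmult c z = (Re c *\<^sub>R fst z - Im c *\<^sub>R snd z, Im c *\<^sub>R fst z + Re c *\<^sub>R snd z)"

lemma bounded_linear_cmult: "bounded_linear (cmult c :: 'a::real_normed_vector \<times> 'a \<Rightarrow> _)"
  unfolding cmult_def
  by (auto intro!: bounded_linear_intros)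

definition clinear_op :: "(('a::real_normed_vector \<times> 'a) \<Rightarrow>\<^sub>L ('a \<times> 'a)) \<Rightarrow> bool" where
  "clinear_op T \<longleftrightarrow> (\<forall>c z. blinfun_apply T (cmult c z) = cmult c (blinfun_apply T z))"

definition cscal :: "complex \<Rightarrow> (('a::real_normed_vector \<times> 'a) \<Rightarrow>\<^sub>L ('a \<times> 'a))" where
  "cscal c = Blinfun (cmult c)"

definition pos_op :: "('a::banach_lattice \<times> 'a \<Rightarrow> 'a \<times> 'a) \<Rightarrow> bool" where
  "pos_op S \<longleftrightarrow> (\<forall>f. 0 \<le> f \<longrightarrow> 0 \<le> fst (S (f, 0)) \<and> snd (S (f, 0)) = 0)"

definition unif_ev_pos :: "(('a::banach_lattice \<times> 'a) \<Rightarrow>\<^sub>L ('a \<times> 'a)) \<Rightarrow> bool" where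
  "unif_ev_pos T \<longleftrightarrow> (\<exists>n0::nat. \<forall>n\<ge>n0. pos_op (blinfun_apply T ^^ n))"

definition resolvent_set :: "(('a::real_normed_vector \<times> 'a) \<Rightarrow>\<^sub>L ('a \<times> 'a)) \<Rightarrow> complex set" where
  "resolvent_set T = {l. \<exists>S. (cscal l - T) o\<^sub>L S = id_blinfun \<and> S o\<^sub>L (cscal l - T) = id_blinfun}"

definition spectrum :: "(('a::real_normed_vector \<times> 'a) \<Rightarrow>\<^sub>L ('a \<times> 'a)) \<Rightarrow> complex set" where
  "spectrum T = - resolvent_set T"

definition resolvent :: "(('a::real_normed_vector \<times> 'a) \<Rightarrow>\<^sub>L ('a \<times> 'a)) \<Rightarrow> complex \<Rightarrow> (('a \<times> 'a) \<Rightarrow>\<^sub>L ('a \<times> 'a))" where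
  "resolvent T l = (THE S. (cscal l - T) o\<^sub>L S = id_blinfun \<and> S o\<^sub>L (cscal l - T) = id_blinfun)"

definition spec_radius :: "(('a::real_normed_vector \<times> 'a) \<Rightarrow>\<^sub>L ('a \<times> 'a)) \<Rightarrow> real" where
  "spec_radius T = Sup (cmod ` spectrum T)"

text \<open>mu is a pole of order 1 of the resolvent: mu is a spectral value, isolated in
  the spectrum, and (lambda - mu) R(lambda,T) has a removable singularity at mu
  (limit in operator norm).\<close>
definition simple_pole :: "(('a::real_normed_vector \<times> 'a) \<Rightarrow>\<^sub>L ('a \<times> 'a)) \<Rightarrow> complex \<Rightarrow> bool" where
  "simple_pole T \<mu> \<longleftrightarrow> \<mu> \<in> spectrum T \<and> (\<forall>\<^sub>F l in at \<mu>. l \<notin> spectrum T) \<and>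
     (\<exists>P. ((\<lambda>l. cscal (l - \<mu>) o\<^sub>L resolvent T l) \<longlongrightarrow> P) (at \<mu>))"

text \<open>Spectral projection at a pole of order 1 = residue of the resolvent
  = lim (lambda - mu) R(lambda,T); spectral space = its range.\<close>
definition spectral_proj :: "(('a::real_normed_vector \<times> 'a) \<Rightarrow>\<^sub>L ('a \<times> 'a)) \<Rightarrow> complex \<Rightarrow> (('a \<times> 'a) \<Rightarrow>\<^sub>L ('a \<times> 'a))" where
  "spectral_proj T \<mu> = Lim (at \<mu>) (\<lambda>l. cscal (l - \<mu>) o\<^sub>L resolvent T l)"

definition spectral_space :: "(('a::real_normed_vector \<times> 'a) \<Rightarrow>\<^sub>L ('a \<times> 'a)) \<Rightarrow> complex \<Rightarrow> ('a \<times> 'a) set" where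
  "spectral_space T \<mu> = range (blinfun_apply (spectral_proj T \<mu>))"

definition finite_dim :: "'a::real_vector set \<Rightarrow> bool" where
  "finite_dim V \<longleftrightarrow> (\<exists>B. finite B \<and> V \<subseteq> span B)"

end

(*
  Idea. Let r > 0 be the spectral radius, P the spectral projection at r, and |l| = r, w = l/r.
  Stepping down from large s shows that R(s) T^n0 is positive for all s > r; hence R(z) T^n0 is
  dominated by R(|z|) T^n0, and K(s) = (s - r) w R(s w) stays bounded as s decreases to r.
  If (l - T) f is small, then f is close to K(s) f, so |f| is almost below P |f|.

  Consider sequences along an ultrafilter modulo those X with P X^+ -> 0. A Zorn argument supplies
  enough real lattice homomorphisms on them; restricted to the range of P there are at most dim of
  the real range many, because distinct ones have a dual system. For approximate eigensequences F
  one has |F| = P |F| modulo null sequences, so finitely many homomorphisms control the norm of F.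
  This bounds the dimension of ker (l - T) and makes bounded approximate eigensequences converge
  along the ultrafilter. Consequently K(s) converges in norm to a projection Q onto ker (l - T), the
  resolvent is bounded on the range of I - Q, l - T + Q is invertible, and the resolvent has a
  simple pole at l with residue Q.
*)
theory Submission
  imports Defs "HOL-Library.Lattice_Algebras" "HOL-Library.Function_Algebras"
begin

section \<open>Banach lattices\<close>

\<comment> \<open>The factor T^n0 is forced: finitely many powers of T may fail to be positive, so
  R(s) itself need not be positive. The terms of the expansion that are left out vanish once
  multiplied by s - r. The main obstacle is that P need not be strictly positive. Domination gives
  |f| below P |f| for an eigenvector, not equality. The gap lies in the kernel of P, and the
  quotient is built to ignore that kernel. Norms are not visible there, but they are recovered
  because |F| is almost below P |F| in norm. Since l is not known in advance to be isolated in the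
  spectrum, exact eigenvectors do not suffice, which is why sequences enter. The ultrafilter makes
  all bounded real sequences converge at once, without passing to subsequences. Dimensions are taken
  over the reals. Each homomorphism therefore counts twice, for real and for imaginary parts, on
  both sides of the comparison, and no factor is lost.\<close>
subclass (in banach_lattice) lattice_ab_group_add ..

definition lat_abs :: "'a::banach_lattice \<Rightarrow> 'a"
  where "lat_abs x = sup x (- x)"

lemma lat_abs_ge: "x \<le> lat_abs x" "- x \<le> lat_abs x"
  by (auto simp: lat_abs_def)

lemma lat_abs_nonneg [simp]: "0 \<le> lat_abs x"
proof -
  have "x + (- x) \<le> lat_abs x + lat_abs x"
    using lat_abs_ge add_mono by blast
  then show ?thesis by simp
qed

lemma lat_abs_le: "x \<le> z \<Longrightarrow> - x \<le> z \<Longrightarrow> lat_abs x \<le> z"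
  by (simp add: lat_abs_def)

lemma lat_abs_of_nonneg [simp]: "0 \<le> x \<Longrightarrow> lat_abs x = x"
  unfolding lat_abs_def by (rule sup_absorb1) (meson neg_le_0_iff_le order_trans)

lemma scaleR_le_lat_abs: "a *\<^sub>R x \<le> \<bar>a\<bar> *\<^sub>R lat_abs x"
proof (cases "a \<ge> 0")
  case True
  then show ?thesis by (simp add: lat_abs_ge scaleR_left_mono)
next
  case False
  then have "(- a) *\<^sub>R (- x) \<le> (- a) *\<^sub>R lat_abs x"
    by (intro scaleR_left_mono) (auto simp: lat_abs_ge)
  with False show ?thesis by simp
qed

lemma norm_lat_abs [simp]: "norm (lat_abs x) = norm (x::'a::banach_lattice)"
proof -
  have "sup (lat_abs x) (- lat_abs x) = sup x (- x)"
    using lat_abs_of_nonneg[OF lat_abs_nonneg[of x]] by (simp add: lat_abs_def)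
  then show ?thesis
    by (intro antisym lattice_norm) simp_all
qed

lemma norm_mono_nonneg:
  fixes x y :: "'a::banach_lattice"
  assumes "0 \<le> x" "x \<le> y"
  shows "norm x \<le> norm y"
proof -
  have "sup x (- x) = x" "sup y (- y) = y"
    using lat_abs_of_nonneg[of x] lat_abs_of_nonneg[of y] assms by (auto simp: lat_abs_def)
  then show ?thesis
    using assms by (intro lattice_norm) simp
qed

text \<open>The norm of \<open>pprt (x - z)\<close> measures how far \<open>x \<le> z\<close> fails,
  so one-sided order estimates become norm estimates.\<close>

lemma norm_pprt_le:
  fixes x y :: "'a::banach_lattice"
  assumes "x \<le> y"
  shows "norm (pprt x) \<le> norm y"
proof -
  have "pprt x \<le> lat_abs y"
    unfolding pprt_def using assms lat_abs_ge(1)[of y] by (auto intro: order_trans)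
  from norm_mono_nonneg[OF _ this] show ?thesis by simp
qed

lemma norm_pprt_triangle:
  fixes x y :: "'a::banach_lattice"
  shows "norm (pprt x) \<le> norm (pprt y) + norm (x - y)"
proof -
  have "x = y + (x - y)" by simp
  also have "\<dots> \<le> pprt y + lat_abs (x - y)"
    by (intro add_mono lat_abs_ge) (simp add: pprt_def)
  finally have "norm (pprt x) \<le> norm (pprt y + lat_abs (x - y))"
    by (rule norm_pprt_le)
  also have "\<dots> \<le> norm (pprt y) + norm (x - y)"
    using norm_triangle_ineq[of "pprt y" "lat_abs (x - y)"] by simp
  finally show ?thesis .
qed

text \<open>Whenever \<open>0 \<le> f n\<close>, also \<open>- x \<le> f n - x\<close>, so the
  positive part of \<open>- x\<close> has norm at most the distance from \<open>f n\<close> to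
  \<open>x\<close>.\<close>

lemma tendsto_nonneg_lattice:
  fixes f :: "'b \<Rightarrow> 'a::banach_lattice"
  assumes "(f \<longlongrightarrow> x) F" "F \<noteq> bot" "\<forall>\<^sub>F n in F. 0 \<le> f n"
  shows "0 \<le> x"
proof -
  have "norm (pprt (- x)) \<le> 0"
  proof (rule tendsto_lowerbound)
    show "((\<lambda>n. norm (f n - x)) \<longlongrightarrow> 0) F"
      using assms(1) by (simp add: LIM_zero tendsto_norm_zero)
    show "\<forall>\<^sub>F n in F. norm (pprt (- x)) \<le> norm (f n - x)"
      using assms(3) by eventually_elim (rule norm_pprt_le, simp)
  qed fact
  then have "- x \<le> 0"
    by (simp add: le_zero_iff_zero_pprt)
  then show ?thesis by simp
qed

lemma tendsto_le_lattice:
  fixes f g :: "'b \<Rightarrow> 'a::banach_lattice"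
  assumes "(f \<longlongrightarrow> x) F" "(g \<longlongrightarrow> y) F" "F \<noteq> bot" "\<forall>\<^sub>F n in F. f n \<le> g n"
  shows "x \<le> y"
  using tendsto_nonneg_lattice[OF tendsto_diff[OF assms(2,1)] assms(3)] assms(4) by simp

section \<open>The modulus on the complexification\<close>

lemma fst_cmult_le:
  fixes F :: "'a::banach_lattice \<times> 'a"
  shows "fst (cmult c F) \<le> cmod c *\<^sub>R (lat_abs (fst F) + lat_abs (snd F))"
proof -
  have "Re c *\<^sub>R fst F \<le> cmod c *\<^sub>R lat_abs (fst F)"
    using scaleR_le_lat_abs[of "Re c" "fst F"] scaleR_right_mono[OF abs_Re_le_cmod[of c] lat_abs_nonneg[of "fst F"]]
    by (rule order_trans)
  moreover have "(- Im c) *\<^sub>R snd F \<le> cmod c *\<^sub>R lat_abs (snd F)"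
    using scaleR_le_lat_abs[of "- Im c" "snd F"] scaleR_right_mono[OF abs_Im_le_cmod[of c] lat_abs_nonneg[of "snd F"]]
    by (simp add: order_trans[of "- (Im c *\<^sub>R snd F)"])
  ultimately have "Re c *\<^sub>R fst F + (- Im c) *\<^sub>R snd F \<le> cmod c *\<^sub>R lat_abs (fst F) + cmod c *\<^sub>R lat_abs (snd F)"
    by (rule add_mono)
  then show ?thesis
    by (simp add: cmult_def scaleR_add_right)
qed

text \<open>The modulus is the supremum of the real parts of all rotations of \<open>F\<close>. As
  the lattice is not assumed order complete, the supremum is taken over a finite net of the unit
  circle and raised by a multiple of \<open>b\<close> that pays for the mesh.\<close>

lemma approximate_modulus:
  fixes F :: "'a::banach_lattice \<times> 'a"
  assumes "e > 0"
  obtains m where "\<And>c. cmod c = 1 \<Longrightarrow> fst (cmult c F) \<le> m"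
    "\<And>z. (\<And>c. cmod c = 1 \<Longrightarrow> fst (cmult c F) \<le> z) \<Longrightarrow> norm (pprt (m - z)) \<le> e"
proof -
  define b where "b = lat_abs (fst F) + lat_abs (snd F)"
  \<comment> \<open>The summand 1 avoids division by zero; with this mesh the correction
    \<open>d *\<^sub>R b\<close> has norm at most \<open>e\<close>.\<close>
  define d where "d = e / (1 + norm b)"
  have d: "d > 0" unfolding d_def using assms by (simp add: add_pos_nonneg)
  have b0: "0 \<le> b" by (simp add: b_def)
  obtain S where S: "finite S" "S \<subseteq> sphere (0::complex) 1" "sphere 0 1 \<subseteq> (\<Union>x\<in>S. ball x d)"
    using seq_compact_imp_totally_bounded[of "sphere (0::complex) 1"] d compact_imp_seq_compact[OF compact_sphere] by metis
  have "1 \<in> sphere (0::complex) 1" by simp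
  then have Sne: "S \<noteq> {}" using S(3) by blast
  define M where "M = Sup_fin ((\<lambda>c. fst (cmult c F)) ` S)"
  show thesis
  proof
    fix c :: complex assume "cmod c = 1"
    then have "c \<in> (\<Union>x\<in>S. ball x d)"
      by (intro subsetD[OF S(3)]) simp
    then obtain c' where c': "c' \<in> S" "cmod (c - c') < d"
      by (auto simp: dist_norm norm_minus_commute)
    have "fst (cmult c F) = fst (cmult c' F) + fst (cmult (c - c') F)"
      by (simp add: cmult_def algebra_simps)
    also have "\<dots> \<le> M + cmod (c - c') *\<^sub>R b"
      unfolding M_def b_def using c' S(1) by (intro add_mono fst_cmult_le Sup_fin.coboundedI) auto
    also have "\<dots> \<le> M + d *\<^sub>R b"
      using c' b0 by (intro add_left_mono scaleR_right_mono) auto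
    finally show "fst (cmult c F) \<le> M + d *\<^sub>R b" .
  next
    fix z assume z: "\<And>c. cmod c = 1 \<Longrightarrow> fst (cmult c F) \<le> z"
    have "M \<le> z" unfolding M_def
      using S(1,2) Sne z by (intro Sup_fin.boundedI) auto
    then have "M + d *\<^sub>R b - z \<le> d *\<^sub>R b"
      by (simp add: algebra_simps)
    from norm_pprt_le[OF this] have "norm (pprt (M + d *\<^sub>R b - z)) \<le> d * norm b"
      using d by simp
    also have "\<dots> \<le> e"
      unfolding d_def using assms by (simp add: field_simps add_pos_nonneg)
    finally show "norm (pprt (M + d *\<^sub>R b - z)) \<le> e" .
  qed
qed

lemma Cauchy_of_inverse_bound:
  fixes X :: "nat \<Rightarrow> 'b::real_normed_vector"
  assumes "\<And>n k. norm (X n - X k) \<le> inverse (Suc n) + inverse (Suc k)"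
  shows "Cauchy X"
proof (rule CauchyI)
  fix e :: real assume "e > 0"
  then obtain N where N: "inverse (real (Suc N)) < e / 2"
    using reals_Archimedean[of "e / 2"] by auto
  have "norm (X n - X k) < e" if "n \<ge> N" "k \<ge> N" for n k
  proof -
    have "inverse (real (Suc n)) \<le> inverse (real (Suc N))" "inverse (real (Suc k)) \<le> inverse (real (Suc N))"
      using that by (auto intro!: le_imp_inverse_le)
    with assms[of n k] N show ?thesis by linarith
  qed
  then show "\<exists>M. \<forall>m\<ge>M. \<forall>n\<ge>M. norm (X m - X n) < e" by blast
qed

text \<open>Approximate suprema are upper bounds, so each of two exceeds the other only by a small
  positive part. They form a Cauchy sequence, and completeness in norm stands in for order
  completeness.\<close>

lemma ex_modulus:
  fixes F :: "'a::banach_lattice \<times> 'a"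
  shows "\<exists>m. (\<forall>c. cmod c = 1 \<longrightarrow> fst (cmult c F) \<le> m) \<and>
    (\<forall>z. (\<forall>c. cmod c = 1 \<longrightarrow> fst (cmult c F) \<le> z) \<longrightarrow> m \<le> z)"
proof -
  have "\<exists>m. (\<forall>c. cmod c = 1 \<longrightarrow> fst (cmult c F) \<le> m) \<and>
      (\<forall>z. (\<forall>c. cmod c = 1 \<longrightarrow> fst (cmult c F) \<le> z) \<longrightarrow> norm (pprt (m - z)) \<le> inverse (Suc n))" for n :: nat
    by (rule approximate_modulus[of "inverse (Suc n)" F]) auto
  then obtain m where m: "\<And>n c. cmod c = 1 \<Longrightarrow> fst (cmult c F) \<le> m n"
    "\<And>n z. \<forall>c. cmod c = 1 \<longrightarrow> fst (cmult c F) \<le> z \<Longrightarrow> norm (pprt (m n - z)) \<le> inverse (Suc n)"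
    by metis
  have diff: "norm (m n - m k) \<le> inverse (Suc n) + inverse (Suc k)" for n k
  proof -
    have "m n - m k = pprt (m n - m k) - pprt (m k - m n)"
      using prts[of "m n - m k"] pprt_neg[of "m n - m k"] by simp
    then have "norm (m n - m k) \<le> norm (pprt (m n - m k)) + norm (pprt (m k - m n))"
      by (metis norm_triangle_ineq4)
    also have "\<dots> \<le> inverse (Suc n) + inverse (Suc k)"
      using m by (intro add_mono) auto
    finally show ?thesis .
  qed
  have "Cauchy m" by (rule Cauchy_of_inverse_bound[OF diff])
  then obtain a where a: "m \<longlonglongrightarrow> a"
    using Cauchy_convergent convergent_def by blast
  have "fst (cmult c F) \<le> a" if "cmod c = 1" for c
    using tendsto_le_lattice[OF tendsto_const a] m(1)[OF that] by simp
  moreover have "a \<le> z" if z: "\<forall>c. cmod c = 1 \<longrightarrow> fst (cmult c F) \<le> z" for z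
  proof -
    have "norm (pprt (a - z)) \<le> 0"
    proof (rule tendsto_lowerbound)
      show "(\<lambda>n. inverse (Suc n) + norm (m n - a)) \<longlonglongrightarrow> 0"
        using tendsto_add[OF LIMSEQ_inverse_real_of_nat tendsto_norm_zero[OF LIM_zero[OF a]]] by simp
      have "norm (pprt (a - z)) \<le> inverse (Suc n) + norm (m n - a)" for n
        using norm_pprt_triangle[of "a - z" "m n - z"] m(2)[OF z, of n] by (simp add: norm_minus_commute)
      then show "\<forall>\<^sub>F n in sequentially. norm (pprt (a - z)) \<le> inverse (Suc n) + norm (m n - a)"
        by simp
    qed simp
    then show ?thesis by (simp add: le_zero_iff_zero_pprt[symmetric])
  qed
  ultimately show ?thesis by blast
qed

definition modulus :: "'a::banach_lattice \<times> 'a \<Rightarrow> 'a"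
  where "modulus F = (SOME m. (\<forall>c. cmod c = 1 \<longrightarrow> fst (cmult c F) \<le> m) \<and>
    (\<forall>z. (\<forall>c. cmod c = 1 \<longrightarrow> fst (cmult c F) \<le> z) \<longrightarrow> m \<le> z))"

lemma modulus_ge: "cmod c = 1 \<Longrightarrow> fst (cmult c F) \<le> modulus F"
  and modulus_least: "(\<And>c. cmod c = 1 \<Longrightarrow> fst (cmult c F) \<le> z) \<Longrightarrow> modulus F \<le> z"
  using someI_ex[OF ex_modulus[of F]] unfolding modulus_def by auto

lemma lat_abs_le_modulus: "lat_abs (fst F) \<le> modulus F" "lat_abs (snd F) \<le> modulus F"
  using modulus_ge[of 1 F] modulus_ge[of "-1" F] modulus_ge[of \<i> F] modulus_ge[of "-\<i>" F]
  by (auto intro!: lat_abs_le simp: cmult_def)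

lemma modulus_nonneg [simp]: "0 \<le> modulus F"
  using lat_abs_le_modulus(1)[of F] lat_abs_nonneg order_trans by blast

lemma modulus_le: "modulus F \<le> lat_abs (fst F) + lat_abs (snd F)"
  using fst_cmult_le[of _ F] by (intro modulus_least) (metis scaleR_one)

lemma norm_modulus_le: "norm (modulus F) \<le> 2 * norm F"
proof -
  have "norm (modulus F) \<le> norm (lat_abs (fst F) + lat_abs (snd F))"
    by (intro norm_mono_nonneg modulus_le) simp
  also have "\<dots> \<le> norm (fst F) + norm (snd F)"
    using norm_triangle_ineq[of "lat_abs (fst F)" "lat_abs (snd F)"] by simp
  also have "\<dots> \<le> 2 * norm F"
    using norm_fst_le[of "fst F" "snd F"] norm_snd_le[of "snd F" "fst F"] by simp
  finally show ?thesis .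
qed

lemma norm_le_modulus: "norm F \<le> 2 * norm (modulus F)"
proof -
  have "norm F \<le> norm (fst F) + norm (snd F)"
    using norm_Pair_le[of "fst F" "snd F"] by simp
  moreover have "norm (fst F) \<le> norm (modulus F)" "norm (snd F) \<le> norm (modulus F)"
    using norm_mono_nonneg[OF lat_abs_nonneg lat_abs_le_modulus(1)[of F]]
      norm_mono_nonneg[OF lat_abs_nonneg lat_abs_le_modulus(2)[of F]] by auto
  ultimately show ?thesis by linarith
qed

section \<open>Operators on the complexification and their resolvents\<close>

lemma cmult_cmult: "cmult a (cmult b z) = cmult (a * b) z"
  by (simp add: cmult_def algebra_simps)

lemma cmult_one [simp]: "cmult 1 z = z"
  by (simp add: cmult_def)

lemma cmult_zero_left [simp]: "cmult 0 z = 0"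
  by (simp add: cmult_def zero_prod_def)

lemma cmult_zero_right [simp]: "cmult c 0 = 0"
  by (simp add: cmult_def zero_prod_def)

lemma cmult_diff_left: "cmult (a - b) z = cmult a z - cmult b z"
  by (simp add: cmult_def algebra_simps)

lemma cmult_add_right: "cmult a (x + y) = cmult a x + cmult a y"
  by (simp add: cmult_def algebra_simps)

lemma cmult_diff_right: "cmult a (x - y) = cmult a x - cmult a y"
  by (simp add: cmult_def algebra_simps)

lemma cmult_of_real: "cmult (complex_of_real a) z = a *\<^sub>R z"
  by (simp add: cmult_def scaleR_prod_def)

lemma cmult_scaleR: "cmult c (a *\<^sub>R z) = a *\<^sub>R cmult c z"
  by (simp add: cmult_def algebra_simps scaleR_prod_def)

text \<open>The product norm on pairs is not a complex norm: even a rotation may change it. The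
  crude constant 4 counts the four real products and is the source of many factors 4 and 8 in later
  estimates.\<close>

lemma norm_cmult_le: "norm (cmult c z) \<le> 4 * cmod c * norm z"
proof -
  have z: "norm (fst z) \<le> norm z" "norm (snd z) \<le> norm z"
    using norm_fst_le[of "fst z" "snd z"] norm_snd_le[of "snd z" "fst z"] by auto
  have bd: "norm (a *\<^sub>R x) \<le> cmod c * norm z" if "\<bar>a\<bar> \<le> cmod c" "norm x \<le> norm z" for a and x :: 'a
    using that by (auto intro: mult_mono)
  have "norm (cmult c z) \<le> norm (Re c *\<^sub>R fst z - Im c *\<^sub>R snd z) + norm (Im c *\<^sub>R fst z + Re c *\<^sub>R snd z)"
    unfolding cmult_def by (rule norm_Pair_le)
  also have "\<dots> \<le> (norm (Re c *\<^sub>R fst z) + norm (Im c *\<^sub>R snd z)) + (norm (Im c *\<^sub>R fst z) + norm (Re c *\<^sub>R snd z))"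
    by (intro add_mono norm_triangle_ineq norm_triangle_ineq4)
  also have "\<dots> \<le> 4 * (cmod c * norm z)"
    using bd[of "Re c" "fst z"] bd[of "Im c" "fst z"] bd[of "Re c" "snd z"] bd[of "Im c" "snd z"] z
      abs_Re_le_cmod[of c] abs_Im_le_cmod[of c] by linarith
  finally show ?thesis by simp
qed

lemma tendsto_cmult [tendsto_intros]:
  fixes x :: "'a::real_normed_vector \<times> 'a"
  shows "(f \<longlongrightarrow> x) F \<Longrightarrow> ((\<lambda>n. cmult c (f n)) \<longlongrightarrow> cmult c x) F"
  by (rule bounded_linear.tendsto[OF bounded_linear_cmult])

lemma blinfun_apply_cscal [simp]: "blinfun_apply (cscal c) z = cmult c z"
  by (simp add: cscal_def bounded_linear_Blinfun_apply bounded_linear_cmult)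

lemma norm_cscal_le: "norm (cscal c) \<le> 4 * cmod c"
  by (rule norm_blinfun_bound) (auto simp: norm_cmult_le)

lemma clinear_opD: "clinear_op T \<Longrightarrow> blinfun_apply T (cmult c z) = cmult c (blinfun_apply T z)"
  unfolding clinear_op_def by blast

lemma clinear_op_funpow:
  "clinear_op T \<Longrightarrow> (blinfun_apply T ^^ n) (cmult c z) = cmult c ((blinfun_apply T ^^ n) z)"
  by (induction n) (auto simp: clinear_opD)

lemma blinfun_funpow_linear:
  fixes T :: "'a::real_normed_vector \<Rightarrow>\<^sub>L 'a"
  shows "bounded_linear (blinfun_apply T ^^ n)"
proof (induction n)
  case 0
  then show ?case by (simp add: id_def[symmetric] bounded_linear_ident[unfolded id_def[symmetric]])
next
  case (Suc n)
  then show ?case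
    using bounded_linear_compose[OF blinfun.bounded_linear_right[of T] Suc] by (simp add: o_def)
qed

lemma norm_blinfun_funpow_le:
  fixes T :: "'a::real_normed_vector \<Rightarrow>\<^sub>L 'a"
  shows "norm ((blinfun_apply T ^^ n) f) \<le> norm T ^ n * norm f"
proof (induction n)
  case (Suc n)
  have "norm (T ((blinfun_apply T ^^ n) f)) \<le> norm T * norm ((blinfun_apply T ^^ n) f)"
    by (rule norm_blinfun)
  also have "\<dots> \<le> norm T * (norm T ^ n * norm f)"
    using Suc by (intro mult_left_mono) auto
  finally show ?case by simp
qed simp

text \<open>The series is recorded at every vector, along with the inverse, because invariance of
  closed cones is later read off term by term.\<close>

lemma neumann_series:
  fixes A :: "'a::banach \<Rightarrow>\<^sub>L 'a"
  assumes A: "norm A \<le> 1 / 2"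
  obtains S where "(id_blinfun - A) o\<^sub>L S = id_blinfun" "S o\<^sub>L (id_blinfun - A) = id_blinfun"
    "norm S \<le> 2" "\<And>f. (\<lambda>k. (blinfun_apply A ^^ k) f) sums blinfun_apply S f"
proof -
  have le: "norm ((blinfun_apply A ^^ k) f) \<le> (1 / 2) ^ k * norm f" for k f
    by (rule order_trans[OF norm_blinfun_funpow_le mult_right_mono[OF power_mono[OF A]]]) auto
  have half: "(\<lambda>k. (1 / 2) ^ k * norm f) sums (2 * norm f)" for f :: 'a
    using sums_mult2[OF geometric_sums[of "1/2::real"], of "norm f"] by simp
  have summ: "summable (\<lambda>k. (blinfun_apply A ^^ k) f)" for f
    by (rule summable_comparison_test'[OF sums_summable[OF half], of 0]) (use le in auto)
  define S where "S f = (\<Sum>k. (blinfun_apply A ^^ k) f)" for f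
  have S: "(\<lambda>k. (blinfun_apply A ^^ k) f) sums S f" for f
    unfolding S_def by (rule summable_sums[OF summ])
  have lin: "bounded_linear (blinfun_apply A ^^ k)" for k
    by (rule blinfun_funpow_linear)
  have nS: "norm (S f) \<le> 2 * norm f" for f
  proof -
    have sn: "summable (\<lambda>k. norm ((blinfun_apply A ^^ k) f))"
      by (rule summable_comparison_test'[OF sums_summable[OF half], of 0]) (use le in auto)
    have "norm (S f) \<le> (\<Sum>k. norm ((blinfun_apply A ^^ k) f))"
      unfolding S_def by (rule summable_norm[OF sn])
    also have "\<dots> \<le> (\<Sum>k. (1 / 2) ^ k * norm f)"
      by (rule suminf_le[OF _ sn sums_summable[OF half]]) (rule le)
    finally show ?thesis using sums_unique[OF half] by simp
  qed
  have bl: "bounded_linear S"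
  proof (rule bounded_linear_intro)
    show "S (x + y) = S x + S y" for x y
      by (rule sums_unique2[OF S]) (use sums_add[OF S[of x] S[of y]] in \<open>simp add: linear_simps(1)[OF lin]\<close>)
    show "S (r *\<^sub>R x) = r *\<^sub>R S x" for r x
      by (rule sums_unique2[OF S]) (use sums_scaleR_right[OF S[of x], of r] in \<open>simp add: linear_simps(5)[OF lin]\<close>)
    show "norm (S x) \<le> norm x * 2" for x using nS[of x] by simp
  qed
  have step: "(\<lambda>k. (blinfun_apply A ^^ Suc k) f) sums (S f - f)" for f
    using S[of f] by (subst sums_Suc_iff) simp
  have r: "S f - A (S f) = f" for f
  proof -
    have "(\<lambda>k. (blinfun_apply A ^^ Suc k) f) sums A (S f)"
      using bounded_linear.sums[OF blinfun.bounded_linear_right S[of f], of A] by simp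
    from sums_unique2[OF step this] show ?thesis by (simp add: algebra_simps)
  qed
  have l: "S (f - A f) = f" for f
  proof -
    have "(\<lambda>k. (blinfun_apply A ^^ Suc k) f) sums S (A f)"
      using S[of "A f"] by (simp add: funpow_swap1)
    from sums_unique2[OF step this] show ?thesis using linear_simps(2)[OF bl, of f "A f"] by (simp add: algebra_simps)
  qed
  show thesis
  proof
    show "(id_blinfun - A) o\<^sub>L Blinfun S = id_blinfun" "Blinfun S o\<^sub>L (id_blinfun - A) = id_blinfun"
      by (rule blinfun_eqI; simp add: bounded_linear_Blinfun_apply[OF bl] blinfun.diff_left r l)+
    show "norm (Blinfun S) \<le> 2"
      by (rule norm_blinfun_bound) (auto simp: bounded_linear_Blinfun_apply[OF bl] nS)
    show "(\<lambda>k. (blinfun_apply A ^^ k) f) sums blinfun_apply (Blinfun S) f" for f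
      using S by (simp add: bounded_linear_Blinfun_apply[OF bl])
  qed
qed

text \<open>\<open>L - D\<close> factors as \<open>L\<close> after
  \<open>id_blinfun - (G o\<^sub>L D)\<close>, so its inverse is \<open>S o\<^sub>L G\<close> with
  \<open>S\<close> the Neumann sum.\<close>

lemma inverse_perturbation:
  fixes L G D :: "'a::banach \<Rightarrow>\<^sub>L 'a"
  assumes LG: "L o\<^sub>L G = id_blinfun" "G o\<^sub>L L = id_blinfun" and small: "norm (G o\<^sub>L D) \<le> 1 / 2"
  obtains H where "(L - D) o\<^sub>L H = id_blinfun" "H o\<^sub>L (L - D) = id_blinfun"
    "norm H \<le> 2 * norm G" "\<And>f. (\<lambda>k. (blinfun_apply (G o\<^sub>L D) ^^ k) (G f)) sums blinfun_apply H f"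
proof -
  obtain S where S: "(id_blinfun - (G o\<^sub>L D)) o\<^sub>L S = id_blinfun" "S o\<^sub>L (id_blinfun - (G o\<^sub>L D)) = id_blinfun"
    "norm S \<le> 2" "\<And>f. (\<lambda>k. (blinfun_apply (G o\<^sub>L D) ^^ k) f) sums blinfun_apply S f"
    using neumann_series[OF small] by blast
  have lg: "L (G f) = f" "G (L f) = f" for f
    using LG by (metis blinfun_apply_blinfun_compose blinfun_apply_id_blinfun id_apply)+
  have s: "S f - G (D (S f)) = f" "S (f - G (D f)) = f" for f
    using S(1,2)[THEN arg_cong, of "\<lambda>A. blinfun_apply A f"] by (simp_all add: blinfun.diff_left)
  show thesis
  proof
    have "L (S (G f)) - D (S (G f)) = f" for f
      using arg_cong[OF s(1)[of "G f"], of "blinfun_apply L"] by (simp add: blinfun.diff_right lg)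
    then show "(L - D) o\<^sub>L (S o\<^sub>L G) = id_blinfun"
      by (intro blinfun_eqI) (simp add: blinfun.diff_left)
    show "(S o\<^sub>L G) o\<^sub>L (L - D) = id_blinfun"
      by (intro blinfun_eqI) (simp add: blinfun.diff_left blinfun.diff_right[of G] lg s(2))
    have "norm (S o\<^sub>L G) \<le> norm S * norm G" by (rule norm_blinfun_compose)
    also have "\<dots> \<le> 2 * norm G" using S(3) by (intro mult_right_mono) auto
    finally show "norm (S o\<^sub>L G) \<le> 2 * norm G" .
    show "(\<lambda>k. (blinfun_apply (G o\<^sub>L D) ^^ k) (G f)) sums blinfun_apply (S o\<^sub>L G) f" for f
      using S(4)[of "G f"] by simp
  qed
qed

lemma resolventI:
  assumes "(cscal l - T) o\<^sub>L S = id_blinfun" "S o\<^sub>L (cscal l - T) = id_blinfun"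
  shows "l \<in> resolvent_set T" "resolvent T l = S"
proof -
  show "l \<in> resolvent_set T"
    using assms by (auto simp: resolvent_set_def)
  have "S' = S" if "S' o\<^sub>L (cscal l - T) = id_blinfun" for S'
  proof (rule blinfun_eqI)
    fix f
    have "S' ((cscal l - T) (S f)) = S f"
      using arg_cong[OF that, of "\<lambda>A. blinfun_apply A (S f)"] by simp
    moreover have "(cscal l - T) (S f) = f"
      using arg_cong[OF assms(1), of "\<lambda>A. blinfun_apply A f"] by simp
    ultimately show "S' f = S f" by simp
  qed
  then show "resolvent T l = S"
    unfolding resolvent_def using assms by (intro the_equality) blast+
qed

lemma resolvent_compose:
  assumes "l \<in> resolvent_set T"
  shows "(cscal l - T) o\<^sub>L resolvent T l = id_blinfun" "resolvent T l o\<^sub>L (cscal l - T) = id_blinfun"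
proof -
  obtain S where S: "(cscal l - T) o\<^sub>L S = id_blinfun" "S o\<^sub>L (cscal l - T) = id_blinfun"
    using assms by (auto simp: resolvent_set_def)
  then show "(cscal l - T) o\<^sub>L resolvent T l = id_blinfun" "resolvent T l o\<^sub>L (cscal l - T) = id_blinfun"
    by (simp_all add: resolventI(2)[OF S])
qed

lemma resolvent_right:
  assumes "l \<in> resolvent_set T"
  shows "cmult l (resolvent T l f) - T (resolvent T l f) = f"
  using arg_cong[OF resolvent_compose(1)[OF assms], of "\<lambda>A. blinfun_apply A f"]
  by (simp add: blinfun.diff_left)

lemma resolvent_eqI:
  assumes "l \<in> resolvent_set T" "cmult l h - T h = g"
  shows "resolvent T l g = h"
  using arg_cong[OF resolvent_compose(2)[OF assms(1)], of "\<lambda>A. blinfun_apply A h"] assms(2)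
  by (simp add: blinfun.diff_left)

lemma resolvent_cmult:
  assumes "clinear_op T" "l \<in> resolvent_set T"
  shows "resolvent T l (cmult c f) = cmult c (resolvent T l f)"
proof (rule resolvent_eqI[OF assms(2)])
  show "cmult l (cmult c (resolvent T l f)) - T (cmult c (resolvent T l f)) = cmult c f"
    using arg_cong[OF resolvent_right[OF assms(2), of f], of "cmult c"]
    by (simp add: clinear_opD[OF assms(1)] cmult_cmult cmult_diff_right mult.commute)
qed

lemma resolvent_commute:
  assumes "clinear_op T" "l \<in> resolvent_set T"
  shows "resolvent T l (T f) = T (resolvent T l f)"
proof (rule resolvent_eqI[OF assms(2)])
  show "cmult l (T (resolvent T l f)) - T (T (resolvent T l f)) = T f"
    using arg_cong[OF resolvent_right[OF assms(2), of f], of "blinfun_apply T"]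
    by (simp add: clinear_opD[OF assms(1)] blinfun.diff_right)
qed

lemma resolvent_perturbation:
  fixes T :: "('a::banach \<times> 'a) \<Rightarrow>\<^sub>L ('a \<times> 'a)"
  assumes "l \<in> resolvent_set T" "norm (resolvent T l o\<^sub>L cscal h) \<le> 1 / 2"
  shows "l - h \<in> resolvent_set T" "norm (resolvent T (l - h)) \<le> 2 * norm (resolvent T l)"
    "(\<lambda>k. (blinfun_apply (resolvent T l o\<^sub>L cscal h) ^^ k) (resolvent T l f)) sums resolvent T (l - h) f"
proof -
  have eq: "cscal l - T - cscal h = cscal (l - h) - T"
    by (rule blinfun_eqI) (simp add: blinfun.diff_left cmult_diff_left)
  obtain H where H: "(cscal (l - h) - T) o\<^sub>L H = id_blinfun" "H o\<^sub>L (cscal (l - h) - T) = id_blinfun"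
    "norm H \<le> 2 * norm (resolvent T l)"
    "\<And>f. (\<lambda>k. (blinfun_apply (resolvent T l o\<^sub>L cscal h) ^^ k) (resolvent T l f)) sums blinfun_apply H f"
    using inverse_perturbation[OF resolvent_compose[OF assms(1)] assms(2)] unfolding eq by blast
  from resolventI[OF H(1,2)] H(3,4)
  show "l - h \<in> resolvent_set T" "norm (resolvent T (l - h)) \<le> 2 * norm (resolvent T l)"
    "(\<lambda>k. (blinfun_apply (resolvent T l o\<^sub>L cscal h) ^^ k) (resolvent T l f)) sums resolvent T (l - h) f"
    by auto
qed

text \<open>\<open>T\<close> is treated as a perturbation of \<open>cscal l\<close>, whose inverse
  has norm at most 4 divided by \<open>cmod l\<close>; the 8 makes the perturbation at most
  1/2.\<close>

lemma resolvent_far: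
  fixes T :: "('a::banach \<times> 'a) \<Rightarrow>\<^sub>L ('a \<times> 'a)"
  assumes "l \<noteq> 0" "8 * norm T \<le> cmod l"
  shows "l \<in> resolvent_set T"
    "(\<lambda>k. (blinfun_apply (cscal (inverse l) o\<^sub>L T) ^^ k) (cmult (inverse l) f)) sums resolvent T l f"
proof -
  define G :: "('a \<times> 'a) \<Rightarrow>\<^sub>L ('a \<times> 'a)" where "G = cscal (inverse l)"
  have 1: "cscal l o\<^sub>L G = id_blinfun" "G o\<^sub>L cscal l = id_blinfun"
    unfolding G_def using assms(1) by (intro blinfun_eqI; simp add: cmult_cmult)+
  have "norm (G o\<^sub>L T) \<le> norm (G) * norm T"
    by (rule norm_blinfun_compose)
  also have "\<dots> \<le> (4 * cmod (inverse l)) * norm T"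
    by (intro mult_right_mono norm_cscal_le[of "inverse l", where 'a='a, folded G_def]) auto
  also have "\<dots> \<le> 1 / 2"
    unfolding norm_inverse using assms by (simp add: field_simps)
  finally have small: "norm (G o\<^sub>L T) \<le> 1 / 2" .
  obtain H where H: "(cscal l - T) o\<^sub>L H = id_blinfun" "H o\<^sub>L (cscal l - T) = id_blinfun"
    "\<And>f. (\<lambda>k. (blinfun_apply (G o\<^sub>L T) ^^ k) (G f)) sums blinfun_apply H f"
    using inverse_perturbation[OF 1 small] by blast
  from resolventI[OF H(1,2)] H(3)[of f, unfolded G_def]
  show "l \<in> resolvent_set T"
    "(\<lambda>k. (blinfun_apply (cscal (inverse l) o\<^sub>L T) ^^ k) (cmult (inverse l) f)) sums resolvent T l f"
    by auto
qed

lemma bdd_above_spectrum: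
  fixes T :: "('a::banach \<times> 'a) \<Rightarrow>\<^sub>L ('a \<times> 'a)"
  shows "bdd_above (cmod ` spectrum T)"
proof (rule bdd_aboveI2)
  fix l assume "l \<in> spectrum T"
  then have "\<not> (l \<noteq> 0 \<and> 8 * norm T \<le> cmod l)"
    using resolvent_far(1)[of l T] by (auto simp: spectrum_def)
  then show "cmod l \<le> 8 * norm T" by auto
qed

lemma spectral_value_le_spec_radius:
  fixes T :: "('a::banach \<times> 'a) \<Rightarrow>\<^sub>L ('a \<times> 'a)"
  shows "l \<in> spectrum T \<Longrightarrow> cmod l \<le> spec_radius T"
  unfolding spec_radius_def by (rule cSUP_upper[OF _ bdd_above_spectrum])

lemma resolvent_set_outside:
  fixes T :: "('a::banach \<times> 'a) \<Rightarrow>\<^sub>L ('a \<times> 'a)"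
  shows "spec_radius T < cmod l \<Longrightarrow> l \<in> resolvent_set T"
  using spectral_value_le_spec_radius[of l T] by (fastforce simp: spectrum_def)

section \<open>Positivity of the resolvent of an eventually positive operator\<close>

definition pos_cone :: "('a::banach_lattice \<times> 'a) set"
  where "pos_cone = {F. 0 \<le> fst F \<and> snd F = 0}"

lemma pos_coneI: "0 \<le> f \<Longrightarrow> (f, 0) \<in> pos_cone"
  by (simp add: pos_cone_def)

lemma pos_cone_zero: "0 \<in> pos_cone"
  by (simp add: pos_cone_def)

lemma pos_cone_add: "x \<in> pos_cone \<Longrightarrow> y \<in> pos_cone \<Longrightarrow> x + y \<in> pos_cone"
  by (simp add: pos_cone_def)

lemma pos_cone_scaleR: "0 \<le> a \<Longrightarrow> x \<in> pos_cone \<Longrightarrow> a *\<^sub>R x \<in> pos_cone"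
  by (simp add: pos_cone_def scaleR_nonneg_nonneg)

lemma closed_pos_cone: "closed pos_cone"
  unfolding closed_sequential_limits
proof (intro allI impI, elim conjE)
  fix x and l :: "'a \<times> 'a" assume x: "\<forall>n. x n \<in> pos_cone" and l: "x \<longlonglongrightarrow> l"
  have "0 \<le> fst l"
    by (rule tendsto_nonneg_lattice[OF tendsto_fst[OF l]]) (use x in \<open>auto simp: pos_cone_def\<close>)
  moreover have "snd l = 0"
    using tendsto_snd[OF l] x LIMSEQ_unique[OF _ tendsto_const] by (simp add: pos_cone_def)
  ultimately show "l \<in> pos_cone" by (simp add: pos_cone_def)
qed

lemma pos_op_iff: "pos_op S \<longleftrightarrow> (\<forall>F\<in>pos_cone. S F \<in> pos_cone)"
proof
  assume "pos_op S"
  then show "\<forall>F\<in>pos_cone. S F \<in> pos_cone"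
    unfolding pos_op_def pos_cone_def by (auto simp: split_paired_all)
next
  assume "\<forall>F\<in>pos_cone. S F \<in> pos_cone"
  then show "pos_op S"
    unfolding pos_op_def using pos_coneI by (auto simp: pos_cone_def)
qed

lemma sums_in_closed_cone:
  fixes f :: "nat \<Rightarrow> 'a::real_normed_vector"
  assumes "closed C" "0 \<in> C" "\<And>x y. x \<in> C \<Longrightarrow> y \<in> C \<Longrightarrow> x + y \<in> C" "f sums s" "\<And>k. f k \<in> C"
  shows "s \<in> C"
proof -
  have "sum f {..<n} \<in> C" for n
    using assms by (induction n) auto
  with assms(1,4) show ?thesis
    unfolding sums_def by (auto intro: closed_sequentially[of C "\<lambda>n. sum f {..<n}"])
qed

section \<open>Positive complex linear operators\<close>

locale clinear_pos =
  fixes S :: "'a::banach_lattice \<times> 'a \<Rightarrow> 'a \<times> 'a"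
  assumes lin: "bounded_linear S"
    and cmult: "\<And>c F. S (cmult c F) = cmult c (S F)"
    and pos: "pos_op S"
begin

definition re_part :: "'a \<Rightarrow> 'a"
  where "re_part x = fst (S (x, 0))"

lemma re_part_bounded_linear: "bounded_linear re_part"
proof -
  have "bounded_linear (\<lambda>x::'a. (x, 0::'a))"
    by (intro bounded_linear_Pair bounded_linear_ident bounded_linear_zero)
  from bounded_linear_compose[OF bounded_linear_fst bounded_linear_compose[OF lin this]]
  show ?thesis by (simp add: re_part_def[abs_def])
qed

lemma re_part_nonneg: "0 \<le> x \<Longrightarrow> 0 \<le> re_part x"
  using pos by (simp add: pos_op_def re_part_def)

lemma re_part_mono: "x \<le> y \<Longrightarrow> re_part x \<le> re_part y"
  using re_part_nonneg[of "y - x"] linear_simps(2)[OF re_part_bounded_linear] by simp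

lemma snd_real_zero: "snd (S (x, 0)) = 0"
proof -
  have "(x, 0::'a) = (pprt x, 0) - (- nprt x, 0)"
    using prts[of x] by simp
  then have "S (x, 0) = S (pprt x, 0) - S (- nprt x, 0)"
    using linear_simps(2)[OF lin] by metis
  moreover have "snd (S (pprt x, 0)) = 0" "snd (S (- nprt x, 0)) = 0"
    using pos by (simp_all add: pos_op_def)
  ultimately show ?thesis by simp
qed

lemma apply_eq: "S F = (re_part (fst F), re_part (snd F))"
proof -
  have F: "F = (fst F, 0) + cmult \<i> (snd F, 0)"
    by (simp add: cmult_def)
  have "S F = S (fst F, 0) + cmult \<i> (S (snd F, 0))"
    by (subst F) (simp add: linear_simps(1)[OF lin] cmult)
  then show ?thesis
    by (simp add: cmult_def re_part_def prod_eq_iff snd_real_zero)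
qed

lemma fst_cmult_apply_le: "fst (cmult c (S F)) \<le> cmod c *\<^sub>R re_part (modulus F)"
proof (cases "c = 0")
  case False
  define d where "d = c / cmod c"
  have d: "cmod d = 1" "c = complex_of_real (cmod c) * d"
    using False by (auto simp: d_def norm_divide)
  have "fst (cmult d (S F)) = re_part (fst (cmult d F))"
    using apply_eq[of "cmult d F"] cmult[of d F] by simp
  also have "\<dots> \<le> re_part (modulus F)"
    by (rule re_part_mono[OF modulus_ge[OF d(1)]])
  finally have "cmod c *\<^sub>R fst (cmult d (S F)) \<le> cmod c *\<^sub>R re_part (modulus F)"
    by (simp add: scaleR_left_mono)
  moreover have "cmult c (S F) = cmod c *\<^sub>R cmult d (S F)"
    by (subst d(2)) (simp add: cmult_cmult[symmetric] cmult_of_real)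
  ultimately show ?thesis by simp
qed simp

lemma norm_apply_le: "norm (S F) \<le> 2 * norm (re_part (modulus F))"
proof -
  have "modulus (S F) \<le> re_part (modulus F)"
    by (rule modulus_least) (use fst_cmult_apply_le in \<open>metis scaleR_one\<close>)
  then show ?thesis
    using norm_le_modulus[of "S F"] norm_mono_nonneg[OF modulus_nonneg[of "S F"]] by fastforce
qed

end

section \<open>Positivity carried down to the spectral radius\<close>

locale ev_pos_operator =
  fixes T :: "('a::banach_lattice \<times> 'a) \<Rightarrow>\<^sub>L ('a \<times> 'a)" and n0 :: nat
  assumes clin: "clinear_op T"
    and pos: "\<And>n. n \<ge> n0 \<Longrightarrow> pos_op (blinfun_apply T ^^ n)"
    and spec_radius_pos: "0 < spec_radius T"
begin

abbreviation "r \<equiv> spec_radius T"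

abbreviation "R \<equiv> resolvent T"

abbreviation "RR s \<equiv> resolvent T (complex_of_real s)"

abbreviation pow :: "nat \<Rightarrow> 'a \<times> 'a \<Rightarrow> 'a \<times> 'a"
  where "pow n \<equiv> blinfun_apply T ^^ n"

lemma pow_linear: "bounded_linear (pow n)"
  by (rule blinfun_funpow_linear)

lemma pow_pos: "n \<ge> n0 \<Longrightarrow> clinear_pos (pow n)"
  unfolding clinear_pos_def using pow_linear clinear_op_funpow[OF clin] pos by blast

lemma pow_pos_cone: "n \<ge> n0 \<Longrightarrow> F \<in> pos_cone \<Longrightarrow> pow n F \<in> pos_cone"
  using pos pos_op_iff by blast

lemma outside: "r < s \<Longrightarrow> complex_of_real s \<in> resolvent_set T"
  using spec_radius_pos by (intro resolvent_set_outside) auto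

text \<open>This is the largest subset of \<open>pos_cone\<close> that \<open>A\<close> maps into
  itself; it is a closed cone even if \<open>A\<close> is not positive.\<close>

definition orbit_cone :: "(('a \<times> 'a) \<Rightarrow>\<^sub>L ('a \<times> 'a)) \<Rightarrow> ('a \<times> 'a) set"
  where "orbit_cone A = {g. \<forall>j. (blinfun_apply A ^^ j) g \<in> pos_cone}"

lemma closed_orbit_cone: "closed (orbit_cone A)"
proof -
  have "orbit_cone A = (\<Inter>j. (blinfun_apply A ^^ j) -` pos_cone)"
    by (auto simp: orbit_cone_def)
  then show ?thesis
    by (auto intro!: closed_INT continuous_closed_vimage closed_pos_cone linear_continuous_at blinfun_funpow_linear)
qed

lemma orbit_cone_zero: "0 \<in> orbit_cone A"
  by (auto simp: orbit_cone_def linear_simps(3)[OF blinfun_funpow_linear] pos_cone_zero)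

lemma orbit_cone_add: "x \<in> orbit_cone A \<Longrightarrow> y \<in> orbit_cone A \<Longrightarrow> x + y \<in> orbit_cone A"
  by (auto simp: orbit_cone_def linear_simps(1)[OF blinfun_funpow_linear] pos_cone_add)

lemma orbit_cone_scaleR: "0 \<le> a \<Longrightarrow> x \<in> orbit_cone A \<Longrightarrow> a *\<^sub>R x \<in> orbit_cone A"
  by (auto simp: orbit_cone_def linear_simps(5)[OF blinfun_funpow_linear] pos_cone_scaleR)

lemma orbit_cone_apply: "x \<in> orbit_cone A \<Longrightarrow> blinfun_apply A x \<in> orbit_cone A"
  unfolding orbit_cone_def by (auto simp: funpow_Suc_right[symmetric, THEN fun_cong, unfolded o_apply] simp del: funpow.simps)

lemma orbit_cone_subset: "x \<in> orbit_cone A \<Longrightarrow> x \<in> pos_cone"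
  unfolding orbit_cone_def by (auto dest: spec[of _ 0])

lemma funpow_invariant: "(\<And>x. x \<in> C \<Longrightarrow> f x \<in> C) \<Longrightarrow> x \<in> C \<Longrightarrow> (f ^^ k) x \<in> C"
  by (induction k) auto

text \<open>\<open>RR s\<close> alone may fail to be positive, since the low powers of
  \<open>T\<close> enter its expansion. Asking for all iterates of \<open>RR s\<close> on the
  vectors \<open>pow n F\<close> puts these vectors into a closed cone that every convergent series
  in \<open>RR s\<close> with nonnegative coefficients preserves.\<close>

definition landau :: "real \<Rightarrow> bool"
  where "landau s \<longleftrightarrow> (\<forall>n\<ge>n0. \<forall>F\<in>pos_cone. pow n F \<in> orbit_cone (RR s))"

lemma landau_from_invariance:
  assumes C: "\<And>x. x \<in> C \<Longrightarrow> RR s x \<in> C" "C \<subseteq> pos_cone"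
    and "\<And>n F. n \<ge> n0 \<Longrightarrow> F \<in> pos_cone \<Longrightarrow> pow n F \<in> C"
  shows "landau s"
  unfolding landau_def orbit_cone_def
  using assms(3) funpow_invariant[of C "blinfun_apply (RR s)", OF C(1)] C(2) by blast

text \<open>For large \<open>s\<close> the resolvent is a series in \<open>T\<close> with
  nonnegative coefficients, so it preserves \<open>orbit_cone T\<close>, which contains the vectors
  \<open>pow n F\<close> by eventual positivity.\<close>

lemma landau_far:
  assumes "8 * norm T \<le> s" "0 < s"
  shows "landau s"
proof (rule landau_from_invariance)
  show "orbit_cone T \<subseteq> pos_cone"
    using orbit_cone_subset by blast
  show "pow n F \<in> orbit_cone T" if "n \<ge> n0" "F \<in> pos_cone" for n F
    unfolding orbit_cone_def using that pow_pos_cone[of "_ + n"] by (auto simp: funpow_add)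
  fix x assume x: "x \<in> orbit_cone T"
  define z where "z = complex_of_real s"
  have z: "z \<noteq> 0" "8 * norm T \<le> cmod z" using assms by (auto simp: z_def)
  have iz: "inverse z = complex_of_real (inverse s)" by (simp add: z_def)
  have "R z x \<in> orbit_cone T"
  proof (rule sums_in_closed_cone[OF closed_orbit_cone orbit_cone_zero orbit_cone_add resolvent_far(2)[OF z]])
    fix k
    have "cmult (inverse z) x \<in> orbit_cone T"
      unfolding iz cmult_of_real using x assms by (intro orbit_cone_scaleR) auto
    then show "(blinfun_apply (cscal (inverse z) o\<^sub>L T) ^^ k) (cmult (inverse z) x) \<in> orbit_cone T"
    proof (rule funpow_invariant[rotated])
      show "(cscal (inverse z) o\<^sub>L T) y \<in> orbit_cone T" if "y \<in> orbit_cone T" for y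
        unfolding blinfun_apply_blinfun_compose blinfun_apply_cscal iz cmult_of_real
        using assms that by (intro orbit_cone_scaleR orbit_cone_apply) auto
    qed
  qed
  then show "RR s x \<in> orbit_cone T"
    by (simp add: z_def orbit_cone_def)
qed

text \<open>The product norm is homogeneous under real scalars, so the factor 4 of
  \<open>norm_cscal_le\<close> does not appear.\<close>

lemma norm_resolvent_real_step:
  "\<bar>h\<bar> * norm (R z) \<le> 1 / 2 \<Longrightarrow> norm (R z o\<^sub>L cscal (complex_of_real h)) \<le> 1 / 2"
  by (rule order_trans[OF norm_blinfun_bound[of "\<bar>h\<bar> * norm (R z)"]])
    (auto simp: cmult_of_real blinfun.scaleR_right mult.assoc intro!: mult_left_mono norm_blinfun)

text \<open>\<open>RR (t - h)\<close> is the sum over \<open>k\<close> of \<open>h ^ k\<close> times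
  the power \<open>Suc k\<close> of \<open>RR t\<close>. The coefficients are nonnegative, so it
  maps \<open>orbit_cone (RR t)\<close> into itself.\<close>

lemma landau_step:
  assumes t: "r < t" "landau t" and h: "0 \<le> h" "h * norm (RR t) \<le> 1 / 2"
  shows "landau (t - h)"
proof (rule landau_from_invariance)
  let ?A = "RR t"
  show "orbit_cone ?A \<subseteq> pos_cone" using orbit_cone_subset by blast
  show "pow n F \<in> orbit_cone ?A" if "n \<ge> n0" "F \<in> pos_cone" for n F
    using t that by (auto simp: landau_def)
  fix x assume x: "x \<in> orbit_cone ?A"
  have "R (complex_of_real t - complex_of_real h) x \<in> orbit_cone ?A"
  proof (rule sums_in_closed_cone[OF closed_orbit_cone orbit_cone_zero orbit_cone_add
        resolvent_perturbation(3)[OF outside[OF t(1)] norm_resolvent_real_step]])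
    show "\<bar>h\<bar> * norm (RR t) \<le> 1 / 2" using h by simp
    fix k
    show "(blinfun_apply (?A o\<^sub>L cscal (complex_of_real h)) ^^ k) (?A x) \<in> orbit_cone ?A"
      by (rule funpow_invariant[OF _ orbit_cone_apply[OF x]])
        (use h in \<open>auto simp: cmult_of_real intro!: orbit_cone_scaleR orbit_cone_apply\<close>)
  qed
  then show "RR (t - h) x \<in> orbit_cone ?A" by simp
qed

text \<open>The admissible step length in the previous lemma is locally bounded below, so going down from
  large \<open>s\<close> cannot stop before the spectral radius.\<close>
lemma landau_all:
  assumes "r < s"
  shows "landau s"
proof (rule ccontr)
  assume ns: "\<not> landau s"
  define B where "B = {t. r < t \<and> \<not> landau t}"
  have sB: "s \<in> B" using ns assms by (simp add: B_def)
  have bd: "bdd_above B"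
  proof (rule bdd_aboveI)
    fix t assume "t \<in> B"
    then have "\<not> 8 * norm T \<le> t" using landau_far[of t] spec_radius_pos by (auto simp: B_def)
    then show "t \<le> 8 * norm T" by simp
  qed
  define a where "a = Sup B"
  have a: "r < a" using cSup_upper[OF sB bd] assms by (simp add: a_def)
  define M where "M = norm (RR a)"
  \<comment> \<open>The bound \<open>d * M \<le> 1 / 4\<close> serves twice: it keeps the norm of
    the resolvent below \<open>2 * M\<close> between \<open>a\<close> and \<open>a + d\<close>, and
    it makes downward steps of length at most \<open>d\<close> from there admissible.\<close>
  define d where "d = min (1 / (4 * M + 1)) ((a - r) / 2)"
  have M0: "0 \<le> M" by (simp add: M_def)
  have d: "0 < d" "d * M \<le> 1 / 4" "d < a - r"
  proof -
    show "0 < d" "d < a - r" using a M0 by (auto simp: d_def min_def)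
    have "d * M \<le> 1 / (4 * M + 1) * M" using M0 by (intro mult_right_mono) (auto simp: d_def)
    also have "\<dots> \<le> 1 / 4" using M0 by (simp add: field_simps)
    finally show "d * M \<le> 1 / 4" .
  qed
  have bound: "norm (RR (a + h)) \<le> 2 * M" if "0 \<le> h" "h \<le> d" for h
  proof -
    have "h * M \<le> 1 / 2" using mult_right_mono[OF that(2) M0] d(2) by linarith
    then have "norm (RR a o\<^sub>L cscal (complex_of_real (- h))) \<le> 1 / 2"
      using that(1) by (intro norm_resolvent_real_step) (simp add: M_def)
    from resolvent_perturbation(2)[OF outside[OF a] this] show ?thesis
      by (simp add: M_def)
  qed
  obtain b where b: "b \<in> B" "a - d / 4 < b"
    using less_cSup_iff[of B "a - d / 4"] sB bd d(1) by (auto simp: a_def)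
  have ba: "b \<le> a" using cSup_upper[OF b(1) bd] by (simp add: a_def)
  \<comment> \<open>Above the supremum of the failing points the property holds, and a step of
    length less than \<open>d / 2\<close> leads from there down to the failing point
    \<open>b\<close>.\<close>
  have "landau (a + d / 4)"
  proof (rule ccontr)
    assume "\<not> landau (a + d / 4)"
    then have "a + d / 4 \<in> B" using a d by (simp add: B_def)
    from cSup_upper[OF this bd] d(1) show False by (simp add: a_def)
  qed
  then have "landau ((a + d / 4) - (a + d / 4 - b))"
  proof (rule landau_step[rotated])
    show "r < a + d / 4" "0 \<le> a + d / 4 - b" using a d ba by auto
    have "(a + d / 4 - b) * norm (RR (a + d / 4)) \<le> d * (2 * M)"
      using b ba d by (intro mult_mono bound) auto
    then show "(a + d / 4 - b) * norm (RR (a + d / 4)) \<le> 1 / 2"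
      using d(2) by linarith
  qed
  then show False using b(1) by (simp add: B_def)
qed

lemma resolvent_pow_pos_cone:
  "r < s \<Longrightarrow> n \<ge> n0 \<Longrightarrow> F \<in> pos_cone \<Longrightarrow> RR s (pow n F) \<in> pos_cone"
  using landau_all[of s] unfolding landau_def by (blast intro: orbit_cone_subset orbit_cone_apply)

end

section \<open>Growth of the powers and domination of the complex resolvent\<close>

context ev_pos_operator
begin

text \<open>Stopping after \<open>N\<close> terms with an explicit remainder makes the expansion
  valid at every nonzero point of the resolvent set, before any convergence is known.\<close>

lemma resolvent_expand_sum:
  assumes "z \<in> resolvent_set T" "z \<noteq> 0"
  shows "R z g = (\<Sum>k<N. cmult (inverse z ^ Suc k) (pow k g)) + cmult (inverse z ^ N) (R z (pow N g))"
proof (induction N)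
  case (Suc N)
  have "R z h = cmult (inverse z) h + cmult (inverse z) (R z (T h))" for h
  proof -
    have "cmult z (R z h) = h + R z (T h)"
      using resolvent_right[OF assms(1), of h] resolvent_commute[OF clin assms(1), of h]
      by (simp add: algebra_simps)
    then have "cmult (inverse z) (cmult z (R z h)) = cmult (inverse z) (h + R z (T h))" by simp
    then show ?thesis using assms(2) by (simp add: cmult_cmult cmult_add_right)
  qed
  from this[of "pow N g"] have "cmult (inverse z ^ N) (R z (pow N g)) =
      cmult (inverse z ^ Suc N) (pow N g) + cmult (inverse z ^ Suc N) (R z (pow (Suc N) g))"
    by (simp add: cmult_add_right cmult_cmult mult.commute)
  with Suc show ?case by simp
qed simp

lemma partial_sums_le_resolvent:
  assumes "r < u" "0 \<le> f"
  shows "(\<Sum>k<N. inverse u ^ Suc k *\<^sub>R fst (pow (k + n0) (f, 0))) \<le> fst (RR u (pow n0 (f, 0)))"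
proof -
  have u: "0 < u" using assms spec_radius_pos by simp
  have iu: "inverse (complex_of_real u) ^ k = complex_of_real (inverse u ^ k)" for k by simp
  have "RR u (pow (N + n0) (f, 0)) \<in> pos_cone"
    using assms by (intro resolvent_pow_pos_cone pos_coneI) auto
  then have "0 \<le> inverse u ^ N *\<^sub>R fst (RR u (pow (N + n0) (f, 0)))"
    using u by (auto simp: pos_cone_def intro!: scaleR_nonneg_nonneg)
  moreover have "fst (RR u (pow n0 (f, 0))) =
      (\<Sum>k<N. inverse u ^ Suc k *\<^sub>R fst (pow (k + n0) (f, 0))) +
      inverse u ^ N *\<^sub>R fst (RR u (pow (N + n0) (f, 0)))"
    using resolvent_expand_sum[OF outside[OF assms(1)], of "pow n0 (f, 0)" N] u
    unfolding iu cmult_of_real by (simp add: fst_sum funpow_add)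
  ultimately show ?thesis by simp
qed

text \<open>One summand is below the whole positive partial sum, which the resolvent at
  \<open>u\<close> bounds. This growth estimate takes the place of the spectral radius
  formula.\<close>

lemma norm_pow_le:
  assumes u: "r < u"
  obtains C where "\<And>k F. norm (pow (k + n0) F) \<le> C * u ^ Suc k * norm F"
proof
  fix k and F :: "'a \<times> 'a"
  interpret clinear_pos "pow (k + n0)" by (rule pow_pos) simp
  have u0: "0 < u" using assms spec_radius_pos by simp
  let ?m = "modulus F" and ?R = "RR u"
  have nn: "0 \<le> inverse u ^ Suc j *\<^sub>R fst (pow (j + n0) (?m, 0))" for j
    using pow_pos_cone[of "j + n0" "(?m, 0)"] u0 by (auto simp: pos_cone_def intro!: scaleR_nonneg_nonneg)
  have "inverse u ^ Suc k *\<^sub>R fst (pow (k + n0) (?m, 0)) \<le>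
      (\<Sum>j<Suc k. inverse u ^ Suc j *\<^sub>R fst (pow (j + n0) (?m, 0)))"
    using nn by (simp add: sum_nonneg)
  also have "\<dots> \<le> fst (?R (pow n0 (?m, 0)))"
    by (rule partial_sums_le_resolvent[OF u modulus_nonneg])
  finally have "norm (inverse u ^ Suc k *\<^sub>R fst (pow (k + n0) (?m, 0))) \<le> norm (fst (?R (pow n0 (?m, 0))))"
    by (rule norm_mono_nonneg[OF nn])
  also have "\<dots> \<le> norm (?R (pow n0 (?m, 0)))"
    using norm_fst_le[of "fst (?R (pow n0 (?m, 0)))" "snd (?R (pow n0 (?m, 0)))"] by simp
  also have "\<dots> \<le> norm ?R * (norm T ^ n0 * norm (?m, 0::'a))"
    by (rule order_trans[OF norm_blinfun mult_left_mono[OF norm_blinfun_funpow_le]]) simp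
  also have "\<dots> \<le> norm ?R * (norm T ^ n0 * (2 * norm F))"
    using norm_modulus_le[of F] by (intro mult_left_mono) (auto simp: norm_Pair)
  finally have "norm (re_part ?m) \<le> u ^ Suc k * (norm ?R * (norm T ^ n0 * (2 * norm F)))"
    using u0 by (simp add: re_part_def power_inverse field_simps)
  then show "norm (pow (k + n0) F) \<le> (4 * norm ?R * norm T ^ n0) * u ^ Suc k * norm F"
    using norm_apply_le[of F] by (simp add: mult_ac)
qed

text \<open>The growth bound for some \<open>u\<close> strictly between \<open>r\<close> and
  \<open>cmod z\<close> makes the expansion at \<open>z\<close> converge. Its terms are dominated
  through the modulus, and the resulting real partial sums stay below the real resolvent.\<close>

lemma resolvent_domination:
  assumes z: "r < cmod z" and c: "cmod c = 1"
  shows "fst (cmult c (R z (pow n0 F))) \<le> fst (RR (cmod z) (pow n0 (modulus F, 0)))"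
proof -
  define u where "u = (r + cmod z) / 2"
  have u: "r < u" "u < cmod z" "0 < u" using z spec_radius_pos by (auto simp: u_def)
  obtain C where C: "\<And>k F. norm (pow (k + n0) F) \<le> C * u ^ Suc k * norm F"
    using norm_pow_le[OF u(1)] by blast
  have z0: "z \<noteq> 0" "z \<in> resolvent_set T"
    using z spec_radius_pos resolvent_set_outside by auto
  define rest where "rest N = cmult (inverse z ^ N) (R z (pow N (pow n0 F)))" for N
  define a where "a N = (\<Sum>k<N. cmult (inverse z ^ Suc k) (pow k (pow n0 F)))" for N
  have split: "R z (pow n0 F) = a N + rest N" for N
    unfolding a_def rest_def by (rule resolvent_expand_sum[OF z0(2,1)])
  have "rest \<longlonglongrightarrow> 0"
  proof (rule tendsto_norm_zero_cancel, rule tendsto_sandwich[OF _ _ tendsto_const])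
    let ?D = "4 * norm (R z) * C * u * norm F"
    have "norm (rest N) \<le> ?D * (u / cmod z) ^ N" for N
    proof -
      have "norm (rest N) \<le> 4 * cmod (inverse z ^ N) * (norm (R z) * (C * u ^ Suc N * norm F))"
        unfolding rest_def
        by (rule order_trans[OF norm_cmult_le mult_left_mono[OF order_trans[OF norm_blinfun mult_left_mono]]])
          (use C[of N F] in \<open>auto simp: funpow_add\<close>)
      then show ?thesis
        by (simp add: norm_power norm_inverse norm_divide power_divide power_inverse field_simps)
    qed
    then show "\<forall>\<^sub>F N in sequentially. norm (rest N) \<le> ?D * (u / cmod z) ^ N" by simp
    have "(\<lambda>N. (u / cmod z) ^ N) \<longlonglongrightarrow> 0"
      using u z0(1) by (intro LIMSEQ_power_zero) (auto simp: divide_less_eq_1)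
    from tendsto_mult[OF tendsto_const this] show "(\<lambda>N. ?D * (u / cmod z) ^ N) \<longlonglongrightarrow> 0" by simp
  qed simp
  then have "(\<lambda>N. R z (pow n0 F) - rest N) \<longlonglongrightarrow> R z (pow n0 F) - 0"
    by (intro tendsto_intros)
  moreover have "R z (pow n0 F) - rest N = a N" for N
    using split[of N] by simp
  ultimately have "a \<longlonglongrightarrow> R z (pow n0 F)" by simp
  then have lim: "(\<lambda>N. fst (cmult c (a N))) \<longlonglongrightarrow> fst (cmult c (R z (pow n0 F)))"
    by (intro tendsto_intros)
  have "fst (cmult c (a N)) \<le> fst (RR (cmod z) (pow n0 (modulus F, 0)))" for N
  proof -
    have "fst (cmult c (a N)) = (\<Sum>k<N. fst (cmult (c * inverse z ^ Suc k) (pow (k + n0) F)))"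
      unfolding a_def
      by (simp add: linear_sum[OF bounded_linear.linear[OF bounded_linear_cmult]] fst_sum cmult_cmult funpow_add)
    also have "\<dots> \<le> (\<Sum>k<N. inverse (cmod z) ^ Suc k *\<^sub>R fst (pow (k + n0) (modulus F, 0)))"
    proof (rule sum_mono)
      fix k
      interpret clinear_pos "pow (k + n0)" by (rule pow_pos) simp
      show "fst (cmult (c * inverse z ^ Suc k) (pow (k + n0) F))
          \<le> inverse (cmod z) ^ Suc k *\<^sub>R fst (pow (k + n0) (modulus F, 0))"
        using fst_cmult_apply_le[of "c * inverse z ^ Suc k" F] c
        by (simp add: re_part_def norm_mult norm_power norm_inverse)
    qed
    also have "\<dots> \<le> fst (RR (cmod z) (pow n0 (modulus F, 0)))"
      using z by (intro partial_sums_le_resolvent) auto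
    finally show ?thesis .
  qed
  then show ?thesis
    by (intro tendsto_le_lattice[OF lim tendsto_const]) auto
qed

text \<open>The scaled resolvent \<open>(s - r) w R(s w)\<close> splits into a part dominated by the real
  scaled resolvent and a part that vanishes as \<open>s\<close> tends to \<open>r\<close>.\<close>

definition main_part :: "complex \<Rightarrow> real \<Rightarrow> 'a \<times> 'a \<Rightarrow> 'a \<times> 'a"
  where "main_part w s f = cmult (complex_of_real (s - r) * w * inverse (complex_of_real s * w) ^ n0) (R (complex_of_real s * w) (pow n0 f))"

definition small_part :: "complex \<Rightarrow> real \<Rightarrow> 'a \<times> 'a \<Rightarrow> 'a \<times> 'a"
  where "small_part w s f = cmult (complex_of_real (s - r) * w) (\<Sum>k<n0. cmult (inverse (complex_of_real s * w) ^ Suc k) (pow k f))"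

definition small_bound :: "real \<Rightarrow> real"
  where "small_bound s = 4 * (s - r) * (\<Sum>k<n0. 4 * inverse s ^ Suc k * norm T ^ k)"

lemma scaled_resolvent_split:
  assumes "cmod w = 1" "r < s"
  shows "cmult (complex_of_real (s - r) * w) (R (complex_of_real s * w) f) = main_part w s f + small_part w s f"
proof -
  have "complex_of_real s * w \<noteq> 0" "complex_of_real s * w \<in> resolvent_set T"
    using assms spec_radius_pos by (auto intro!: resolvent_set_outside simp: norm_mult)
  from resolvent_expand_sum[OF this(2,1), of f n0] show ?thesis
    by (simp add: main_part_def small_part_def cmult_add_right cmult_cmult mult_ac)
qed

lemma small_part_le:
  assumes "cmod w = 1" "r < s"
  shows "norm (small_part w s f) \<le> small_bound s * norm f"
proof -
  have s: "0 < s" using assms spec_radius_pos by simp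
  have "norm (\<Sum>k<n0. cmult (inverse (complex_of_real s * w) ^ Suc k) (pow k f))
      \<le> (\<Sum>k<n0. 4 * inverse s ^ Suc k * norm T ^ k * norm f)"
  proof (rule sum_norm_le)
    fix k
    have "norm (cmult (inverse (complex_of_real s * w) ^ Suc k) (pow k f)) \<le> 4 * cmod (inverse (complex_of_real s * w) ^ Suc k) * (norm T ^ k * norm f)"
      by (rule order_trans[OF norm_cmult_le mult_left_mono[OF norm_blinfun_funpow_le]]) simp
    moreover have "cmod (inverse (complex_of_real s * w) ^ Suc k) = inverse s ^ Suc k"
      using assms s by (simp add: norm_power norm_inverse norm_mult del: power_Suc)
    ultimately show "norm (cmult (inverse (complex_of_real s * w) ^ Suc k) (pow k f)) \<le> 4 * inverse s ^ Suc k * norm T ^ k * norm f"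
      by (simp add: mult_ac)
  qed
  moreover have "norm (small_part w s f) \<le> 4 * (s - r) * norm (\<Sum>k<n0. cmult (inverse (complex_of_real s * w) ^ Suc k) (pow k f))"
    unfolding small_part_def
    by (rule order_trans[OF norm_cmult_le]) (use assms in \<open>simp add: norm_mult flip: of_real_diff\<close>)
  ultimately have "norm (small_part w s f) \<le> 4 * (s - r) * (\<Sum>k<n0. 4 * inverse s ^ Suc k * norm T ^ k * norm f)"
    by (elim order_trans) (use assms in \<open>intro mult_left_mono, auto\<close>)
  then show ?thesis
    by (simp add: small_bound_def sum_distrib_right mult.assoc)
qed

lemma small_bound_tendsto: "(small_bound \<longlongrightarrow> 0) (at_right r)"
proof -
  have "(small_bound \<longlongrightarrow> 4 * (r - r) * (\<Sum>k<n0. 4 * inverse r ^ Suc k * norm T ^ k)) (at_right r)"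
    unfolding small_bound_def[abs_def] using spec_radius_pos by (intro tendsto_intros) auto
  then show ?thesis by simp
qed

lemma main_part_le:
  assumes "cmod w = 1" "r < s" "cmod c = 1"
  shows "fst (cmult c (main_part w s f)) \<le>
    fst (((s - r) * inverse s ^ n0) *\<^sub>R RR s (pow n0 (modulus f, 0)))"
proof -
  have s: "0 < s" using assms spec_radius_pos by simp
  \<comment> \<open>All unimodular factors are collected in \<open>d\<close>, so that only a
    nonnegative real factor stays outside.\<close>
  define d where "d = c * (w * inverse w ^ n0)"
  have d: "cmod d = 1" using assms by (simp add: d_def norm_mult norm_power norm_inverse)
  have "c * (complex_of_real (s - r) * w * inverse (complex_of_real s * w) ^ n0) = complex_of_real ((s - r) * inverse s ^ n0) * d"
    by (simp add: d_def power_mult_distrib)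
  then have "cmult c (main_part w s f) = cmult (complex_of_real ((s - r) * inverse s ^ n0) * d) (R (complex_of_real s * w) (pow n0 f))"
    unfolding main_part_def cmult_cmult by (rule arg_cong)
  then have "fst (cmult c (main_part w s f)) = ((s - r) * inverse s ^ n0) *\<^sub>R fst (cmult d (R (complex_of_real s * w) (pow n0 f)))"
    unfolding cmult_cmult[symmetric] cmult_of_real by simp
  also have "\<dots> \<le> ((s - r) * inverse s ^ n0) *\<^sub>R fst (R (complex_of_real (cmod (complex_of_real s * w))) (pow n0 (modulus f, 0)))"
    using assms s d by (intro scaleR_left_mono resolvent_domination) (auto simp: norm_mult)
  finally show ?thesis using assms s by (simp add: norm_mult)
qed

end

section \<open>The spectral projection at the spectral radius\<close>

locale ev_pos_pole = ev_pos_operator +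
  assumes pole: "simple_pole T (complex_of_real (spec_radius T))"
begin

definition P :: "('a \<times> 'a) \<Rightarrow>\<^sub>L ('a \<times> 'a)"
  where "P = spectral_proj T (complex_of_real r)"

text \<open>The limit at the pole is restricted to real \<open>s > r\<close>, where the positivity
  and domination results hold.\<close>

lemma real_resolvent_tendsto: "((\<lambda>s. (s - r) *\<^sub>R RR s) \<longlongrightarrow> P) (at_right r)"
proof -
  obtain P' where P': "((\<lambda>l. cscal (l - complex_of_real r) o\<^sub>L R l) \<longlongrightarrow> P') (at (complex_of_real r))"
    using pole by (auto simp: simple_pole_def)
  then have "P = P'"
    unfolding P_def spectral_proj_def by (intro tendsto_Lim) auto
  have "filterlim complex_of_real (at (complex_of_real r)) (at_right r)"
    by (auto simp: filterlim_at eventually_at_filter intro!: tendsto_intros)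
  from filterlim_compose[OF P' this] have "((\<lambda>s. cscal (complex_of_real s - complex_of_real r) o\<^sub>L RR s) \<longlongrightarrow> P) (at_right r)"
    unfolding \<open>P = P'\<close> .
  moreover have "cscal (complex_of_real s - complex_of_real r) o\<^sub>L RR s = (s - r) *\<^sub>R RR s" for s
    by (rule blinfun_eqI) (simp add: cmult_of_real blinfun.scaleR_left flip: of_real_diff)
  ultimately show ?thesis by simp
qed

lemma real_resolvent_apply_tendsto:
  "((\<lambda>s. (s - r) *\<^sub>R RR s f) \<longlongrightarrow> P f) (at_right r)"
  using bounded_linear.tendsto[OF blinfun.bounded_linear_left[of f] real_resolvent_tendsto]
  by (simp add: blinfun.scaleR_left)

lemma norm_apply_pow_le: "norm (blinfun_apply A (pow n g)) \<le> norm A * (norm T ^ n * norm g)"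
  by (rule order_trans[OF norm_blinfun mult_left_mono[OF norm_blinfun_funpow_le]]) simp

lemma right_eventually: "\<forall>\<^sub>F s in at_right r. r < s"
  by (simp add: eventually_at_right_less)

lemma P_cmult: "P (cmult c f) = cmult c (P f)"
proof (rule tendsto_unique[OF _ real_resolvent_apply_tendsto])
  have "\<forall>\<^sub>F s in at_right r. cmult c ((s - r) *\<^sub>R RR s f) = (s - r) *\<^sub>R RR s (cmult c f)"
    using right_eventually by eventually_elim (simp add: cmult_scaleR resolvent_cmult[OF clin outside])
  from Lim_transform_eventually[OF tendsto_cmult[OF real_resolvent_apply_tendsto] this]
  show "((\<lambda>s. (s - r) *\<^sub>R RR s (cmult c f)) \<longlongrightarrow> cmult c (P f)) (at_right r)" .
qed simp

lemma T_P: "T (P f) = r *\<^sub>R P f"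
proof (rule tendsto_unique)
  show "((\<lambda>s. T ((s - r) *\<^sub>R RR s f)) \<longlongrightarrow> T (P f)) (at_right r)"
    by (rule bounded_linear.tendsto[OF blinfun.bounded_linear_right real_resolvent_apply_tendsto])
  have "((\<lambda>s. s *\<^sub>R ((s - r) *\<^sub>R RR s f) - (s - r) *\<^sub>R f) \<longlongrightarrow> r *\<^sub>R P f - (r - r) *\<^sub>R f) (at_right r)"
    by (intro tendsto_intros real_resolvent_apply_tendsto)
  then have "((\<lambda>s. s *\<^sub>R ((s - r) *\<^sub>R RR s f) - (s - r) *\<^sub>R f) \<longlongrightarrow> r *\<^sub>R P f) (at_right r)"
    by simp
  moreover have "\<forall>\<^sub>F s in at_right r. s *\<^sub>R ((s - r) *\<^sub>R RR s f) - (s - r) *\<^sub>R f = T ((s - r) *\<^sub>R RR s f)"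
    using right_eventually
  proof eventually_elim
    case (elim s)
    have "T (RR s f) = s *\<^sub>R RR s f - f"
      using resolvent_right[OF outside[OF elim], of f] by (simp add: cmult_of_real algebra_simps)
    then show ?case by (simp add: blinfun.scaleR_right scaleR_diff_right mult.commute)
  qed
  ultimately show "((\<lambda>s. T ((s - r) *\<^sub>R RR s f)) \<longlongrightarrow> r *\<^sub>R P f) (at_right r)"
    by (rule Lim_transform_eventually)
qed simp

lemma P_T: "P (T f) = r *\<^sub>R P f"
proof (rule tendsto_unique[OF _ real_resolvent_apply_tendsto])
  have "((\<lambda>s. T ((s - r) *\<^sub>R RR s f)) \<longlongrightarrow> T (P f)) (at_right r)"
    by (rule bounded_linear.tendsto[OF blinfun.bounded_linear_right real_resolvent_apply_tendsto])
  moreover have "\<forall>\<^sub>F s in at_right r. T ((s - r) *\<^sub>R RR s f) = (s - r) *\<^sub>R RR s (T f)"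
    using right_eventually by eventually_elim (simp add: blinfun.scaleR_right resolvent_commute[OF clin outside])
  ultimately show "((\<lambda>s. (s - r) *\<^sub>R RR s (T f)) \<longlongrightarrow> r *\<^sub>R P f) (at_right r)"
    unfolding T_P by (rule Lim_transform_eventually)
qed simp

lemma P_pow: "P (pow n f) = r ^ n *\<^sub>R P f"
  by (induction n) (auto simp: P_T)

lemma P_idem: "P (P f) = P f"
proof (rule tendsto_unique[OF _ real_resolvent_apply_tendsto])
  have "\<forall>\<^sub>F s in at_right r. P f = (s - r) *\<^sub>R RR s (P f)"
    using right_eventually
  proof eventually_elim
    case (elim s)
    have "RR s (P f) = inverse (s - r) *\<^sub>R P f"
    proof (rule resolvent_eqI[OF outside[OF elim]])
      have "cmult (complex_of_real s) (inverse (s - r) *\<^sub>R P f) - T (inverse (s - r) *\<^sub>R P f) =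
          inverse (s - r) *\<^sub>R ((s - r) *\<^sub>R P f)"
        unfolding scaleR_diff_left by (simp add: cmult_of_real blinfun.scaleR_right T_P scaleR_diff_right mult.commute)
      then show "cmult (complex_of_real s) (inverse (s - r) *\<^sub>R P f) - T (inverse (s - r) *\<^sub>R P f) = P f"
        using elim by simp
    qed
    then show ?case using elim by simp
  qed
  from Lim_transform_eventually[OF tendsto_const this]
  show "((\<lambda>s. (s - r) *\<^sub>R RR s (P f)) \<longlongrightarrow> P f) (at_right r)" .
qed simp

text \<open>Positivity of the approximants is known only after \<open>pow n0\<close>. Since
  \<open>P (pow n0 F)\<close> is \<open>r ^ n0\<close> times \<open>P F\<close> and
  \<open>r > 0\<close>, the power can be divided out in the limit.\<close>

lemma P_pos_cone:
  assumes "F \<in> pos_cone"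
  shows "P F \<in> pos_cone"
proof -
  have "P (pow n0 F) \<in> pos_cone"
  proof (rule Lim_in_closed_set[OF closed_pos_cone _ _ real_resolvent_apply_tendsto])
    show "\<forall>\<^sub>F s in at_right r. (s - r) *\<^sub>R RR s (pow n0 F) \<in> pos_cone"
      using right_eventually by eventually_elim (use assms in \<open>auto intro!: pos_cone_scaleR resolvent_pow_pos_cone\<close>)
  qed simp
  then have "inverse (r ^ n0) *\<^sub>R P (pow n0 F) \<in> pos_cone"
    using spec_radius_pos by (intro pos_cone_scaleR) auto
  then show ?thesis
    using spec_radius_pos by (simp add: P_pow)
qed

sublocale PP: clinear_pos "blinfun_apply P"
proof (unfold clinear_pos_def, intro conjI allI)
  show "bounded_linear (blinfun_apply P)" by (rule blinfun.bounded_linear_right)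
  show "P (cmult c F) = cmult c (P F)" for c F by (rule P_cmult)
  show "pos_op (blinfun_apply P)" using P_pos_cone pos_op_iff by blast
qed

abbreviation p :: "'a \<Rightarrow> 'a"
  where "p \<equiv> PP.re_part"

lemma p_idem: "p (p x) = p x"
  using P_idem[of "(x, 0)"] PP.apply_eq[of "(x, 0)"] by (simp add: PP.apply_eq prod_eq_iff)

lemma p_linear: "bounded_linear p"
  by (rule PP.re_part_bounded_linear)

text \<open>If the limit vanished, \<open>s - r\<close> would be small against the inverse norm of
  \<open>RR s\<close> for some \<open>s\<close>, and the Neumann series at \<open>s\<close> would
  reach the spectral value \<open>r\<close>.\<close>

lemma P_nonzero: "P \<noteq> 0"
proof
  assume "P = 0"
  then have "((\<lambda>s. norm ((s - r) *\<^sub>R RR s)) \<longlongrightarrow> 0) (at_right r)"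
    using tendsto_norm[OF real_resolvent_tendsto] by simp
  then have "\<forall>\<^sub>F s in at_right r. norm ((s - r) *\<^sub>R RR s) < 1 / 2"
    by (rule order_tendstoD) simp
  then have "\<forall>\<^sub>F s in at_right r. r < s \<and> norm ((s - r) *\<^sub>R RR s) < 1 / 2"
    using right_eventually by eventually_elim simp
  from eventually_happens'[OF trivial_limit_at_right_real this]
  obtain s where s: "r < s" "norm ((s - r) *\<^sub>R RR s) < 1 / 2" by blast
  have "complex_of_real s - complex_of_real (s - r) \<in> resolvent_set T"
    by (rule resolvent_perturbation(1)[OF outside[OF s(1)] norm_resolvent_real_step]) (use s in auto)
  then show False
    using pole by (simp add: simple_pole_def spectrum_def)
qed

text \<open>If \<open>T f\<close> is close to \<open>r w f\<close>, then \<open>f\<close> is close to its image under the scaled resolvent, whose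
  modulus is dominated by a positive operator close to the projection.\<close>
lemma modulus_almost_subinvariant:
  assumes w: "cmod w = 1" and e: "0 < e"
  obtains C where "0 \<le> C" "\<And>f. norm (pprt (modulus f - p (modulus f))) \<le> e * norm f + C * norm (cmult (complex_of_real r * w) f - T f)"
proof -
  \<comment> \<open>\<open>q s\<close> bounds the operator norm distance between \<open>P\<close>
    and the dominating operator \<open>(s - r) * inverse s ^ n0\<close> times \<open>RR s\<close>
    after \<open>pow n0\<close>; its second summand comes from \<open>P_pow\<close>.\<close>
  define q where "q s = inverse s ^ n0 * norm ((s - r) *\<^sub>R RR s - P) * norm T ^ n0 +
      \<bar>inverse s ^ n0 * r ^ n0 - 1\<bar> * norm P" for s
  define t where "t s = 2 * q s + 2 * small_bound s" for s
  have "((\<lambda>s. norm ((s - r) *\<^sub>R RR s - P)) \<longlongrightarrow> 0) (at_right r)"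
    using LIM_zero[OF real_resolvent_tendsto] tendsto_norm_zero by blast
  then have "(t \<longlongrightarrow> 2 * (inverse r ^ n0 * 0 * norm T ^ n0 + \<bar>inverse r ^ n0 * r ^ n0 - 1\<bar> * norm P) + 2 * 0) (at_right r)"
    unfolding t_def[abs_def] q_def using spec_radius_pos by (intro tendsto_intros small_bound_tendsto) auto
  then have "(t \<longlongrightarrow> 0) (at_right r)"
    using spec_radius_pos by (simp add: power_inverse)
  then have "\<forall>\<^sub>F s in at_right r. t s < e"
    using e by (rule order_tendstoD)
  then have "\<forall>\<^sub>F s in at_right r. r < s \<and> t s < e"
    using right_eventually by eventually_elim simp
  from eventually_happens'[OF trivial_limit_at_right_real this]
  obtain s where s: "r < s" "t s < e" by blast
  have s0: "0 < s" using s spec_radius_pos by simp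
  let ?z = "complex_of_real s * w"
  have z: "?z \<in> resolvent_set T" using s w s0 by (intro resolvent_set_outside) (simp add: norm_mult)
  show thesis
  proof
    \<comment> \<open>The constant is twice the resolvent norm at one point \<open>?z\<close> that
      is chosen for \<open>e\<close>. It may blow up as \<open>e\<close> tends to 0, which is
      harmless along sequences whose defect vanishes.\<close>
    show "0 \<le> 2 * norm (R ?z)" by simp
    fix f :: "'a \<times> 'a"
    define m where "m = modulus f"
    define b where "b = small_part w s f + R ?z (cmult (complex_of_real r * w) f - T f)"
    define a where "a = ((s - r) * inverse s ^ n0) *\<^sub>R RR s (pow n0 (m, 0))"
    have f: "f = main_part w s f + b"
    proof -
      have "R ?z (cmult ?z f - T f) = f" by (rule resolvent_eqI[OF z refl])
      moreover have "cmult ?z f - T f = cmult (complex_of_real (s - r) * w) f + (cmult (complex_of_real r * w) f - T f)"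
        by (simp add: cmult_diff_left left_diff_distrib)
      ultimately have "f = cmult (complex_of_real (s - r) * w) (R ?z f) + R ?z (cmult (complex_of_real r * w) f - T f)"
        using resolvent_cmult[OF clin z] by (simp add: blinfun.add_right)
      then show ?thesis
        unfolding scaled_resolvent_split[OF w s(1)] b_def by (simp only: add.assoc)
    qed
    have "m \<le> fst a + (lat_abs (fst b) + lat_abs (snd b))"
      unfolding m_def
    proof (rule modulus_least)
      fix c :: complex assume c: "cmod c = 1"
      have "fst (cmult c f) = fst (cmult c (main_part w s f)) + fst (cmult c b)"
        by (subst f) (simp add: cmult_add_right)
      also have "\<dots> \<le> fst a + (lat_abs (fst b) + lat_abs (snd b))"
        using main_part_le[OF w s(1) c, of f] fst_cmult_le[of c b] c
        by (intro add_mono) (auto simp: a_def m_def)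
      finally show "fst (cmult c f) \<le> fst a + (lat_abs (fst b) + lat_abs (snd b))" .
    qed
    then have "m - p m \<le> (fst a - p m) + (lat_abs (fst b) + lat_abs (snd b))"
      by (simp add: algebra_simps)
    from norm_pprt_le[OF this]
    have "norm (pprt (m - p m)) \<le> norm (fst a - p m) + (norm (fst b) + norm (snd b))"
      by (smt (verit) norm_triangle_ineq norm_lat_abs)
    also have "norm (fst a - p m) \<le> norm (a - P (m, 0))"
      unfolding PP.re_part_def fst_diff[symmetric] by (metis norm_fst_le prod.collapse)
    also have "norm (a - P (m, 0)) \<le> q s * norm m"
    proof -
      let ?D = "(s - r) *\<^sub>R RR s - P"
      have "a - P (m, 0) = inverse s ^ n0 *\<^sub>R ?D (pow n0 (m, 0)) + (inverse s ^ n0 * r ^ n0 - 1) *\<^sub>R P (m, 0)"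
        by (simp add: a_def blinfun.diff_left blinfun.add_left blinfun.scaleR_left P_pow algebra_simps)
      also have "norm \<dots> \<le> inverse s ^ n0 * (norm ?D * (norm T ^ n0 * norm (m, 0::'a))) + \<bar>inverse s ^ n0 * r ^ n0 - 1\<bar> * (norm P * norm (m, 0::'a))"
        unfolding norm_scaleR
        by (rule order_trans[OF norm_triangle_ineq])
          (unfold norm_scaleR, rule add_mono[OF mult_mono[OF _ norm_apply_pow_le] mult_left_mono[OF norm_blinfun]],
            use s0 in auto)
      finally show ?thesis by (simp add: q_def norm_Pair algebra_simps)
    qed
    also have "q s * norm m \<le> q s * (2 * norm f)"
      unfolding m_def q_def using s0 by (intro mult_left_mono norm_modulus_le) auto
    also have "norm (fst b) + norm (snd b) \<le> 2 * norm b"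
      using norm_fst_le[of "fst b" "snd b"] norm_snd_le[of "snd b" "fst b"] by simp
    also have "norm b \<le> small_bound s * norm f + norm (R ?z) * norm (cmult (complex_of_real r * w) f - T f)"
      unfolding b_def by (intro norm_triangle_le add_mono small_part_le[OF w s(1)] norm_blinfun)
    finally have "norm (pprt (m - p m)) \<le> t s * norm f + 2 * norm (R ?z) * norm (cmult (complex_of_real r * w) f - T f)"
      by (simp add: t_def algebra_simps)
    also have "t s * norm f \<le> e * norm f" using s by (intro mult_right_mono) auto
    finally show "norm (pprt (modulus f - p (modulus f))) \<le> e * norm f + 2 * norm (R ?z) * norm (cmult (complex_of_real r * w) f - T f)"
      by (simp add: m_def)
  qed
qed

text \<open>The main part is dominated by the scaled real resolvent, which converges in norm and is
  therefore bounded near \<open>r\<close>. The factor 4 comes from passing to the modulus and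
  back.\<close>

lemma scaled_resolvent_bounded:
  assumes w: "cmod w = 1"
  obtains M where "\<forall>\<^sub>F s in at_right r. \<forall>f. norm (cmult (complex_of_real (s - r) * w) (R (complex_of_real s * w) f)) \<le> M * norm f"
proof -
  define q where "q s = 4 * (inverse s ^ n0 * norm ((s - r) *\<^sub>R RR s) * norm T ^ n0) + small_bound s" for s
  have "(q \<longlongrightarrow> 4 * (inverse r ^ n0 * norm P * norm T ^ n0) + 0) (at_right r)"
    unfolding q_def[abs_def] using spec_radius_pos
    by (intro tendsto_intros small_bound_tendsto real_resolvent_tendsto) auto
  then have "\<forall>\<^sub>F s in at_right r. q s < 4 * (inverse r ^ n0 * norm P * norm T ^ n0) + 1"
    by (rule order_tendstoD) simp
  then have "\<forall>\<^sub>F s in at_right r. \<forall>f. norm (cmult (complex_of_real (s - r) * w) (R (complex_of_real s * w) f))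
      \<le> (4 * (inverse r ^ n0 * norm P * norm T ^ n0) + 1) * norm f"
    using right_eventually
  proof eventually_elim
    case (elim s)
    have s0: "0 < s" using elim spec_radius_pos by simp
    show ?case
    proof
      fix f
      define a where "a = ((s - r) * inverse s ^ n0) *\<^sub>R RR s (pow n0 (modulus f, 0))"
      have "norm (main_part w s f) \<le> 2 * norm (modulus (main_part w s f))" by (rule norm_le_modulus)
      also have "norm (modulus (main_part w s f)) \<le> norm (fst a)"
        by (rule norm_mono_nonneg[OF modulus_nonneg modulus_least])
          (use main_part_le[OF w elim(2)] in \<open>simp add: a_def\<close>)
      also have "norm (fst a) \<le> norm a" using norm_fst_le[of "fst a" "snd a"] by simp
      also have "a = inverse s ^ n0 *\<^sub>R ((s - r) *\<^sub>R RR s) (pow n0 (modulus f, 0))"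
        by (simp add: a_def blinfun.scaleR_left mult.commute)
      also have "norm \<dots> \<le> inverse s ^ n0 * (norm ((s - r) *\<^sub>R RR s) * (norm T ^ n0 * norm (modulus f, 0::'a)))"
        unfolding norm_scaleR[of "inverse s ^ n0"]
        by (rule mult_mono[OF _ norm_apply_pow_le]) (use s0 in auto)
      also have "\<dots> \<le> inverse s ^ n0 * (norm ((s - r) *\<^sub>R RR s) * (norm T ^ n0 * (2 * norm f)))"
        using s0 norm_modulus_le[of f] by (intro mult_left_mono) (auto simp: norm_Pair)
      finally have "norm (main_part w s f) + norm (small_part w s f) \<le> q s * norm f"
        using small_part_le[OF w elim(2), of f] by (simp add: q_def algebra_simps)
      then have "norm (main_part w s f + small_part w s f) \<le> q s * norm f"
        by (rule norm_triangle_le)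
      also have "q s * norm f \<le> (4 * (inverse r ^ n0 * norm P * norm T ^ n0) + 1) * norm f"
        using elim by (intro mult_right_mono) auto
      finally show "norm (cmult (complex_of_real (s - r) * w) (R (complex_of_real s * w) f))
          \<le> (4 * (inverse r ^ n0 * norm P * norm T ^ n0) + 1) * norm f"
        unfolding scaled_resolvent_split[OF w elim(2)] .
    qed
  qed
  then show thesis by (rule that)
qed

end

section \<open>Lattice homomorphisms below a sublinear functional\<close>

text \<open>Only inequalities are asked, as these survive the infima taken below. For a monotone
  linear functional the last clause is the lattice homomorphism property, the reverse inequality
  being monotonicity.\<close>

definition sup_sublinear :: "'v::{real_vector,lattice} set \<Rightarrow> ('v \<Rightarrow> real) \<Rightarrow> bool"
  where "sup_sublinear V p \<longleftrightarrow> (\<forall>x\<in>V. \<forall>y\<in>V. p (x + y) \<le> p x + p y) \<and>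
    (\<forall>x\<in>V. \<forall>c>0. p (c *\<^sub>R x) \<le> c * p x) \<and> (\<forall>x\<in>V. \<forall>y\<in>V. p (sup x y) \<le> max (p x) (p y))"

locale sup_subspace =
  fixes V :: "'v::{real_vector,lattice} set"
  assumes V: "subspace V"
    and V_sup: "\<And>x y. x \<in> V \<Longrightarrow> y \<in> V \<Longrightarrow> sup x y \<in> V"
    and sup_add: "\<And>x y z :: 'v. sup x y + z = sup (x + z) (y + z)"
begin

lemma V_zero: "0 \<in> V" and V_add: "x \<in> V \<Longrightarrow> y \<in> V \<Longrightarrow> x + y \<in> V"
  and V_scaleR: "x \<in> V \<Longrightarrow> c *\<^sub>R x \<in> V"
  using V by (auto simp: subspace_def)

lemma V_minus: "x \<in> V \<Longrightarrow> - x \<in> V"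
  using V_scaleR[of x "-1"] by simp

context
  fixes p assumes p: "sup_sublinear V p"
begin

lemma sublin_add: "x \<in> V \<Longrightarrow> y \<in> V \<Longrightarrow> p (x + y) \<le> p x + p y"
  and sublin_sup: "x \<in> V \<Longrightarrow> y \<in> V \<Longrightarrow> p (sup x y) \<le> max (p x) (p y)"
  and sublin_scaleR_le: "x \<in> V \<Longrightarrow> 0 < c \<Longrightarrow> p (c *\<^sub>R x) \<le> c * p x"
  using p by (auto simp: sup_sublinear_def)

lemma sublin_zero: "p 0 = 0"
  using sublin_scaleR_le[OF V_zero, of 2] sublin_scaleR_le[OF V_zero, of "1/2"] by simp

lemma sublin_scaleR: "x \<in> V \<Longrightarrow> 0 \<le> c \<Longrightarrow> p (c *\<^sub>R x) = c * p x"
proof (cases "c = 0")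
  case False
  assume x: "x \<in> V" and "0 \<le> c"
  with False have c: "0 < c" by simp
  have "p (inverse c *\<^sub>R (c *\<^sub>R x)) \<le> inverse c * p (c *\<^sub>R x)"
    using c by (intro sublin_scaleR_le V_scaleR x) simp
  then have "c * p x \<le> p (c *\<^sub>R x)"
    using c by (simp add: field_simps)
  with sublin_scaleR_le[OF x c] show ?thesis by simp
qed (simp add: sublin_zero)

lemma sublin_minus_ge: "x \<in> V \<Longrightarrow> - p (- x) \<le> p x"
  using sublin_add[of x "- x"] V_minus[of x] sublin_zero by simp

text \<open>This is the Hahn-Banach shift: \<open>q z\<close> is the infimum over
  \<open>t \<ge> 0\<close> of \<open>p (z + t *\<^sub>R x) - t * p x\<close>. The expression
  decreases in \<open>t\<close>, so near-optimal parameters for two vectors may be replaced by the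
  larger one, which preserves the condition on suprema. The value \<open>t = 1\<close> gives the
  bound at \<open>- x\<close>.\<close>

lemma sublinear_shift:
  assumes x: "x \<in> V"
  obtains q where "sup_sublinear V q" "\<And>z. z \<in> V \<Longrightarrow> q z \<le> p z" "q (- x) \<le> - p x"
proof -
  define g where "g z t = p (z + t *\<^sub>R x) - t * p x" for z t
  define q where "q z = (INF t\<in>{0..}. g z t)" for z
  have g_ge: "- p (- z) \<le> g z t" if "z \<in> V" "t \<ge> 0" for z t
    using sublin_add[of "z + t *\<^sub>R x" "- z"] sublin_scaleR[OF x that(2)] that x
    by (simp add: g_def V_add V_scaleR V_minus)
  have bdd: "bdd_below (g z ` {0..})" if "z \<in> V" for z
    using g_ge[OF that] by (intro bdd_belowI2[where m = "- p (- z)"]) auto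
  have q_le: "q z \<le> g z t" if "z \<in> V" "t \<ge> 0" for z t
    unfolding q_def using bdd[OF that(1)] that(2) by (intro cINF_lower) auto
  have q_approx: "\<exists>t\<ge>0. g z t < q z + e" if "z \<in> V" "e > 0" for z e
    using cINF_less_iff[OF _ bdd[OF that(1)], of "q z + e"] that(2) by (auto simp: q_def)
  have g_mono: "g z t' \<le> g z t" if "z \<in> V" "0 \<le> t" "t \<le> t'" for z t t'
  proof -
    have "z + t' *\<^sub>R x = (z + t *\<^sub>R x) + (t' - t) *\<^sub>R x" by (simp add: algebra_simps)
    then have "p (z + t' *\<^sub>R x) \<le> p (z + t *\<^sub>R x) + p ((t' - t) *\<^sub>R x)"
      using sublin_add[of "z + t *\<^sub>R x" "(t' - t) *\<^sub>R x"] that x by (simp add: V_add V_scaleR add.assoc)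
    then show ?thesis
      using sublin_scaleR[OF x, of "t' - t"] that by (simp add: g_def algebra_simps)
  qed
  show thesis
  proof
    show "q z \<le> p z" if "z \<in> V" for z
      using q_le[OF that, of 0] by (simp add: g_def)
    show "q (- x) \<le> - p x"
      using q_le[OF V_minus[OF x], of 1] by (simp add: g_def sublin_zero)
    show "sup_sublinear V q"
      unfolding sup_sublinear_def
    proof (intro conjI ballI allI impI)
      fix y z assume yz: "y \<in> V" "z \<in> V"
      show "q (y + z) \<le> q y + q z"
      proof (rule field_le_epsilon)
        fix e :: real assume e: "e > 0"
        obtain t where t: "t \<ge> 0" "g y t < q y + e / 2" using q_approx[OF yz(1), of "e / 2"] e by auto
        obtain u where u: "u \<ge> 0" "g z u < q z + e / 2" using q_approx[OF yz(2), of "e / 2"] e by auto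
        have "g (y + z) (t + u) \<le> g y t + g z u"
          using sublin_add[of "y + t *\<^sub>R x" "z + u *\<^sub>R x"] yz x
          by (simp add: g_def V_add V_scaleR algebra_simps)
        with q_le[OF V_add[OF yz], of "t + u"] t u show "q (y + z) \<le> q y + q z + e" by simp
      qed
      show "q (sup y z) \<le> max (q y) (q z)"
      proof (rule field_le_epsilon)
        fix e :: real assume e: "e > 0"
        obtain t where t: "t \<ge> 0" "g y t < q y + e" using q_approx[OF yz(1) e] by auto
        obtain u where u: "u \<ge> 0" "g z u < q z + e" using q_approx[OF yz(2) e] by auto
        define s where "s = max t u"
        have "g (sup y z) s \<le> max (g y s) (g z s)"
          using sublin_sup[of "y + s *\<^sub>R x" "z + s *\<^sub>R x"] yz x
          by (auto simp: g_def V_add V_scaleR sup_add max_def split: if_splits)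
        moreover have "g y s \<le> g y t" "g z s \<le> g z u"
          using yz t(1) u(1) by (auto intro!: g_mono simp: s_def)
        moreover have "q (sup y z) \<le> g (sup y z) s"
          using t(1) by (intro q_le V_sup yz) (auto simp: s_def)
        ultimately show "q (sup y z) \<le> max (q y) (q z) + e"
          using t(2) u(2) by (auto simp: max_def split: if_splits)
      qed
    next
      fix y and c :: real assume y: "y \<in> V" and c: "0 < c"
      show "q (c *\<^sub>R y) \<le> c * q y"
      proof (rule field_le_epsilon)
        fix e :: real assume e: "e > 0"
        obtain t where t: "t \<ge> 0" "g y t < q y + e / c" using q_approx[OF y, of "e / c"] e c by auto
        have "q (c *\<^sub>R y) \<le> g (c *\<^sub>R y) (c * t)"
          using c t y by (intro q_le V_scaleR) auto
        also have "\<dots> = c * g y t"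
          using sublin_scaleR[of "y + t *\<^sub>R x" c] y x c by (simp add: g_def V_add V_scaleR algebra_simps)
        also have "\<dots> \<le> c * (q y + e / c)" using t c by simp
        also have "\<dots> = c * q y + e" using c by (simp add: algebra_simps)
        finally show "q (c *\<^sub>R y) \<le> c * q y + e" .
      qed
    qed
  qed
qed

text \<open>Zorn's lemma applies with pointwise infima of chains as lower bounds:
  \<open>- p (- z)\<close> keeps them finite, and the chain property yields one member that is
  nearly optimal at two points at once.\<close>

lemma ex_minimal_sublinear:
  obtains d where "sup_sublinear V d" "\<And>z. z \<in> V \<Longrightarrow> d z \<le> p z"
    "\<And>q z. sup_sublinear V q \<Longrightarrow> (\<And>z. z \<in> V \<Longrightarrow> q z \<le> d z) \<Longrightarrow> z \<in> V \<Longrightarrow> q z = d z"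
proof -
  \<comment> \<open>Values off \<open>V\<close> are set to 0, so that the order of functions on the
    whole type compares the functionals on \<open>V\<close> alone.\<close>
  define A where "A = {q. sup_sublinear V q \<and> (\<forall>z\<in>V. q z \<le> p z) \<and> (\<forall>z. z \<notin> V \<longrightarrow> q z = 0)}"
  have norm0: "sup_sublinear V (\<lambda>z. if z \<in> V then q z else 0)" if "sup_sublinear V q" for q
    using that by (simp add: sup_sublinear_def V_add V_scaleR V_sup)
  have "\<exists>m\<in>A. \<forall>a\<in>A. a \<le> m \<longrightarrow> a = m"
  proof (rule predicate_Zorn)
    show "partial_order_on A (relation_of (\<lambda>a b. b \<le> a) A)"
      by (auto simp: partial_order_on_def preorder_on_def refl_on_def trans_def antisym_def relation_of_def)
    fix C assume "C \<in> Chains (relation_of (\<lambda>a b. b \<le> a) A)"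
    then have C: "C \<subseteq> A" "\<And>a b. a \<in> C \<Longrightarrow> b \<in> C \<Longrightarrow> a \<le> b \<or> b \<le> a"
      by (auto simp: Chains_def relation_of_def)
    show "\<exists>u\<in>A. \<forall>a\<in>C. u \<le> a"
    proof (cases "C = {}")
      case True
      have "(\<lambda>z. if z \<in> V then p z else 0) \<in> A"
        using norm0[OF p] by (auto simp: A_def)
      with True show ?thesis by blast
    next
      case False
      define u where "u z = (if z \<in> V then (INF q\<in>C. q z) else 0)" for z
      have CA: "sup_sublinear V q" "z \<in> V \<Longrightarrow> q z \<le> p z" "z \<notin> V \<Longrightarrow> q z = 0" if "q \<in> C" for q z
        using that C(1) by (auto simp: A_def)
      have bdd: "bdd_below ((\<lambda>q. q z) ` C)" if "z \<in> V" for z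
      proof (rule bdd_belowI2)
        fix q assume q: "q \<in> C"
        have "- q (- z) \<le> q z"
          by (rule sup_subspace.sublin_minus_ge[OF sup_subspace_axioms CA(1)[OF q] that])
        with CA(2)[OF q V_minus[OF that]] show "- p (- z) \<le> q z" by linarith
      qed
      have u_le: "u z \<le> q z" if "z \<in> V" "q \<in> C" for z q
        unfolding u_def using that bdd[OF that(1)] by (auto intro: cINF_lower)
      have u_approx: "\<exists>q\<in>C. q z < u z + e" if "z \<in> V" "e > 0" for z e
        using cINF_less_iff[OF False bdd[OF that(1)], of "u z + e"] that by (auto simp: u_def)
      have low: "\<exists>q\<in>C. q \<le> q1 \<and> q \<le> q2" if "q1 \<in> C" "q2 \<in> C" for q1 q2
        using C(2)[OF that] that by auto
      have "sup_sublinear V u"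
        unfolding sup_sublinear_def
      proof (intro conjI ballI allI impI)
        fix y z assume yz: "y \<in> V" "z \<in> V"
        have common: "\<exists>q\<in>C. q y < u y + e \<and> q z < u z + e" if e: "e > 0" for e
        proof -
          obtain q1 q2 where q12: "q1 \<in> C" "q1 y < u y + e" "q2 \<in> C" "q2 z < u z + e"
            using u_approx[OF yz(1) e] u_approx[OF yz(2) e] by blast
          obtain q where q: "q \<in> C" "q \<le> q1" "q \<le> q2" using low[OF q12(1,3)] by blast
          show ?thesis using q(1) q12(2,4) le_funD[OF q(2), of y] le_funD[OF q(3), of z]
            by (intro bexI[of _ q] conjI) linarith+
        qed
        show "u (y + z) \<le> u y + u z"
        proof (rule field_le_epsilon)
          fix e :: real assume "e > 0"
          then obtain q where q: "q \<in> C" "q y < u y + e / 2" "q z < u z + e / 2"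
            using common[of "e / 2"] by auto
          moreover have "q (y + z) \<le> q y + q z"
            using CA(1)[OF q(1)] yz by (simp add: sup_sublinear_def)
          ultimately show "u (y + z) \<le> u y + u z + e"
            using u_le[OF V_add[OF yz] q(1)] by linarith
        qed
        show "u (sup y z) \<le> max (u y) (u z)"
        proof (rule field_le_epsilon)
          fix e :: real assume "e > 0"
          then obtain q where q: "q \<in> C" "q y < u y + e" "q z < u z + e"
            using common[of e] by auto
          moreover have "q (sup y z) \<le> max (q y) (q z)"
            using CA(1)[OF q(1)] yz by (simp add: sup_sublinear_def)
          ultimately show "u (sup y z) \<le> max (u y) (u z) + e"
            using u_le[OF V_sup[OF yz] q(1)] by linarith
        qed
      next
        fix y and c :: real assume y: "y \<in> V" and c: "0 < c"
        show "u (c *\<^sub>R y) \<le> c * u y"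
        proof (rule field_le_epsilon)
          fix e :: real assume "e > 0"
          then obtain q where q: "q \<in> C" "q y < u y + e / c"
            using u_approx[OF y, of "e / c"] c by auto
          have "u (c *\<^sub>R y) \<le> q (c *\<^sub>R y)" by (rule u_le[OF V_scaleR[OF y] q(1)])
          also have "\<dots> \<le> c * q y" using CA(1)[OF q(1)] y c by (simp add: sup_sublinear_def)
          also have "\<dots> \<le> c * (u y + e / c)" using q c by simp
          also have "\<dots> = c * u y + e" using c by (simp add: algebra_simps)
          finally show "u (c *\<^sub>R y) \<le> c * u y + e" .
        qed
      qed
      moreover have "u z \<le> p z" if "z \<in> V" for z
      proof -
        obtain q where q: "q \<in> C" using False by blast
        show ?thesis using u_le[OF that q] CA(2)[OF q that] by linarith
      qed
      ultimately have "u \<in> A" by (simp add: A_def u_def)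
      moreover have "u \<le> q" if "q \<in> C" for q
        using u_le[OF _ that] CA(3)[OF that] by (auto simp: le_fun_def u_def)
      ultimately show ?thesis by blast
    qed
  qed
  then obtain d where d: "d \<in> A" "\<And>a. a \<in> A \<Longrightarrow> a \<le> d \<Longrightarrow> a = d" by blast
  show thesis
  proof
    show "sup_sublinear V d" "\<And>z. z \<in> V \<Longrightarrow> d z \<le> p z" using d(1) by (auto simp: A_def)
    fix q z assume q: "sup_sublinear V q" "\<And>z. z \<in> V \<Longrightarrow> q z \<le> d z" and z: "z \<in> V"
    have "(\<lambda>z. if z \<in> V then q z else 0) = d"
    proof (rule d(2))
      show "(\<lambda>z. if z \<in> V then q z else 0) \<in> A"
        using norm0[OF q(1)] order_trans[OF q(2)] d(1) by (simp add: A_def)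
      show "(\<lambda>z. if z \<in> V then q z else 0) \<le> d"
        using q(2) d(1) by (auto simp: A_def le_fun_def)
    qed
    from fun_cong[OF this, of z] z show "q z = d z" by simp
  qed
qed

end

text \<open>A minimal functional among those that are sublinear and bounded by the maximum on suprema
  is linear: otherwise shifting it along some direction would make it smaller.\<close>
lemma ex_lattice_hom:
  assumes p: "sup_sublinear V p" and x0: "x0 \<in> V"
  obtains d where "\<And>x y. x \<in> V \<Longrightarrow> y \<in> V \<Longrightarrow> d (x + y) = d x + d y"
    "\<And>x c. x \<in> V \<Longrightarrow> d (c *\<^sub>R x) = c * d x"
    "\<And>x y. x \<in> V \<Longrightarrow> y \<in> V \<Longrightarrow> d (sup x y) \<le> max (d x) (d y)"
    "\<And>x. x \<in> V \<Longrightarrow> d x \<le> p x" "d x0 = p x0"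
proof -
  \<comment> \<open>The shift along \<open>x0\<close> precedes the minimisation: a linear
    \<open>d\<close> below \<open>q\<close> has \<open>d (- x0) \<le> - p x0\<close> and hence
    attains \<open>p\<close> at \<open>x0\<close>.\<close>
  obtain q where q: "sup_sublinear V q" "\<And>z. z \<in> V \<Longrightarrow> q z \<le> p z" "q (- x0) \<le> - p x0"
    using sublinear_shift[OF p x0] by blast
  obtain d where d: "sup_sublinear V d" "\<And>z. z \<in> V \<Longrightarrow> d z \<le> q z"
    "\<And>q z. sup_sublinear V q \<Longrightarrow> (\<And>z. z \<in> V \<Longrightarrow> q z \<le> d z) \<Longrightarrow> z \<in> V \<Longrightarrow> q z = d z"
    using ex_minimal_sublinear[OF q(1)] by blast
  have minus: "d (- x) = - d x" if x: "x \<in> V" for x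
  proof -
    obtain q' where q': "sup_sublinear V q'" "\<And>z. z \<in> V \<Longrightarrow> q' z \<le> d z" "q' (- x) \<le> - d x"
      using sublinear_shift[OF d(1) x] by blast
    have "q' (- x) = d (- x)" by (rule d(3)[OF q'(1,2) V_minus[OF x]])
    with q'(3) sublin_minus_ge[OF d(1) x] show ?thesis by linarith
  qed
  have add: "d (x + y) = d x + d y" if "x \<in> V" "y \<in> V" for x y
    using sublin_add[OF d(1) that] sublin_add[OF d(1) V_add[OF that] V_minus[OF that(2)]] minus[OF that(2)]
    by simp
  have scale: "d (c *\<^sub>R x) = c * d x" if x: "x \<in> V" for x c
  proof (cases "c \<ge> 0")
    case True then show ?thesis by (rule sublin_scaleR[OF d(1) x])
  next
    case False
    then have "d ((- c) *\<^sub>R x) = - c * d x" by (intro sublin_scaleR[OF d(1) x]) simp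
    with minus[OF V_scaleR[OF x, of c]] show ?thesis by simp
  qed
  have "d (- x0) \<le> - p x0" using d(2)[OF V_minus[OF x0]] q(3) by linarith
  then have "p x0 \<le> d x0" using minus[OF x0] by simp
  moreover have le: "d x \<le> p x" if "x \<in> V" for x using d(2)[OF that] q(2)[OF that] by linarith
  ultimately have "d x0 = p x0" using le[OF x0] by simp
  then show thesis
    using add scale sublin_sup[OF d(1)] le by (intro that[of d]) auto
qed

end

section \<open>Ultrafilters and finite dimension\<close>

text \<open>Smaller filters are finer, so ultrafilters are the minimal proper filters.\<close>

definition ultrafilter :: "'b filter \<Rightarrow> bool"
  where "ultrafilter U \<longleftrightarrow> U \<noteq> bot \<and> (\<forall>F. F \<noteq> bot \<longrightarrow> F \<le> U \<longrightarrow> F = U)"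

lemma ex_ultrafilter:
  assumes "F0 \<noteq> bot"
  obtains U where "U \<le> F0" "ultrafilter U"
proof -
  define A where "A = {F. F \<noteq> bot \<and> F \<le> F0}"
  have "\<exists>m\<in>A. \<forall>a\<in>A. a \<le> m \<longrightarrow> a = m"
  proof (rule predicate_Zorn)
    show "partial_order_on A (relation_of (\<lambda>a b. b \<le> a) A)"
      by (auto simp: partial_order_on_def preorder_on_def refl_on_def trans_def antisym_def relation_of_def)
    fix C assume "C \<in> Chains (relation_of (\<lambda>a b. b \<le> a) A)"
    then have C: "C \<subseteq> A" "\<And>a b. a \<in> C \<Longrightarrow> b \<in> C \<Longrightarrow> a \<le> b \<or> b \<le> a"
      by (auto simp: Chains_def relation_of_def)
    show "\<exists>u\<in>A. \<forall>a\<in>C. u \<le> a"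
    proof (cases "C = {}")
      case True
      then show ?thesis using assms by (auto simp: A_def)
    next
      case False
      have "eventually P (Inf C) \<longleftrightarrow> (\<exists>b\<in>C. eventually P b)" for P
      proof (rule eventually_Inf_base[OF False])
        fix F G assume "F \<in> C" "G \<in> C"
        then show "\<exists>x\<in>C. x \<le> inf F G" using C(2)[of F G] by auto
      qed
      then have "Inf C \<noteq> bot"
        using C(1) by (auto simp: trivial_limit_def A_def)
      moreover have "Inf C \<le> F0"
        using False C(1) by (auto simp: A_def intro: Inf_lower2)
      ultimately show ?thesis by (auto simp: A_def intro!: bexI[of _ "Inf C"] Inf_lower)
    qed
  qed
  then obtain U where "U \<in> A" "\<And>a. a \<in> A \<Longrightarrow> a \<le> U \<Longrightarrow> a = U" by blast
  then show thesis
    by (intro that[of U]) (auto simp: A_def ultrafilter_def)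
qed

lemma ultrafilter_cases:
  assumes "ultrafilter U"
  shows "eventually P U \<or> eventually (\<lambda>x. \<not> P x) U"
proof (cases "inf U (principal {x. P x}) = bot")
  case True
  then have "eventually (\<lambda>x. False) (inf U (principal {x. P x}))" by simp
  then show ?thesis by (auto simp: eventually_inf_principal)
next
  case False
  then have "inf U (principal {x. P x}) = U"
    using assms by (auto simp: ultrafilter_def)
  then have "U \<le> principal {x. P x}" by (metis inf_le2)
  then show ?thesis by (simp add: le_principal)
qed

lemma ultrafilter_compact_limit:
  assumes U: "ultrafilter U" and K: "compact K" "eventually (\<lambda>x. f x \<in> K) U"
  obtains l where "l \<in> K" "(f \<longlongrightarrow> l) U"
proof -
  have "filtermap f U \<noteq> bot" using U by (simp add: ultrafilter_def filtermap_bot_iff)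
  moreover have "eventually (\<lambda>x. x \<in> K) (filtermap f U)" using K(2) by (simp add: eventually_filtermap)
  ultimately obtain l where l: "l \<in> K" "inf (nhds l) (filtermap f U) \<noteq> bot"
    using K(1) unfolding compact_filter by blast
  have "(f \<longlongrightarrow> l) U"
  proof (rule topological_tendstoI)
    fix S assume S: "open S" "l \<in> S"
    show "eventually (\<lambda>x. f x \<in> S) U"
    proof (rule ccontr)
      assume "\<not> ?thesis"
      then have "eventually (\<lambda>x. x \<notin> S) (filtermap f U)"
        using ultrafilter_cases[OF U, of "\<lambda>x. f x \<in> S"] by (simp add: eventually_filtermap)
      moreover have "eventually (\<lambda>x. x \<in> S) (nhds l)" using S by (rule eventually_nhds_in_open)
      ultimately have "eventually (\<lambda>x. False) (inf (nhds l) (filtermap f U))"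
        unfolding eventually_inf by blast
      with l(2) show False by (simp add: trivial_limit_def)
    qed
  qed
  with l(1) show thesis by (rule that)
qed

lemma ultrafilter_real_limit:
  fixes f :: "'b \<Rightarrow> real"
  assumes "ultrafilter U" "eventually (\<lambda>x. \<bar>f x\<bar> \<le> B) U"
  obtains l where "(f \<longlongrightarrow> l) U"
  by (rule ultrafilter_compact_limit[OF assms(1), of "{-B..B}" f])
    (use assms(2) in \<open>auto elim: eventually_mono\<close>)

text \<open>Otherwise there are coefficients of absolute sum 1 whose combinations tend to 0. Their
  limits along an ultrafilter still have absolute sum 1 but combine to 0, against
  independence.\<close>

lemma coordinates_bounded:
  fixes B :: "'b::real_normed_vector set"
  assumes B: "finite B" "independent B"
  obtains C where "0 \<le> C" "\<And>c. (\<Sum>b\<in>B. \<bar>c b\<bar>) \<le> C * norm (\<Sum>b\<in>B. c b *\<^sub>R b)"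
proof -
  have "\<exists>C\<ge>0. \<forall>c. (\<Sum>b\<in>B. \<bar>c b\<bar>) \<le> C * norm (\<Sum>b\<in>B. c b *\<^sub>R b)"
  proof (rule ccontr)
    assume "\<not> ?thesis"
    then have "\<exists>c. (\<Sum>b\<in>B. \<bar>c b\<bar>) > real n * norm (\<Sum>b\<in>B. c b *\<^sub>R b)" for n
      by (auto simp: not_le dest: spec[of _ "real n"])
    then obtain c where c: "\<And>n. (\<Sum>b\<in>B. \<bar>c n b\<bar>) > real n * norm (\<Sum>b\<in>B. c n b *\<^sub>R b)" by metis
    define N where "N n = (\<Sum>b\<in>B. \<bar>c n b\<bar>)" for n
    have N: "N n > 0" for n
      unfolding N_def by (rule le_less_trans[OF _ c]) simp
    define a where "a n b = c n b / N n" for n b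
    have a1: "(\<Sum>b\<in>B. \<bar>a n b\<bar>) = 1" for n
    proof -
      have "(\<Sum>b\<in>B. \<bar>a n b\<bar>) = (\<Sum>b\<in>B. \<bar>c n b\<bar>) / N n"
        using N[of n] by (simp add: a_def abs_divide sum_divide_distrib)
      then show ?thesis using N[of n] by (simp add: N_def)
    qed
    have a_sum: "(\<Sum>b\<in>B. a n b *\<^sub>R b) = inverse (N n) *\<^sub>R (\<Sum>b\<in>B. c n b *\<^sub>R b)" for n
      by (simp add: a_def scaleR_sum_right divide_inverse mult.commute)
    have a2: "real n * norm (\<Sum>b\<in>B. a n b *\<^sub>R b) \<le> 1" for n
      using c[of n] N[of n] unfolding a_sum by (simp add: N_def[symmetric] field_simps)
    obtain U where U: "U \<le> sequentially" "ultrafilter U"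
      using ex_ultrafilter[of sequentially] by auto
    have "\<exists>l. ((\<lambda>n. a n b) \<longlongrightarrow> l) U" if "b \<in> B" for b
    proof -
      have "\<bar>a n b\<bar> \<le> 1" for n
        using member_le_sum[of b B "\<lambda>b. \<bar>a n b\<bar>"] that B(1) a1[of n] by simp
      then have "eventually (\<lambda>n. \<bar>a n b\<bar> \<le> 1) U" by simp
      from ultrafilter_real_limit[OF U(2) this] show ?thesis by blast
    qed
    then obtain l where l: "\<And>b. b \<in> B \<Longrightarrow> ((\<lambda>n. a n b) \<longlongrightarrow> l b) U" by metis
    have Ub: "U \<noteq> bot" using U(2) by (simp add: ultrafilter_def)
    have "((\<lambda>n. \<Sum>b\<in>B. \<bar>a n b\<bar>) \<longlongrightarrow> (\<Sum>b\<in>B. \<bar>l b\<bar>)) U"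
      by (intro tendsto_sum tendsto_rabs l)
    then have one: "(\<Sum>b\<in>B. \<bar>l b\<bar>) = 1"
      using a1 tendsto_unique[OF Ub _ tendsto_const] by simp
    have "(\<lambda>n. \<Sum>b\<in>B. a n b *\<^sub>R b) \<longlonglongrightarrow> 0"
    proof (rule tendsto_norm_zero_cancel, rule tendsto_sandwich[OF _ _ tendsto_const])
      show "(\<lambda>n. 1 / real n) \<longlonglongrightarrow> 0" by (rule lim_1_over_n)
      show "\<forall>\<^sub>F n in sequentially. norm (\<Sum>b\<in>B. a n b *\<^sub>R b) \<le> 1 / real n"
        using eventually_gt_at_top[of 0] by eventually_elim (use a2 in \<open>simp add: field_simps\<close>)
    qed simp
    then have "((\<lambda>n. \<Sum>b\<in>B. a n b *\<^sub>R b) \<longlongrightarrow> 0) U" using U(1) by (rule tendsto_mono[rotated])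
    moreover have "((\<lambda>n. \<Sum>b\<in>B. a n b *\<^sub>R b) \<longlongrightarrow> (\<Sum>b\<in>B. l b *\<^sub>R b)) U"
      by (intro tendsto_sum tendsto_scaleR l tendsto_const)
    ultimately have "(\<Sum>b\<in>B. l b *\<^sub>R b) = 0"
      using tendsto_unique[OF Ub] by blast
    then have "l b = 0" if "b \<in> B" for b
      using independentD[OF B(2,1) order_refl _ that] by blast
    with one show False by simp
  qed
  then show thesis using that by blast
qed

text \<open>Passing to the kernel of one functional costs at most one spanning vector. Linearity is
  asked on \<open>V\<close> only, because the functionals used later come from homomorphisms that
  are linear only on a subspace of sequences.\<close>

lemma spanned_of_separating_functionals:
  fixes \<phi> :: "'i \<Rightarrow> 'b::real_vector \<Rightarrow> real"
  assumes "finite I" "subspace V"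
    and "\<And>i x y. i \<in> I \<Longrightarrow> x \<in> V \<Longrightarrow> y \<in> V \<Longrightarrow> \<phi> i (x + y) = \<phi> i x + \<phi> i y"
    and "\<And>i x c. i \<in> I \<Longrightarrow> x \<in> V \<Longrightarrow> \<phi> i (c *\<^sub>R x) = c * \<phi> i x"
    and "\<And>x. x \<in> V \<Longrightarrow> (\<And>i. i \<in> I \<Longrightarrow> \<phi> i x = 0) \<Longrightarrow> x = 0"
  shows "\<exists>B. finite B \<and> card B \<le> card I \<and> V \<subseteq> span B"
  using assms
proof (induction I arbitrary: V rule: finite_induct)
  case empty
  then have "V \<subseteq> span {}" by auto
  then show ?case by (intro exI[of _ "{}"]) auto
next
  case (insert i I)
  define V' where "V' = {v \<in> V. \<phi> i v = 0}"
  have z: "\<phi> i 0 = 0"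
    using insert.prems(3)[of i 0 0] insert.prems(1) by (simp add: subspace_0)
  have "\<exists>B. finite B \<and> card B \<le> card I \<and> V' \<subseteq> span B"
  proof (rule insert.IH)
    show "subspace V'"
      using insert.prems(1-3) z by (auto simp: subspace_def V'_def)
    show "x = 0" if "x \<in> V'" "\<And>i. i \<in> I \<Longrightarrow> \<phi> i x = 0" for x
      using insert.prems(4)[of x] that by (auto simp: V'_def)
  qed (use insert.prems in \<open>auto simp: V'_def\<close>)
  then obtain B where B: "finite B" "card B \<le> card I" "V' \<subseteq> span B" by blast
  show ?case
  proof (cases "\<exists>b\<in>V. \<phi> i b \<noteq> 0")
    case True
    then obtain b where b: "b \<in> V" "\<phi> i b \<noteq> 0" by blast
    have "V \<subseteq> span (insert b B)"
    proof
      fix v assume v: "v \<in> V"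
      define k where "k = \<phi> i v / \<phi> i b"
      have "\<phi> i (v + (- k) *\<^sub>R b) = \<phi> i v + \<phi> i ((- k) *\<^sub>R b)"
        using insert.prems(1) v b(1) by (intro insert.prems(2)) (auto intro: subspace_scale subspace_neg)
      also have "\<phi> i ((- k) *\<^sub>R b) = - k * \<phi> i b"
        using b(1) by (intro insert.prems(3)) auto
      finally have "v - k *\<^sub>R b \<in> V'"
        using insert.prems(1) v b by (simp add: V'_def k_def subspace_diff subspace_scale)
      then show "v \<in> span (insert b B)"
        using B(3) span_breakdown_eq[of v b B] by blast
    qed
    moreover have "finite (insert b B)" "card (insert b B) \<le> card (insert i I)"
      using B(1,2) insert.hyps by (auto simp: card_insert_if)
    ultimately show ?thesis by blast
  next
    case False
    then have "V' = V" by (auto simp: V'_def)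
    with B insert.hyps show ?thesis by (intro exI[of _ B]) auto
  qed
qed

text \<open>Applying the functionals to a linear relation among the \<open>e i\<close> isolates its
  coefficients, so these vectors are independent.\<close>

lemma card_le_dim_of_dual_system:
  fixes \<phi> :: "'i \<Rightarrow> 'b::real_vector \<Rightarrow> real"
  assumes I: "finite I" and lin: "\<And>i. i \<in> I \<Longrightarrow> linear (\<phi> i)"
    and e: "\<And>i. i \<in> I \<Longrightarrow> e i \<in> S" and dual: "\<And>i j. i \<in> I \<Longrightarrow> j \<in> I \<Longrightarrow> \<phi> i (e j) = (if i = j then 1 else 0)"
    and S: "S \<subseteq> span B" "finite B"
  shows "card I \<le> dim S"
proof -
  have inj: "inj_on e I"
  proof (rule inj_onI)
    fix i j assume "i \<in> I" "j \<in> I" "e i = e j"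
    then show "i = j" using dual[of i i] dual[of i j] by (auto split: if_splits)
  qed
  have "independent (e ` I)"
  proof (rule independent_if_scalars_zero)
    show "finite (e ` I)" using I by simp
    fix f x assume 0: "(\<Sum>x\<in>e ` I. f x *\<^sub>R x) = 0" and "x \<in> e ` I"
    then obtain j where j: "j \<in> I" "x = e j" by blast
    have "0 = \<phi> j (\<Sum>i\<in>I. f (e i) *\<^sub>R e i)"
      using 0 linear_0[OF lin[OF j(1)]] by (simp add: sum.reindex[OF inj])
    also have "\<dots> = (\<Sum>i\<in>I. f (e i) * \<phi> j (e i))"
      by (simp add: linear_sum[OF lin[OF j(1)]] linear_scale[OF lin[OF j(1)]])
    also have "\<dots> = (\<Sum>i\<in>I. if i = j then f (e j) else 0)"
      by (rule sum.cong) (auto simp: dual j)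
    also have "\<dots> = f x" using I j by simp
    finally show "f x = 0" by simp
  qed
  moreover obtain D where D: "D \<subseteq> S" "independent D" "S \<subseteq> span D" "card D = dim S"
    by (rule basis_exists)
  moreover have "finite D"
    using independent_span_bound[OF S(2) D(2)] D(1) S(1) by auto
  ultimately have "card (e ` I) \<le> card D"
    using independent_span_bound[of D "e ` I"] e by blast
  then show ?thesis using D(4) card_image[OF inj] by simp
qed

section \<open>Sequences modulo the null sequences of a positive projection\<close>

instantiation "fun" :: (type, real_vector) real_vector
begin

definition "scaleR_fun c f = (\<lambda>x. c *\<^sub>R f x)"

instance
  by standard (auto simp: scaleR_fun_def fun_eq_iff algebra_simps)

end

lemma scaleR_fun_apply [simp]: "(c *\<^sub>R f) x = c *\<^sub>R f x"
  by (simp add: scaleR_fun_def)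

lemma tendsto_zero_of_norm_le:
  "(g \<longlongrightarrow> 0) F \<Longrightarrow> (\<And>n. norm (f n) \<le> norm (g n)) \<Longrightarrow> (f \<longlongrightarrow> 0) F"
  by (rule Lim_null_comparison[OF always_eventually tendsto_norm_zero]) auto

lemma pprt_ge: "(x::'a::banach_lattice) \<le> pprt x"
  by (simp add: pprt_def)

lemma pprt_le: "(x::'a::banach_lattice) \<le> y \<Longrightarrow> 0 \<le> y \<Longrightarrow> pprt x \<le> y"
  by (simp add: pprt_def)

text \<open>\<open>S\<close> is the range of the complexified projection, a space of pairs; its real
  dimension is twice that of the range of \<open>p\<close>.\<close>

locale pos_projection =
  fixes p :: "'a::banach_lattice \<Rightarrow> 'a" and U :: "nat filter" and S :: "('a \<times> 'a) set"
  assumes p_bl: "bounded_linear p"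
    and p_pos: "\<And>x. 0 \<le> x \<Longrightarrow> 0 \<le> p x"
    and p_idem: "\<And>x. p (p x) = p x"
    and p_nonzero: "\<exists>x. p x \<noteq> 0"
    and S_eq: "S = {F. p (fst F) = fst F \<and> p (snd F) = snd F}"
    and S_fin: "finite_dim S"
    and U: "ultrafilter U" "U \<le> sequentially"
begin

lemma U_bot: "U \<noteq> bot"
  using U(1) by (simp add: ultrafilter_def)

lemma p_add: "p (x + y) = p x + p y" and p_diff: "p (x - y) = p x - p y"
  and p_scaleR: "p (c *\<^sub>R x) = c *\<^sub>R p x" and p_zero: "p 0 = 0" and p_minus: "p (- x) = - p x"
  by (simp_all add: linear_simps[OF p_bl])

lemma p_mono: "x \<le> y \<Longrightarrow> p x \<le> p y"
  using p_pos[of "y - x"] by (simp add: p_diff)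

lemma p_norm: obtains K where "0 \<le> K" "\<And>x. norm (p x) \<le> norm x * K"
  using bounded_linear.nonneg_bounded[OF p_bl] by blast

lemma range_basis:
  obtains B where "finite B" "independent B" "\<And>b. b \<in> B \<Longrightarrow> p b = b" "\<And>x. p x = x \<Longrightarrow> x \<in> span B"
proof -
  obtain B0 where B0: "finite B0" "S \<subseteq> span B0" using S_fin by (auto simp: finite_dim_def)
  have W: "{x. p x = x} \<subseteq> span (fst ` B0)"
  proof
    fix x assume "x \<in> {x. p x = x}"
    then have "(x, 0) \<in> span B0" using B0(2) by (auto simp: S_eq p_zero)
    then have "fst (x, 0::'a) \<in> fst ` span B0" by (rule imageI)
    then show "x \<in> span (fst ` B0)"
      by (simp add: linear_span_image[OF bounded_linear.linear[OF bounded_linear_fst]])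
  qed
  obtain B where B: "B \<subseteq> {x. p x = x}" "independent B" "{x. p x = x} \<subseteq> span B"
    by (rule basis_exists[of "{x. p x = x}"])
  have "finite B"
    using independent_span_bound[OF finite_imageI[OF B0(1)] B(2) order_trans[OF B(1) W]] by simp
  with B show thesis by (intro that[of B]) blast+
qed

text \<open>The vector \<open>v\<close> is an order unit for the range. An element of the range is
  below a combination of the \<open>lat_abs b\<close> with coefficients bounded by its norm, and
  applying \<open>p\<close> to this estimate brings in \<open>v\<close>.\<close>

lemma dominating_element:
  obtains v C where "p v = v" "0 \<le> v" "v \<noteq> 0" "0 \<le> C" "\<And>x. p x = x \<Longrightarrow> x \<le> (C * norm x) *\<^sub>R v"
proof -
  obtain B where B: "finite B" "independent B" "\<And>b. b \<in> B \<Longrightarrow> p b = b" "\<And>x. p x = x \<Longrightarrow> x \<in> span B"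
    using range_basis by blast
  obtain C where C: "0 \<le> C" "\<And>c. (\<Sum>b\<in>B. \<bar>c b\<bar>) \<le> C * norm (\<Sum>b\<in>B. c b *\<^sub>R b)"
    using coordinates_bounded[OF B(1,2)] by blast
  define v where "v = (\<Sum>b\<in>B. p (lat_abs b))"
  have pv: "p v = v"
    unfolding v_def by (simp add: linear_sum[OF bounded_linear.linear[OF p_bl]] p_idem)
  have le: "x \<le> (C * norm x) *\<^sub>R v" if px: "p x = x" for x
  proof -
    obtain c where c: "x = (\<Sum>b\<in>B. c b *\<^sub>R b)"
      using B(4)[OF px] unfolding span_finite[OF B(1)] by auto
    have cb: "\<bar>c b\<bar> \<le> C * norm x" if "b \<in> B" for b
      using member_le_sum[of b B "\<lambda>b. \<bar>c b\<bar>"] that B(1) C(2)[of c] c by simp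
    have "x \<le> (\<Sum>b\<in>B. \<bar>c b\<bar> *\<^sub>R lat_abs b)"
      unfolding c by (intro sum_mono scaleR_le_lat_abs)
    also have "\<dots> \<le> (\<Sum>b\<in>B. (C * norm x) *\<^sub>R lat_abs b)"
      using cb by (intro sum_mono scaleR_right_mono) auto
    finally have "p x \<le> p ((C * norm x) *\<^sub>R (\<Sum>b\<in>B. lat_abs b))"
      by (intro p_mono) (simp add: scaleR_sum_right)
    then show ?thesis
      by (simp add: px p_scaleR v_def linear_sum[OF bounded_linear.linear[OF p_bl]])
  qed
  have "v \<noteq> 0"
  proof
    assume v: "v = 0"
    obtain x where x: "p x \<noteq> 0" using p_nonzero by blast
    have "p x \<le> 0" "- p x \<le> 0"
      using le[of "p x"] le[of "- p x"] by (simp_all add: v p_idem p_minus)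
    with x show False by simp
  qed
  moreover have "0 \<le> v" unfolding v_def by (intro sum_nonneg p_pos) simp
  ultimately show thesis using that[of v C] pv C(1) le by blast
qed

lemma range_limit:
  assumes X: "\<And>n. p (X n) = X n" "\<And>n. norm (X n) \<le> M"
  obtains v where "p v = v" "(X \<longlongrightarrow> v) U"
proof -
  obtain B where B: "finite B" "independent B" "\<And>b. b \<in> B \<Longrightarrow> p b = b" "\<And>x. p x = x \<Longrightarrow> x \<in> span B"
    using range_basis by blast
  obtain C where C: "0 \<le> C" "\<And>c. (\<Sum>b\<in>B. \<bar>c b\<bar>) \<le> C * norm (\<Sum>b\<in>B. c b *\<^sub>R b)"
    using coordinates_bounded[OF B(1,2)] by blast
  have "\<exists>c. X n = (\<Sum>b\<in>B. c b *\<^sub>R b)" for n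
    using B(4)[OF X(1)[of n]] unfolding span_finite[OF B(1)] by auto
  then obtain c where c: "\<And>n. X n = (\<Sum>b\<in>B. c n b *\<^sub>R b)" by metis
  have "\<exists>l. ((\<lambda>n. c n b) \<longlongrightarrow> l) U" if "b \<in> B" for b
  proof -
    have "\<bar>c n b\<bar> \<le> C * M" for n
    proof -
      have "\<bar>c n b\<bar> \<le> C * norm (X n)"
        using member_le_sum[of b B "\<lambda>b. \<bar>c n b\<bar>"] that B(1) C(2)[of "c n"] c[of n] by simp
      also have "\<dots> \<le> C * M" using C(1) X(2) by (intro mult_left_mono)
      finally show ?thesis .
    qed
    then have "eventually (\<lambda>n. \<bar>c n b\<bar> \<le> C * M) U" by simp
    from ultrafilter_real_limit[OF U(1) this] show ?thesis by blast
  qed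
  then obtain l where l: "\<And>b. b \<in> B \<Longrightarrow> ((\<lambda>n. c n b) \<longlongrightarrow> l b) U" by metis
  show thesis
  proof
    show "p (\<Sum>b\<in>B. l b *\<^sub>R b) = (\<Sum>b\<in>B. l b *\<^sub>R b)"
      by (simp add: linear_sum[OF bounded_linear.linear[OF p_bl]] p_scaleR B(3))
    have "((\<lambda>n. \<Sum>b\<in>B. c n b *\<^sub>R b) \<longlongrightarrow> (\<Sum>b\<in>B. l b *\<^sub>R b)) U"
      by (intro tendsto_sum tendsto_scaleR l tendsto_const)
    then show "(X \<longlongrightarrow> (\<Sum>b\<in>B. l b *\<^sub>R b)) U" by (simp add: c[symmetric])
  qed
qed

text \<open>This is the relation \<open>X \<le> 0\<close> in the quotient. Positive parts are tested
  only after applying \<open>p\<close>, so a positive sequence in the kernel of \<open>p\<close>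
  counts as zero.\<close>

definition below_null :: "(nat \<Rightarrow> 'a) \<Rightarrow> bool"
  where "below_null X \<longleftrightarrow> ((\<lambda>n. p (pprt (X n))) \<longlongrightarrow> 0) U"

lemma below_null_sum:
  assumes "below_null X" "below_null Y" "\<And>n. Z n \<le> X n + Y n"
  shows "below_null Z"
proof -
  have "norm (p (pprt (Z n))) \<le> norm (p (pprt (X n)) + p (pprt (Y n)))" for n
  proof (rule norm_mono_nonneg)
    show "0 \<le> p (pprt (Z n))" by (simp add: p_pos)
    have "Z n \<le> pprt (X n) + pprt (Y n)"
      using assms(3)[of n] add_mono[OF pprt_ge[of "X n"] pprt_ge[of "Y n"]] by (rule order_trans)
    then have "pprt (Z n) \<le> pprt (X n) + pprt (Y n)"
      by (rule pprt_le) (simp add: add_nonneg_nonneg)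
    from p_mono[OF this] show "p (pprt (Z n)) \<le> p (pprt (X n)) + p (pprt (Y n))"
      by (simp add: p_add)
  qed
  moreover have "((\<lambda>n. p (pprt (X n)) + p (pprt (Y n))) \<longlongrightarrow> 0) U"
    using tendsto_add[OF assms(1,2)[unfolded below_null_def]] by simp
  ultimately show ?thesis
    unfolding below_null_def by (rule tendsto_zero_of_norm_le[rotated])
qed

lemma below_null_nonpos: "(\<And>n. X n \<le> 0) \<Longrightarrow> below_null X"
  by (simp add: below_null_def p_zero)

lemma below_null_mono: "below_null Y \<Longrightarrow> (\<And>n. X n \<le> Y n) \<Longrightarrow> below_null X"
  using below_null_sum[of Y "\<lambda>n. 0" X] below_null_nonpos[of "\<lambda>n. 0"] by simp

lemma below_null_scaleR:
  assumes "below_null X" "0 \<le> c"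
  shows "below_null (\<lambda>n. c *\<^sub>R X n)"
proof -
  have "norm (p (pprt (c *\<^sub>R X n))) \<le> norm (c *\<^sub>R p (pprt (X n)))" for n
  proof (rule norm_mono_nonneg)
    show "0 \<le> p (pprt (c *\<^sub>R X n))" by (simp add: p_pos)
    have "pprt (c *\<^sub>R X n) \<le> c *\<^sub>R pprt (X n)"
      using assms(2) by (intro pprt_le scaleR_left_mono pprt_ge) (auto intro: scaleR_nonneg_nonneg)
    from p_mono[OF this] show "p (pprt (c *\<^sub>R X n)) \<le> c *\<^sub>R p (pprt (X n))"
      by (simp add: p_scaleR)
  qed
  moreover have "((\<lambda>n. c *\<^sub>R p (pprt (X n))) \<longlongrightarrow> 0) U"
    using tendsto_scaleR[OF tendsto_const assms(1)[unfolded below_null_def], of c] by simp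
  ultimately show ?thesis
    unfolding below_null_def by (rule tendsto_zero_of_norm_le[rotated])
qed

lemma below_null_sup:
  assumes "below_null X" "below_null Y"
  shows "below_null (\<lambda>n. sup (X n) (Y n))"
proof (rule below_null_sum[of "\<lambda>n. pprt (X n)" "\<lambda>n. pprt (Y n)"])
  show "below_null (\<lambda>n. pprt (X n))" "below_null (\<lambda>n. pprt (Y n))"
    using assms by (simp_all add: below_null_def)
  show "sup (X n) (Y n) \<le> pprt (X n) + pprt (Y n)" for n
    by (intro sup_least) (use pprt_ge[of "X n"] pprt_ge[of "Y n"] in \<open>auto intro: add_increasing add_increasing2\<close>)
qed

lemma below_null_tendsto:
  assumes "((\<lambda>n. pprt (X n)) \<longlongrightarrow> 0) U"
  shows "below_null X"
  using bounded_linear.tendsto[OF p_bl assms] by (simp add: below_null_def p_zero)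

lemma below_null_tendsto0:
  assumes "(X \<longlongrightarrow> 0) U"
  shows "below_null X"
proof (rule below_null_tendsto, rule Lim_null_comparison)
  show "\<forall>\<^sub>F n in U. norm (pprt (X n)) \<le> norm (X n)" by (simp add: norm_pprt_le)
  show "((\<lambda>n. norm (X n)) \<longlongrightarrow> 0) U" using assms by (rule tendsto_norm_zero)
qed

lemma below_null_kernel: "(\<And>n. 0 \<le> X n) \<Longrightarrow> (\<And>n. p (X n) = 0) \<Longrightarrow> below_null X"
  by (simp add: below_null_def)

end

locale ordered_sequences = pos_projection +
  fixes v :: 'a and C :: real
  assumes v: "p v = v" "0 \<le> v" "v \<noteq> 0" and C: "0 \<le> C" "\<And>x. p x = x \<Longrightarrow> x \<le> (C * norm x) *\<^sub>R v"
begin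

text \<open>This is the ideal generated by the constant sequence \<open>v\<close>: modulo null
  sequences its elements lie between multiples of \<open>v\<close>, which makes the order-unit
  functional \<open>gauge\<close> finite.\<close>

definition V :: "(nat \<Rightarrow> 'a) set"
  where "V = {X. \<exists>t. below_null (\<lambda>n. X n - t *\<^sub>R v) \<and> below_null (\<lambda>n. - X n - t *\<^sub>R v)}"

definition gauge :: "(nat \<Rightarrow> 'a) \<Rightarrow> real"
  where "gauge X = Inf {t. below_null (\<lambda>n. X n - t *\<^sub>R v)}"

lemma below_null_weaken:
  assumes "below_null (\<lambda>n. X n - t *\<^sub>R v)" "t \<le> t'"
  shows "below_null (\<lambda>n. X n - t' *\<^sub>R v)"
  by (rule below_null_mono[OF assms(1)]) (use assms(2) v(2) scaleR_right_mono in auto)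

lemma V_I: "below_null (\<lambda>n. X n - t *\<^sub>R v) \<Longrightarrow> below_null (\<lambda>n. - X n - t' *\<^sub>R v) \<Longrightarrow> X \<in> V"
  unfolding V_def mem_Collect_eq
  by (intro exI[of _ "max t t'"] conjI; erule below_null_weaken) auto

lemma V_solid:
  assumes "Y \<in> V" "\<And>n. X n \<le> Y n" "\<And>n. - X n \<le> Y n"
  shows "X \<in> V"
proof -
  obtain t where "below_null (\<lambda>n. Y n - t *\<^sub>R v)" using assms(1) by (auto simp: V_def)
  then show ?thesis
    using assms(2,3) by (intro V_I[of X t t]) (auto elim!: below_null_mono)
qed

sublocale VV: sup_subspace V
proof
  show "sup x y + z = sup (x + z) (y + z)" for x y z :: "nat \<Rightarrow> 'a"
    by (auto simp: fun_eq_iff add_sup_distrib_right)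
  show "subspace V"
    unfolding subspace_def
  proof (intro conjI ballI allI)
    show "0 \<in> V" by (intro V_I[of 0 0 0]) (auto intro: below_null_nonpos)
    fix X assume "X \<in> V"
    then obtain t where t: "below_null (\<lambda>n. X n - t *\<^sub>R v)" "below_null (\<lambda>n. - X n - t *\<^sub>R v)"
      by (auto simp: V_def)
    show "X + Y \<in> V" if "Y \<in> V" for Y
    proof -
      obtain s where s: "below_null (\<lambda>n. Y n - s *\<^sub>R v)" "below_null (\<lambda>n. - Y n - s *\<^sub>R v)"
        using \<open>Y \<in> V\<close> by (auto simp: V_def)
      show ?thesis
        using below_null_sum[OF t(1) s(1)] below_null_sum[OF t(2) s(2)]
        by (intro V_I[of _ "t + s" "t + s"]) (simp_all add: algebra_simps)
    qed
    fix c :: real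
    show "c *\<^sub>R X \<in> V"
    proof (cases "c \<ge> 0")
      case True
      show ?thesis
        using below_null_scaleR[OF t(1) True] below_null_scaleR[OF t(2) True]
        by (intro V_I[of _ "c * t" "c * t"]) (simp_all add: scaleR_diff_right)
    next
      case False
      then have "0 \<le> - c" by simp
      from below_null_scaleR[OF t(1) this] below_null_scaleR[OF t(2) this] show ?thesis
        by (intro V_I[of _ "- c * t" "- c * t"]) (simp_all add: scaleR_diff_right)
    qed
  qed
  show "sup X Y \<in> V" if XY: "X \<in> V" "Y \<in> V" for X Y
  proof -
    obtain t where t: "below_null (\<lambda>n. X n - t *\<^sub>R v)" "below_null (\<lambda>n. - X n - t *\<^sub>R v)"
      using XY by (auto simp: V_def)
    obtain s where s: "below_null (\<lambda>n. Y n - s *\<^sub>R v)" using XY by (auto simp: V_def)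
    have "below_null (\<lambda>n. sup (X n - max t s *\<^sub>R v) (Y n - max t s *\<^sub>R v))"
      by (intro below_null_sup below_null_weaken[OF t(1)] below_null_weaken[OF s]) auto
    then have "below_null (\<lambda>n. sup X Y n - max t s *\<^sub>R v)"
      using add_sup_distrib_right[of _ _ "- (max t s *\<^sub>R v)"] by simp
    moreover have "below_null (\<lambda>n. - sup X Y n - t *\<^sub>R v)"
      by (rule below_null_mono[OF t(2)]) simp
    ultimately show ?thesis by (rule V_I)
  qed
qed

text \<open>A nonzero positive vector fixed by \<open>p\<close> does not vanish in the quotient;
  this is what bounds \<open>gauge\<close> from below.\<close>

lemma below_null_const_nonneg: "below_null (\<lambda>n. - (t *\<^sub>R v)) \<Longrightarrow> 0 \<le> t"
proof (rule ccontr)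
  assume n: "below_null (\<lambda>n. - (t *\<^sub>R v))" and t: "\<not> 0 \<le> t"
  then have "0 \<le> - (t *\<^sub>R v)" using v(2) by (simp add: scaleR_nonpos_nonneg)
  then have "((\<lambda>n. - (t *\<^sub>R v)) \<longlongrightarrow> 0) U"
    using n by (simp add: below_null_def p_minus p_scaleR v(1))
  then have "- (t *\<^sub>R v) = 0" using tendsto_unique[OF U_bot tendsto_const] by blast
  then show False using t v(3) by simp
qed

lemma gauge_bdd:
  assumes "X \<in> V"
  shows "bdd_below {t. below_null (\<lambda>n. X n - t *\<^sub>R v)}" "{t. below_null (\<lambda>n. X n - t *\<^sub>R v)} \<noteq> {}"
proof -
  obtain s where s: "below_null (\<lambda>n. X n - s *\<^sub>R v)" "below_null (\<lambda>n. - X n - s *\<^sub>R v)"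
    using assms by (auto simp: V_def)
  show "bdd_below {t. below_null (\<lambda>n. X n - t *\<^sub>R v)}"
  proof (rule bdd_belowI)
    fix t assume "t \<in> {t. below_null (\<lambda>n. X n - t *\<^sub>R v)}"
    then have "below_null (\<lambda>n. - ((t + s) *\<^sub>R v))"
      using below_null_sum[OF _ s(2), of "\<lambda>n. X n - t *\<^sub>R v"] by (simp add: algebra_simps)
    from below_null_const_nonneg[OF this] show "- s \<le> t" by simp
  qed
  show "{t. below_null (\<lambda>n. X n - t *\<^sub>R v)} \<noteq> {}" using s by blast
qed

lemma gauge_le: "X \<in> V \<Longrightarrow> below_null (\<lambda>n. X n - t *\<^sub>R v) \<Longrightarrow> gauge X \<le> t"
  unfolding gauge_def using gauge_bdd by (intro cInf_lower) auto

lemma below_null_gauge: "X \<in> V \<Longrightarrow> gauge X < t \<Longrightarrow> below_null (\<lambda>n. X n - t *\<^sub>R v)"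
  unfolding gauge_def using gauge_bdd below_null_weaken
  by (subst (asm) cInf_less_iff) (auto intro: less_imp_le)

lemma sup_sublinear_gauge: "sup_sublinear V gauge"
  unfolding sup_sublinear_def
proof (intro conjI ballI allI impI)
  fix X Y assume XY: "X \<in> V" "Y \<in> V"
  show "gauge (X + Y) \<le> gauge X + gauge Y"
  proof (rule field_le_epsilon)
    fix e :: real assume "e > 0"
    then have "below_null (\<lambda>n. X n - (gauge X + e / 2) *\<^sub>R v)" "below_null (\<lambda>n. Y n - (gauge Y + e / 2) *\<^sub>R v)"
      using XY by (auto intro: below_null_gauge)
    then have "below_null (\<lambda>n. (X + Y) n - (gauge X + gauge Y + e) *\<^sub>R v)"
      by (rule below_null_sum) (simp add: algebra_simps flip: scaleR_add_left)
    then show "gauge (X + Y) \<le> gauge X + gauge Y + e" by (rule gauge_le[OF VV.V_add[OF XY]])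
  qed
  show "gauge (sup X Y) \<le> max (gauge X) (gauge Y)"
  proof (rule field_le_epsilon)
    fix e :: real assume "e > 0"
    define t where "t = max (gauge X) (gauge Y) + e"
    have "below_null (\<lambda>n. X n - t *\<^sub>R v)" "below_null (\<lambda>n. Y n - t *\<^sub>R v)"
      using XY \<open>e > 0\<close> by (auto intro!: below_null_gauge simp: t_def)
    then have "below_null (\<lambda>n. sup (X n - t *\<^sub>R v) (Y n - t *\<^sub>R v))" by (rule below_null_sup)
    then have "below_null (\<lambda>n. sup X Y n - t *\<^sub>R v)"
      using add_sup_distrib_right[of _ _ "- (t *\<^sub>R v)"] by simp
    then show "gauge (sup X Y) \<le> max (gauge X) (gauge Y) + e"
      using gauge_le[OF VV.V_sup[OF XY]] by (simp add: t_def)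
  qed
next
  fix X and c :: real assume X: "X \<in> V" and c: "0 < c"
  show "gauge (c *\<^sub>R X) \<le> c * gauge X"
  proof (rule field_le_epsilon)
    fix e :: real assume "e > 0"
    then have "below_null (\<lambda>n. X n - (gauge X + e / c) *\<^sub>R v)"
      using X c by (intro below_null_gauge) auto
    from below_null_scaleR[OF this, of c]
    have "below_null (\<lambda>n. (c *\<^sub>R X) n - (c * gauge X + e) *\<^sub>R v)"
      using c by (simp add: scaleR_diff_right distrib_left)
    then show "gauge (c *\<^sub>R X) \<le> c * gauge X + e" by (rule gauge_le[OF VV.V_scaleR[OF X]])
  qed
qed

end

section \<open>Homomorphisms on sequences and their restrictions to the range\<close>

context ordered_sequences
begin

text \<open>For a linear functional, domination by \<open>gauge\<close> carries three facts at once: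
  positivity, vanishing on null sequences in \<open>V\<close>, and the value 1 at
  \<open>v\<close>.\<close>

definition homs :: "((nat \<Rightarrow> 'a) \<Rightarrow> real) set"
  where "homs = {d. (\<forall>x\<in>V. \<forall>y\<in>V. d (x + y) = d x + d y) \<and> (\<forall>x\<in>V. \<forall>c. d (c *\<^sub>R x) = c * d x) \<and>
    (\<forall>x\<in>V. \<forall>y\<in>V. d (sup x y) \<le> max (d x) (d y)) \<and> (\<forall>x\<in>V. d x \<le> gauge x)}"

lemma ex_hom:
  assumes "X \<in> V"
  obtains d where "d \<in> homs" "d X = gauge X"
proof (rule VV.ex_lattice_hom[OF sup_sublinear_gauge assms], goal_cases)
  case (1 d)
  then have "d \<in> homs" by (simp add: homs_def)
  then show ?thesis using 1(6) by (rule that)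
qed

abbreviation const :: "'a \<Rightarrow> nat \<Rightarrow> 'a"
  where "const x \<equiv> (\<lambda>n. x)"

lemma const_in_V: "p x = x \<Longrightarrow> const x \<in> V"
  using C(2)[of x] C(2)[of "- x"]
  by (intro V_I[of _ "C * norm x" "C * norm x"] below_null_nonpos) (simp_all add: p_minus)

lemma v_in_V: "const v \<in> V"
  by (rule const_in_V[OF v(1)])

context
  fixes d assumes d: "d \<in> homs"
begin

lemma hom_add: "X \<in> V \<Longrightarrow> Y \<in> V \<Longrightarrow> d (X + Y) = d X + d Y"
  and hom_scaleR: "X \<in> V \<Longrightarrow> d (c *\<^sub>R X) = c * d X"
  and hom_le_gauge: "X \<in> V \<Longrightarrow> d X \<le> gauge X"
  using d by (auto simp: homs_def)

lemma hom_minus: "X \<in> V \<Longrightarrow> d (- X) = - d X"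
  using hom_scaleR[of X "-1"] by simp

lemma hom_diff: "X \<in> V \<Longrightarrow> Y \<in> V \<Longrightarrow> d (X - Y) = d X - d Y"
  using hom_add[of X "- Y"] hom_minus[of Y] VV.V_minus[of Y] by simp

lemma hom_mono:
  assumes "X \<in> V" "Y \<in> V" "below_null (\<lambda>n. X n - Y n)"
  shows "d X \<le> d Y"
proof -
  have XY: "X - Y \<in> V"
    using VV.V_add[OF assms(1) VV.V_minus[OF assms(2)]] by simp
  have "gauge (X - Y) \<le> 0"
    by (rule gauge_le[OF XY]) (use assms(3) in simp)
  with hom_le_gauge[OF XY] hom_diff[OF assms(1,2)] show ?thesis by simp
qed

lemma hom_sup:
  assumes "X \<in> V" "Y \<in> V"
  shows "d (sup X Y) = max (d X) (d Y)"
proof (rule antisym)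
  show "d (sup X Y) \<le> max (d X) (d Y)" using d assms by (auto simp: homs_def)
  show "max (d X) (d Y) \<le> d (sup X Y)"
    using assms VV.V_sup[OF assms]
    by (intro max.boundedI hom_mono below_null_nonpos) (simp_all only: diff_le_0_iff_le sup_apply sup_ge1 sup_ge2)
qed

lemma hom_v: "d (const v) = 1"
proof -
  have "gauge (const v) \<le> 1" by (rule gauge_le[OF v_in_V]) (auto intro: below_null_nonpos)
  moreover have "gauge (- const v) \<le> - 1"
    by (rule gauge_le[OF VV.V_minus[OF v_in_V]]) (auto intro: below_null_nonpos)
  ultimately show ?thesis
    using hom_le_gauge[OF v_in_V] hom_le_gauge[OF VV.V_minus[OF v_in_V]] hom_minus[OF v_in_V] by linarith
qed

lemma hom_null:
  assumes "X \<in> V" "(X \<longlongrightarrow> 0) U"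
  shows "d X = 0"
proof -
  have "d 0 = 0" using hom_scaleR[OF VV.V_zero, of 0] by simp
  moreover have "d X \<le> d 0"
    by (rule hom_mono[OF assms(1) VV.V_zero]) (simp add: below_null_tendsto0[OF assms(2)])
  moreover have "d 0 \<le> d X"
    by (rule hom_mono[OF VV.V_zero assms(1)])
      (use below_null_tendsto0[of "\<lambda>n. - X n"] tendsto_minus[OF assms(2)] in simp)
  ultimately show ?thesis by simp
qed

end

text \<open>Composition with \<open>p\<close> makes the restriction to the range a linear functional
  on the whole space, so that restrictions can be compared and counted as functions.\<close>

definition restr :: "((nat \<Rightarrow> 'a) \<Rightarrow> real) \<Rightarrow> 'a \<Rightarrow> real"
  where "restr d x = d (const (p x))"

lemma const_p_in_V: "const (p x) \<in> V"
  by (rule const_in_V[OF p_idem])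

lemma linear_restr:
  assumes "d \<in> homs"
  shows "linear (restr d)"
proof (rule linearI)
  show "restr d (x + y) = restr d x + restr d y" for x y
    using hom_add[OF assms const_p_in_V const_p_in_V, of x y] by (simp add: restr_def p_add plus_fun_def)
  show "restr d (c *\<^sub>R x) = c *\<^sub>R restr d x" for c x
    using hom_scaleR[OF assms const_p_in_V, of c x] by (simp add: restr_def p_scaleR scaleR_fun_def)
qed

lemma restr_v: "d \<in> homs \<Longrightarrow> restr d v = 1"
  using hom_v by (simp add: restr_def v(1))

text \<open>The range of \<open>p\<close> need not be a sublattice; its own supremum is
  \<open>p (sup x y)\<close>. This exceeds \<open>sup x y\<close> by a positive element of the
  kernel of \<open>p\<close>, which homomorphisms do not see.\<close>

lemma restr_sup:
  assumes d: "d \<in> homs" and xy: "p x = x" "p y = y"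
  shows "restr d (p (sup x y)) = max (restr d x) (restr d y)"
proof -
  have le: "sup x y \<le> p (sup x y)"
    using p_mono[of x "sup x y"] p_mono[of y "sup x y"] by (simp add: xy)
  have cV: "const (sup x y) \<in> V"
    using VV.V_sup[OF const_in_V[OF xy(1)] const_in_V[OF xy(2)]] by (simp add: sup_fun_def)
  have "below_null (\<lambda>n. p (sup x y) - sup x y)"
  proof (rule below_null_kernel)
    show "0 \<le> p (sup x y) - sup x y" using le by (simp only: diff_ge_0_iff_ge)
    show "p (p (sup x y) - sup x y) = 0" by (simp only: p_diff p_idem diff_self)
  qed
  then have "d (const (p (sup x y))) \<le> d (const (sup x y))"
    by (intro hom_mono[OF d const_p_in_V cV])
  moreover have "d (const (sup x y)) \<le> d (const (p (sup x y)))"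
    using le by (intro hom_mono[OF d cV const_p_in_V] below_null_nonpos) (simp only: diff_le_0_iff_le)
  moreover have "d (const (sup x y)) = max (d (const x)) (d (const y))"
    using hom_sup[OF d const_in_V[OF xy(1)] const_in_V[OF xy(2)]] by (simp add: sup_fun_def)
  ultimately show ?thesis
    unfolding restr_def p_idem xy by linarith
qed

text \<open>With \<open>y = p x - \<psi> x *\<^sub>R v\<close>, every restriction sends the modulus
  of \<open>y\<close>, formed in the range, to the distance between its value at \<open>x\<close>
  and \<open>\<psi> x\<close>. Division by the distance for \<open>\<phi>\<close>
  normalises.\<close>

lemma separate_two:
  assumes "\<phi> \<in> restr ` homs" "\<psi> \<in> restr ` homs" "\<phi> \<noteq> \<psi>"
  obtains u where "p u = u" "\<phi> u = 1" "\<psi> u = 0" "\<And>\<theta>. \<theta> \<in> restr ` homs \<Longrightarrow> 0 \<le> \<theta> u"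
proof -
  have lin: "linear \<theta>" "\<theta> v = 1" "\<And>x. \<theta> (p x) = \<theta> x" "\<And>x y. p x = x \<Longrightarrow> p y = y \<Longrightarrow> \<theta> (p (sup x y)) = max (\<theta> x) (\<theta> y)"
    if "\<theta> \<in> restr ` homs" for \<theta>
    using that linear_restr restr_v restr_sup by (auto simp: restr_def p_idem)
  obtain x where x: "\<phi> x \<noteq> \<psi> x" using assms(3) by blast
  define y where "y = p x - \<psi> x *\<^sub>R v"
  have py: "p y = y" "p (- y) = - y" by (simp_all add: y_def p_diff p_scaleR p_idem v(1) p_minus)
  have y: "\<theta> y = \<theta> x - \<psi> x" "\<theta> (- y) = \<psi> x - \<theta> x" if "\<theta> \<in> restr ` homs" for \<theta>
    using lin[OF that] by (simp_all add: y_def linear_diff linear_scale)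
  define k where "k = \<bar>\<phi> x - \<psi> x\<bar>"
  have k: "k > 0" using x by (simp add: k_def)
  define u where "u = inverse k *\<^sub>R p (sup y (- y))"
  have u: "\<theta> u = inverse k * \<bar>\<theta> x - \<psi> x\<bar>" if "\<theta> \<in> restr ` homs" for \<theta>
    using lin(1)[OF that] lin(4)[OF that py] y[OF that] by (simp add: u_def linear_scale max_def abs_if)
  show thesis
  proof
    show "p u = u" by (simp add: u_def p_scaleR p_idem)
    show "\<phi> u = 1" using u[OF assms(1)] k by (simp add: k_def)
    show "\<psi> u = 0" using u[OF assms(2)] by simp
    show "0 \<le> \<theta> u" if "\<theta> \<in> restr ` homs" for \<theta> using u[OF that] k by simp
  qed
qed

text \<open>Separating elements are combined by the infimum in the range, which restrictions turn
  into a minimum; nonnegativity keeps the zeros already obtained.\<close>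

lemma separate_finite:
  assumes "finite \<Psi>" "\<Psi> \<subseteq> restr ` homs" "\<phi> \<in> restr ` homs" "\<phi> \<notin> \<Psi>"
  shows "\<exists>u. p u = u \<and> \<phi> u = 1 \<and> (\<forall>\<psi>\<in>\<Psi>. \<psi> u = 0) \<and> (\<forall>\<theta>\<in>restr ` homs. 0 \<le> \<theta> u)"
  using assms(1,2,4)
proof (induction \<Psi> rule: finite_induct)
  case empty
  have "\<theta> v = 1" if "\<theta> \<in> restr ` homs" for \<theta> using that restr_v by auto
  then show ?case using assms(3) v(1) by (intro exI[of _ v]) auto
next
  case (insert \<psi> \<Psi>)
  then obtain a where a: "p a = a" "\<phi> a = 1" "\<forall>\<psi>\<in>\<Psi>. \<psi> a = 0" "\<forall>\<theta>\<in>restr ` homs. 0 \<le> \<theta> a"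
    by auto
  obtain b where b: "p b = b" "\<phi> b = 1" "\<psi> b = 0" "\<And>\<theta>. \<theta> \<in> restr ` homs \<Longrightarrow> 0 \<le> \<theta> b"
    using separate_two[OF assms(3), of \<psi>] insert.prems by blast
  define u where "u = - p (sup (- a) (- b))"
  have u: "\<theta> u = min (\<theta> a) (\<theta> b)" if \<theta>: "\<theta> \<in> restr ` homs" for \<theta>
  proof -
    obtain d where d: "d \<in> homs" "\<theta> = restr d" using \<theta> by blast
    have "\<theta> (p (sup (- a) (- b))) = max (\<theta> (- a)) (\<theta> (- b))"
      unfolding d(2) by (rule restr_sup[OF d(1)]) (simp_all add: p_minus a b)
    then show ?thesis
      using linear_restr[OF d(1)] unfolding d(2) by (simp add: u_def linear_neg minus_max_eq_min)
  qed
  show ?case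
  proof (intro exI[of _ u] conjI ballI)
    show "p u = u" by (simp add: u_def p_minus p_idem)
    show "\<phi> u = 1" using u[OF assms(3)] a(2) b(2) by simp
    show "0 \<le> \<theta> u" if "\<theta> \<in> restr ` homs" for \<theta>
      using u[OF that] bspec[OF a(4) that] b(4)[OF that] by simp
    show "\<theta> u = 0" if "\<theta> \<in> insert \<psi> \<Psi>" for \<theta>
    proof -
      have "\<theta> \<in> restr ` homs" using that insert.prems by auto
      from u[OF this] bspec[OF a(4) this] b(4)[OF this] that a(3) b(3) show ?thesis by auto
    qed
  qed
qed

text \<open>Separating elements give a dual system for the restrictions. It is doubled into real and
  imaginary copies, as \<open>S\<close> consists of pairs.\<close>

lemma card_restr_le:
  assumes \<Psi>: "finite \<Psi>" "\<Psi> \<subseteq> restr ` homs"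
  shows "2 * card \<Psi> \<le> dim S"
proof -
  have "\<exists>u. p u = u \<and> \<phi> u = 1 \<and> (\<forall>\<psi>\<in>\<Psi> - {\<phi>}. \<psi> u = 0)" if "\<phi> \<in> \<Psi>" for \<phi>
    using separate_finite[of "\<Psi> - {\<phi>}" \<phi>] \<Psi> that by auto
  then have "\<forall>\<phi>\<in>\<Psi>. \<exists>u. p u = u \<and> \<phi> u = 1 \<and> (\<forall>\<psi>\<in>\<Psi> - {\<phi>}. \<psi> u = 0)" by blast
  then obtain u where u': "\<forall>\<phi>\<in>\<Psi>. p (u \<phi>) = u \<phi> \<and> \<phi> (u \<phi>) = 1 \<and> (\<forall>\<psi>\<in>\<Psi> - {\<phi>}. \<psi> (u \<phi>) = 0)"
    unfolding bchoice_iff by blast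
  have u: "p (u \<phi>) = u \<phi>" "\<phi> (u \<phi>) = 1" "\<psi> \<in> \<Psi> \<Longrightarrow> \<psi> \<noteq> \<phi> \<Longrightarrow> \<psi> (u \<phi>) = 0" if "\<phi> \<in> \<Psi>" for \<phi> \<psi>
    using bspec[OF u' that] by blast+
  have lin: "linear \<phi>" if "\<phi> \<in> \<Psi>" for \<phi> using \<Psi>(2) that linear_restr by auto
  define f where "f i F = (if snd i then fst i (fst F) else fst i (snd F))" for i :: "('a \<Rightarrow> real) \<times> bool" and F :: "'a \<times> 'a"
  define e where "e i = (if snd i then (u (fst i), 0) else (0, u (fst i)))" for i :: "('a \<Rightarrow> real) \<times> bool"
  obtain B where B: "finite B" "S \<subseteq> span B" using S_fin by (auto simp: finite_dim_def)
  have "card (\<Psi> \<times> (UNIV :: bool set)) \<le> dim S"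
  proof (rule card_le_dim_of_dual_system[where \<phi> = f and e = e])
    show "finite (\<Psi> \<times> (UNIV :: bool set))" using \<Psi>(1) by simp
    fix i :: "('a \<Rightarrow> real) \<times> bool" assume i: "i \<in> \<Psi> \<times> UNIV"
    then have li: "linear (fst i)" using lin by auto
    show "linear (f i)"
      by (rule linearI) (auto simp: f_def linear_add[OF li] linear_scale[OF li])
    show "e i \<in> S" using i u(1) by (auto simp: e_def S_eq p_zero)
    fix j :: "('a \<Rightarrow> real) \<times> bool" assume j: "j \<in> \<Psi> \<times> UNIV"
    show "f i (e j) = (if i = j then 1 else 0)"
      using i j u(2)[of "fst i"] u(3)[of "fst j" "fst i"] linear_0[OF li]
      by (auto simp: f_def e_def prod_eq_iff)
  qed (use B in auto)
  then show ?thesis by (simp add: card_cartesian_product)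
qed

lemma finite_restr: "finite (restr ` homs)" and card_restr: "2 * card (restr ` homs) \<le> dim S"
proof -
  show fin: "finite (restr ` homs)"
  proof (rule ccontr)
    assume "infinite (restr ` homs)"
    then obtain \<Psi> where "\<Psi> \<subseteq> restr ` homs" "finite \<Psi>" "card \<Psi> = Suc (dim S)"
      using infinite_arbitrarily_large by blast
    with card_restr_le[of \<Psi>] show False by simp
  qed
  show "2 * card (restr ` homs) \<le> dim S" by (rule card_restr_le[OF fin order_refl])
qed

text \<open>Homomorphisms with a common restriction may still differ outside constant sequences, and
  there may be infinitely many. Fixing one for each restriction leaves a finite family.\<close>

definition rep :: "('a \<Rightarrow> real) \<Rightarrow> (nat \<Rightarrow> 'a) \<Rightarrow> real"
  where "rep \<phi> = inv_into homs restr \<phi>"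

lemma rep_homs: "\<phi> \<in> restr ` homs \<Longrightarrow> rep \<phi> \<in> homs" and restr_rep: "\<phi> \<in> restr ` homs \<Longrightarrow> restr (rep \<phi>) = \<phi>"
  unfolding rep_def by (simp_all only: inv_into_into f_inv_into_f)

section \<open>Sequences with almost subinvariant modulus\<close>

context
  fixes G :: "nat \<Rightarrow> 'a \<times> 'a" and M :: real
  assumes bounded: "\<And>n. norm (G n) \<le> M"
    and sub: "((\<lambda>n. pprt (modulus (G n) - p (modulus (G n)))) \<longlongrightarrow> 0) U"
begin

lemma below_null_modulus: "below_null (\<lambda>n. modulus (G n) - p (modulus (G n)))"
  by (rule below_null_tendsto[OF sub])

lemma p_modulus_bounded:
  assumes "\<And>x. norm (p x) \<le> norm x * K" "0 \<le> K"
  shows "norm (p (modulus (G n))) \<le> 2 * M * K"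
proof -
  have "norm (p (modulus (G n))) \<le> norm (modulus (G n)) * K" by (rule assms)
  also have "\<dots> \<le> 2 * M * K"
    using norm_modulus_le[of "G n"] bounded[of n] assms(2) by (intro mult_right_mono) linarith+
  finally show ?thesis .
qed

lemma below_null_modulus_v:
  assumes "\<And>x. norm (p x) \<le> norm x * K" "0 \<le> K"
  shows "below_null (\<lambda>n. modulus (G n) - (C * (2 * M * K)) *\<^sub>R v)"
proof (rule below_null_mono[OF below_null_modulus])
  fix n
  have "p (modulus (G n)) \<le> (C * norm (p (modulus (G n)))) *\<^sub>R v" by (rule C(2)[OF p_idem])
  also have "\<dots> \<le> (C * (2 * M * K)) *\<^sub>R v"
    using C(1) v(2) p_modulus_bounded[OF assms] by (intro scaleR_right_mono mult_left_mono)
  finally show "modulus (G n) - (C * (2 * M * K)) *\<^sub>R v \<le> modulus (G n) - p (modulus (G n))"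
    by (rule diff_left_mono)
qed

lemma modulus_in_V: "(\<lambda>n. modulus (G n)) \<in> V"
proof -
  obtain K where K: "0 \<le> K" "\<And>x. norm (p x) \<le> norm x * K" using p_norm by blast
  have "below_null (\<lambda>n. - modulus (G n) - 0 *\<^sub>R v)" by (intro below_null_nonpos) simp
  with below_null_modulus_v[OF K(2,1)] show ?thesis by (rule V_I)
qed

lemma fst_in_V: "(\<lambda>n. fst (G n)) \<in> V"
  by (rule V_solid[OF modulus_in_V order_trans[OF lat_abs_ge(1) lat_abs_le_modulus(1)]
        order_trans[OF lat_abs_ge(2) lat_abs_le_modulus(1)]])

lemma snd_in_V: "(\<lambda>n. snd (G n)) \<in> V"
  by (rule V_solid[OF modulus_in_V order_trans[OF lat_abs_ge(1) lat_abs_le_modulus(2)]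
        order_trans[OF lat_abs_ge(2) lat_abs_le_modulus(2)]])

text \<open>In the quotient the modulus equals its image under \<open>p\<close>, whose terms stay in
  a finite-dimensional range and converge along \<open>U\<close>. Its value under a homomorphism
  thus depends on the restriction alone, which need not be so for real and imaginary parts.\<close>

lemma hom_modulus:
  obtains w where "\<forall>d\<in>homs. d (\<lambda>n. modulus (G n)) = restr d w"
proof -
  obtain K where K: "0 \<le> K" "\<And>x. norm (p x) \<le> norm x * K" using p_norm by blast
  let ?m = "\<lambda>n. modulus (G n)" and ?q = "\<lambda>n. p (modulus (G n))"
  obtain w where w: "p w = w" "(?q \<longlongrightarrow> w) U"
    by (rule range_limit[OF p_idem p_modulus_bounded[OF K(2,1)]])
  have le: "?q n \<le> (C * (2 * M * K)) *\<^sub>R v" for n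
    by (rule order_trans[OF C(2)[OF p_idem]])
      (use C(1) v(2) p_modulus_bounded[OF K(2,1)] in \<open>intro scaleR_right_mono mult_left_mono\<close>)
  have qV: "?q \<in> V"
    by (rule V_I[of _ "C * (2 * M * K)" 0]; rule below_null_nonpos) (use le p_pos in auto)
  \<comment> \<open>The reverse inequality comes for free: \<open>p\<close> annihilates
    \<open>?q n - ?m n\<close>, so it takes equal values on the positive and the negative
    part.\<close>
  have "below_null (\<lambda>n. ?q n - ?m n)"
    unfolding below_null_def
  proof -
    have "p (pprt (?q n - ?m n)) = p (pprt (?m n - ?q n))" for n
    proof -
      have "?q n - ?m n = pprt (?q n - ?m n) - pprt (?m n - ?q n)"
        using prts[of "?q n - ?m n"] pprt_neg[of "?q n - ?m n"] by simp
      then have "p (?q n - ?m n) = p (pprt (?q n - ?m n)) - p (pprt (?m n - ?q n))"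
        by (subst p_diff[symmetric]) (rule arg_cong)
      then show ?thesis by (simp add: p_diff p_idem)
    qed
    then show "((\<lambda>n. p (pprt (?q n - ?m n))) \<longlongrightarrow> 0) U"
      using below_null_modulus by (simp add: below_null_def)
  qed
  then have 1: "d ?m = d ?q" if "d \<in> homs" for d
    using hom_mono[OF that modulus_in_V qV below_null_modulus] hom_mono[OF that qV modulus_in_V] by simp
  have "d ?q = restr d w" if d: "d \<in> homs" for d
  proof -
    have "?q - const w \<in> V"
      using VV.V_add[OF qV VV.V_minus[OF const_in_V[OF w(1)]]] by simp
    moreover have "((?q - const w) \<longlongrightarrow> 0) U"
      using LIM_zero[OF w(2)] by (simp add: fun_diff_def)
    ultimately have "d (?q - const w) = 0" by (rule hom_null[OF d])
    then show ?thesis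
      using hom_diff[OF d qV const_in_V[OF w(1)]] by (simp add: restr_def w(1))
  qed
  with 1 show thesis by (intro that[of w]) auto
qed

lemma hom_modulus_le:
  assumes d: "d \<in> homs"
  shows "d (\<lambda>n. modulus (G n)) \<le> \<bar>d (\<lambda>n. fst (G n))\<bar> + \<bar>d (\<lambda>n. snd (G n))\<bar>"
proof -
  let ?x = "\<lambda>n. fst (G n)" and ?y = "\<lambda>n. snd (G n)"
  have V: "?x \<in> V" "- ?x \<in> V" "?y \<in> V" "- ?y \<in> V"
    using fst_in_V snd_in_V by (auto intro: VV.V_minus)
  have xy: "sup ?x (- ?x) + sup ?y (- ?y) \<in> V"
    by (intro VV.V_add VV.V_sup V)
  have "d (\<lambda>n. modulus (G n)) \<le> d (sup ?x (- ?x) + sup ?y (- ?y))"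
    using modulus_le by (intro hom_mono[OF d modulus_in_V xy] below_null_nonpos) (simp add: lat_abs_def)
  also have "\<dots> = max (d ?x) (- d ?x) + max (d ?y) (- d ?y)"
    using V by (simp add: hom_add[OF d] hom_sup[OF d] hom_minus[OF d] VV.V_sup)
  finally show ?thesis by (simp add: max_def abs_if split: if_splits)
qed

lemma abs_hom_le:
  assumes d: "d \<in> homs" and K: "\<And>x. norm (p x) \<le> norm x * K" "0 \<le> K"
  shows "\<bar>d (\<lambda>n. fst (G n))\<bar> \<le> C * (2 * M * K)" "\<bar>d (\<lambda>n. snd (G n))\<bar> \<le> C * (2 * M * K)"
proof -
  let ?m = "\<lambda>n. modulus (G n)"
  have m: "d ?m \<le> C * (2 * M * K)"
    using hom_le_gauge[OF d modulus_in_V] gauge_le[OF modulus_in_V below_null_modulus_v[OF K]] by simp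
  have "\<bar>d X\<bar> \<le> d ?m" if X: "X \<in> V" "\<And>n. lat_abs (X n) \<le> modulus (G n)" for X
  proof -
    have "d X \<le> d ?m"
      using order_trans[OF lat_abs_ge(1) X(2)] by (intro hom_mono[OF d X(1) modulus_in_V] below_null_nonpos) simp
    moreover have "d (- X) \<le> d ?m"
      using order_trans[OF lat_abs_ge(2) X(2)]
      by (intro hom_mono[OF d VV.V_minus[OF X(1)] modulus_in_V] below_null_nonpos) simp
    ultimately show ?thesis using hom_minus[OF d X(1)] by simp
  qed
  from this[OF fst_in_V lat_abs_le_modulus(1)] this[OF snd_in_V lat_abs_le_modulus(2)] m
  show "\<bar>d (\<lambda>n. fst (G n))\<bar> \<le> C * (2 * M * K)" "\<bar>d (\<lambda>n. snd (G n))\<bar> \<le> C * (2 * M * K)"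
    by linarith+
qed

text \<open>On subinvariant sequences a homomorphism is controlled in modulus by its restriction to
  the range of \<open>p\<close>, so the finitely many representatives suffice to bound the norm.\<close>
lemma norm_eventually_le:
  assumes e: "\<And>\<phi>. \<phi> \<in> restr ` homs \<Longrightarrow> \<bar>rep \<phi> (\<lambda>n. fst (G n))\<bar> + \<bar>rep \<phi> (\<lambda>n. snd (G n))\<bar> \<le> e"
    and \<eta>: "0 < \<eta>"
  shows "\<forall>\<^sub>F n in U. norm (G n) \<le> 2 * ((e + \<eta>) * norm v) + \<eta>"
proof -
  let ?m = "\<lambda>n. modulus (G n)"
  obtain w where w: "\<forall>d\<in>homs. d ?m = restr d w" by (rule hom_modulus)
  obtain d where d: "d \<in> homs" "d ?m = gauge ?m" by (rule ex_hom[OF modulus_in_V])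
  define \<phi> where "\<phi> = restr d"
  have \<phi>: "\<phi> \<in> restr ` homs" using d(1) by (simp add: \<phi>_def)
  have "gauge ?m = rep \<phi> ?m"
    using bspec[OF w d(1)] bspec[OF w rep_homs[OF \<phi>]] restr_rep[OF \<phi>] d(2) by (simp add: \<phi>_def)
  also have "\<dots> \<le> e"
    using hom_modulus_le[OF rep_homs[OF \<phi>]] e[OF \<phi>] by linarith
  finally have "gauge ?m < e + \<eta>" using \<eta> by simp
  then have N: "below_null (\<lambda>n. ?m n - (e + \<eta>) *\<^sub>R v)"
    by (rule below_null_gauge[OF modulus_in_V])
  have g0: "0 \<le> e + \<eta>"
  proof -
    have "0 \<le> e" using e[OF \<phi>] by linarith
    then show ?thesis using \<eta> by simp
  qed
  have ev1: "\<forall>\<^sub>F n in U. norm (p (pprt (?m n - (e + \<eta>) *\<^sub>R v))) < \<eta> / 4"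
    using order_tendstoD(2)[OF tendsto_norm_zero[OF N[unfolded below_null_def]], of "\<eta> / 4"] \<eta> by simp
  have ev2: "\<forall>\<^sub>F n in U. norm (pprt (?m n - p (?m n))) < \<eta> / 4"
    using order_tendstoD(2)[OF tendsto_norm_zero[OF sub], of "\<eta> / 4"] \<eta> by simp
  from ev1 ev2 show ?thesis
  proof eventually_elim
    case (elim n)
    let ?a = "pprt (?m n - (e + \<eta>) *\<^sub>R v)" and ?b = "pprt (?m n - p (?m n))"
    \<comment> \<open>The gauge controls the excess over \<open>v\<close> only after
      \<open>p\<close>. Hence \<open>p (?m n)\<close> is estimated first, and subinvariance then
      brings the bound back to \<open>?m n\<close>.\<close>
    have "?m n - (e + \<eta>) *\<^sub>R v \<le> ?a" by (rule pprt_ge)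
    then have "?m n \<le> ?a + (e + \<eta>) *\<^sub>R v" by (simp add: algebra_simps)
    from p_mono[OF this] have p1: "p (?m n) \<le> p ?a + (e + \<eta>) *\<^sub>R v"
      by (simp add: p_add p_scaleR v(1))
    have "?m n - p (?m n) \<le> ?b" by (rule pprt_ge)
    then have "?m n \<le> p (?m n) + ?b" by (simp add: algebra_simps)
    also have "\<dots> \<le> p ?a + (e + \<eta>) *\<^sub>R v + ?b" using p1 by (rule add_right_mono)
    finally have "norm (?m n) \<le> norm (p ?a + (e + \<eta>) *\<^sub>R v + ?b)"
      by (intro norm_mono_nonneg) simp
    also have "\<dots> \<le> norm (p ?a) + norm ((e + \<eta>) *\<^sub>R v) + norm ?b"
      by (rule order_trans[OF norm_triangle_ineq add_right_mono[OF norm_triangle_ineq]])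
    also have "\<dots> \<le> \<eta> / 4 + (e + \<eta>) * norm v + \<eta> / 4"
      using elim g0 by simp
    finally show ?case using norm_le_modulus[of "G n"] by simp
  qed
qed

end

end

section \<open>Approximate eigenvectors at the peripheral spectrum\<close>

locale peripheral_value = ev_pos_pole +
  fixes l :: complex
  assumes fin: "finite_dim (spectral_space T (complex_of_real (spec_radius T)))"
    and l: "cmod l = spec_radius T"
begin

abbreviation "S \<equiv> spectral_space T (complex_of_real (spec_radius T))"

lemma S_eq: "S = {F. p (fst F) = fst F \<and> p (snd F) = snd F}"
proof -
  have "S = range (blinfun_apply P)" by (simp add: spectral_space_def P_def)
  also have "\<dots> = {F. P F = F}"
  proof (intro equalityI subsetI)
    show "F \<in> {F. P F = F}" if "F \<in> range (blinfun_apply P)" for F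
      using that by (auto simp: P_idem simp del: split_paired_All)
    show "F \<in> range (blinfun_apply P)" if "F \<in> {F. P F = F}" for F
      using that by (intro range_eqI[of F _ F]) simp
  qed
  also have "\<dots> = {F. p (fst F) = fst F \<and> p (snd F) = snd F}"
    by (rule Collect_cong, subst PP.apply_eq) (simp only: prod_eq_iff fst_conv snd_conv)
  finally show ?thesis .
qed

lemma projection: "ultrafilter U \<Longrightarrow> U \<le> sequentially \<Longrightarrow> pos_projection p U S"
proof (rule pos_projection.intro)
  show "bounded_linear p" by (rule p_linear)
  show "0 \<le> x \<Longrightarrow> 0 \<le> p x" for x by (rule PP.re_part_nonneg)
  show "p (p x) = p x" for x by (rule p_idem)
  show "\<exists>x. p x \<noteq> 0"
  proof (rule ccontr)
    assume "\<not> (\<exists>x. p x \<noteq> 0)"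
    then have "P F = 0" for F by (simp add: PP.apply_eq zero_prod_def)
    then have "P = 0" by (intro blinfun_eqI) simp
    with P_nonzero show False by simp
  qed
  show "S = {F. p (fst F) = fst F \<and> p (snd F) = snd F}" by (rule S_eq)
  show "finite_dim S" by (rule fin)
qed

definition defect :: "'a \<times> 'a \<Rightarrow> 'a \<times> 'a"
  where "defect f = cmult l f - T f"

lemma defect_bounded_linear: "bounded_linear defect"
  unfolding defect_def[abs_def]
  by (intro bounded_linear_sub bounded_linear_cmult blinfun.bounded_linear_right)

lemma defect_diff: "defect (x - y) = defect x - defect y"
  and defect_add: "defect (x + y) = defect x + defect y"
  and defect_scaleR: "defect (c *\<^sub>R x) = c *\<^sub>R defect x"
  and defect_zero: "defect 0 = 0"
  by (simp_all add: linear_simps[OF defect_bounded_linear])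

lemma subinvariant:
  assumes "\<And>n. norm (G n) \<le> M" "(\<lambda>n. defect (G n)) \<longlonglongrightarrow> 0"
  shows "(\<lambda>n. pprt (modulus (G n) - p (modulus (G n)))) \<longlonglongrightarrow> 0"
proof (rule LIMSEQ_I)
  fix \<epsilon> :: real assume \<epsilon>: "0 < \<epsilon>"
  have M: "0 \<le> M" using assms(1)[of 0] norm_ge_zero order_trans by blast
  define w where "w = l / r"
  have w: "cmod w = 1" "complex_of_real r * w = l"
    using l spec_radius_pos by (auto simp: w_def norm_divide)
  \<comment> \<open>\<open>e\<close> is fixed before \<open>D\<close>, which depends on it and
    multiplies only the vanishing defect.\<close>
  define e where "e = \<epsilon> / (2 * (M + 1))"
  have e: "0 < e" using \<epsilon> M by (simp add: e_def)
  obtain D where D: "0 \<le> D" "\<And>f. norm (pprt (modulus f - p (modulus f))) \<le> e * norm f + D * norm (cmult (complex_of_real r * w) f - T f)"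
    by (rule modulus_almost_subinvariant[OF w(1) e]) (rule that, simp_all)
  obtain N where N: "\<And>n. n \<ge> N \<Longrightarrow> norm (defect (G n)) < \<epsilon> / (2 * (D + 1))"
    using LIMSEQ_D[OF assms(2), of "\<epsilon> / (2 * (D + 1))"] \<epsilon> D(1) by auto
  have "norm (pprt (modulus (G n) - p (modulus (G n))) - 0) < \<epsilon>" if "n \<ge> N" for n
  proof -
    have "e * norm (G n) \<le> e * M" using e assms(1) by (intro mult_left_mono) auto
    also have "\<dots> < \<epsilon> / 2" using \<epsilon> M by (simp add: e_def field_simps)
    finally have 1: "e * norm (G n) < \<epsilon> / 2" .
    have "D * norm (defect (G n)) \<le> D * (\<epsilon> / (2 * (D + 1)))"
      using D(1) N[OF that] by (intro mult_left_mono) auto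
    also have "\<dots> \<le> \<epsilon> / 2" using \<epsilon> D(1) by (simp add: field_simps)
    finally show ?thesis
      using D(2)[of "G n"] 1 unfolding w(2) defect_def by simp
  qed
  then show "\<exists>no. \<forall>n\<ge>no. norm (pprt (modulus (G n) - p (modulus (G n))) - 0) < \<epsilon>" by blast
qed

text \<open>Eigenvectors enter as constant sequences, and the representatives, evaluated at real and
  imaginary parts, separate them. The two functionals per representative match the factor 2 in
  \<open>card_restr\<close>.\<close>

lemma kernel_finite_dim: "\<exists>B. finite B \<and> card B \<le> dim S \<and> {F. defect F = 0} \<subseteq> span B"
proof -
  obtain U where U: "U \<le> sequentially" "ultrafilter U"
    by (rule ex_ultrafilter[of sequentially]) auto
  interpret PR: pos_projection p U S by (rule projection[OF U(2,1)])
  obtain v C where vC: "p v = v" "0 \<le> v" "v \<noteq> 0" "0 \<le> C" "\<And>x. p x = x \<Longrightarrow> x \<le> (C * norm x) *\<^sub>R v"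
    by (rule PR.dominating_element) (rule that, simp_all)
  interpret OS: ordered_sequences p U S v C
    by (intro ordered_sequences.intro ordered_sequences_axioms.intro PR.pos_projection_axioms vC)
  let ?I = "(OS.restr ` OS.homs) \<times> (UNIV :: bool set)"
  define \<phi> where "\<phi> i F = OS.rep (fst i) (\<lambda>n. if snd i then fst F else snd F)"
    for i :: "('a \<Rightarrow> real) \<times> bool" and F :: "'a \<times> 'a"
  have sub: "((\<lambda>n. pprt (modulus F - p (modulus F))) \<longlongrightarrow> 0) U" if "defect F = 0" for F
    using tendsto_mono[OF U(1) subinvariant[of "\<lambda>n. F" "norm F"]] that by simp
  have inV: "(\<lambda>n. if b then fst F else snd F) \<in> OS.V" if "defect F = 0" for F b
    using OS.fst_in_V[of "\<lambda>n. F" "norm F"] OS.snd_in_V[of "\<lambda>n. F" "norm F"] sub[OF that] by simp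
  have "\<exists>B. finite B \<and> card B \<le> card ?I \<and> {F. defect F = 0} \<subseteq> span B"
  proof (rule spanned_of_separating_functionals[where \<phi> = \<phi>])
    show "finite ?I" using OS.finite_restr by simp
    show "subspace {F. defect F = 0}"
      by (auto simp: subspace_def defect_add defect_scaleR defect_zero)
    fix i :: "('a \<Rightarrow> real) \<times> bool" assume i: "i \<in> ?I"
    then have h: "OS.rep (fst i) \<in> OS.homs" by (auto intro: OS.rep_homs)
    fix x assume x: "x \<in> {F. defect F = 0}"
    show "\<phi> i (x + y) = \<phi> i x + \<phi> i y" if "y \<in> {F. defect F = 0}" for y
      using OS.hom_add[OF h inV[of x "snd i"] inV[of y "snd i"]] x that
      by (simp add: \<phi>_def plus_fun_def if_distrib cong: if_cong)
    show "\<phi> i (c *\<^sub>R x) = c * \<phi> i x" for c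
      using OS.hom_scaleR[OF h inV[of x "snd i"], of c] x
      by (simp add: \<phi>_def scaleR_fun_def if_distrib cong: if_cong)
  next
    fix F assume F: "F \<in> {F. defect F = 0}" and z: "\<And>i. i \<in> ?I \<Longrightarrow> \<phi> i F = 0"
    have "norm F \<le> 0"
    proof (rule field_le_epsilon)
      fix \<epsilon> :: real assume \<epsilon>: "0 < \<epsilon>"
      define \<eta> where "\<eta> = \<epsilon> / (2 * norm v + 1)"
      have nv: "0 < 2 * norm v + 1" by (simp add: add_nonneg_pos)
      have \<eta>: "0 < \<eta>" using \<epsilon> nv by (simp add: \<eta>_def)
      have "\<forall>\<^sub>F n in U. norm F \<le> 2 * ((0 + \<eta>) * norm v) + \<eta>"
      proof (rule OS.norm_eventually_le[of "\<lambda>n. F" "norm F"])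
        show "((\<lambda>n. pprt (modulus F - p (modulus F))) \<longlongrightarrow> 0) U" using sub F by simp
        show "\<bar>OS.rep \<psi> (\<lambda>n. fst F)\<bar> + \<bar>OS.rep \<psi> (\<lambda>n. snd F)\<bar> \<le> 0" if "\<psi> \<in> OS.restr ` OS.homs" for \<psi>
          using z[of "(\<psi>, True)"] z[of "(\<psi>, False)"] that by (simp add: \<phi>_def)
      qed (use \<eta> in auto)
      then have "norm F \<le> 2 * (\<eta> * norm v) + \<eta>"
        using eventually_happens'[OF PR.U_bot] by auto
      also have "\<dots> = \<eta> * (2 * norm v + 1)" by (simp add: algebra_simps)
      also have "\<dots> = \<epsilon>" using nv by (simp add: \<eta>_def)
      finally show "norm F \<le> 0 + \<epsilon>" by simp
    qed
    then show "F = 0" by simp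
  qed
  moreover have "card ?I \<le> dim S"
    using OS.card_restr by (simp add: card_cartesian_product)
  ultimately show ?thesis using order_trans by blast
qed

text \<open>Two shifts \<open>F (n + i)\<close> and \<open>F (n + j)\<close> are compared as
  sequences in \<open>n\<close>. The finitely many representatives are bounded on all shifts, so
  they nearly agree for suitable \<open>i < j\<close>; the difference sequence is then small along
  \<open>U\<close>, against separation.\<close>

lemma no_separated_sequence:
  assumes F: "\<And>n. norm (F n) \<le> M" "(\<lambda>n. defect (F n)) \<longlonglongrightarrow> 0"
    and e0: "0 < e0" and sep: "\<And>i j. i < j \<Longrightarrow> e0 \<le> norm (F i - F j)"
  shows False
proof -
  obtain U where U: "U \<le> sequentially" "ultrafilter U"
    by (rule ex_ultrafilter[of sequentially]) auto
  interpret PR: pos_projection p U S by (rule projection[OF U(2,1)])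
  obtain v C where vC: "p v = v" "0 \<le> v" "v \<noteq> 0" "0 \<le> C" "\<And>x. p x = x \<Longrightarrow> x \<le> (C * norm x) *\<^sub>R v"
    by (rule PR.dominating_element) (rule that, simp_all)
  interpret OS: ordered_sequences p U S v C
    by (intro ordered_sequences.intro ordered_sequences_axioms.intro PR.pos_projection_axioms vC)
  obtain K where K: "0 \<le> K" "\<And>x. norm (p x) \<le> norm x * K" by (rule PR.p_norm) (rule that, simp_all)
  have defect_shift: "(\<lambda>n. defect (F (n + j))) \<longlonglongrightarrow> 0" for j
    using LIMSEQ_ignore_initial_segment[OF F(2)] .
  have sub: "((\<lambda>n. pprt (modulus (F (n + j)) - p (modulus (F (n + j))))) \<longlongrightarrow> 0) U" for j
    by (rule tendsto_mono[OF U(1) subinvariant[OF F(1) defect_shift]])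
  define x where "x \<phi> j = OS.rep \<phi> (\<lambda>n. fst (F (n + j)))" for \<phi> j
  define y where "y \<phi> j = OS.rep \<phi> (\<lambda>n. snd (F (n + j)))" for \<phi> j
  have bx: "\<bar>x \<phi> j\<bar> \<le> C * (2 * M * K)" "\<bar>y \<phi> j\<bar> \<le> C * (2 * M * K)" if "\<phi> \<in> OS.restr ` OS.homs" for \<phi> j
    unfolding x_def y_def
    using OS.abs_hom_le[of "\<lambda>n. F (n + j)" M, OF F(1) sub OS.rep_homs[OF that] K(2,1)] by auto
  \<comment> \<open>Four values, each within \<open>\<eta>\<close> of its limit, give the bound
    \<open>4 * \<eta>\<close> for the difference. The resulting norm bound is
    \<open>\<eta> * (10 * norm v + 1)\<close>, which is half of \<open>e0\<close>.\<close>
  define \<eta> where "\<eta> = e0 / (2 * (10 * norm v + 1))"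
  have nv: "0 < 10 * norm v + 1" by (simp add: add_nonneg_pos)
  have \<eta>: "0 < \<eta>" "2 * ((4 * \<eta> + \<eta>) * norm v) + \<eta> < e0"
  proof -
    show "0 < \<eta>" using e0 nv by (simp add: \<eta>_def)
    have "2 * ((4 * \<eta> + \<eta>) * norm v) + \<eta> = \<eta> * (10 * norm v + 1)" by (simp add: algebra_simps)
    also have "\<dots> = e0 / 2" using nv by (simp add: \<eta>_def field_simps)
    finally show "2 * ((4 * \<eta> + \<eta>) * norm v) + \<eta> < e0" using e0 by simp
  qed
  have "\<exists>a. \<forall>\<^sub>F j in U. \<bar>x \<phi> j - a\<bar> < \<eta>" "\<exists>a. \<forall>\<^sub>F j in U. \<bar>y \<phi> j - a\<bar> < \<eta>" if \<phi>: "\<phi> \<in> OS.restr ` OS.homs" for \<phi>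
  proof -
    have lim: "\<exists>a. \<forall>\<^sub>F j in U. \<bar>f j - a\<bar> < \<eta>" if bf: "\<And>j. \<bar>f j\<bar> \<le> C * (2 * M * K)" for f :: "nat \<Rightarrow> real"
    proof -
      obtain a where "(f \<longlongrightarrow> a) U"
        by (rule ultrafilter_real_limit[OF U(2), of f "C * (2 * M * K)"]) (simp_all add: bf)
      from tendstoD[OF this \<eta>(1)] show ?thesis by (auto simp: dist_real_def)
    qed
    show "\<exists>a. \<forall>\<^sub>F j in U. \<bar>x \<phi> j - a\<bar> < \<eta>" "\<exists>a. \<forall>\<^sub>F j in U. \<bar>y \<phi> j - a\<bar> < \<eta>"
      using lim bx[OF \<phi>] by auto
  qed
  then obtain a b where ab: "\<And>\<phi>. \<phi> \<in> OS.restr ` OS.homs \<Longrightarrow> \<forall>\<^sub>F j in U. \<bar>x \<phi> j - a \<phi>\<bar> < \<eta>"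
    "\<And>\<phi>. \<phi> \<in> OS.restr ` OS.homs \<Longrightarrow> \<forall>\<^sub>F j in U. \<bar>y \<phi> j - b \<phi>\<bar> < \<eta>" by metis
  define good where "good j \<longleftrightarrow> (\<forall>\<phi>\<in>OS.restr ` OS.homs. \<bar>x \<phi> j - a \<phi>\<bar> < \<eta> \<and> \<bar>y \<phi> j - b \<phi>\<bar> < \<eta>)" for j
  have good: "\<forall>\<^sub>F j in U. good j"
    unfolding good_def
    by (rule eventually_ball_finite[OF OS.finite_restr]) (use ab in \<open>auto intro: eventually_conj\<close>)
  then obtain i where i: "good i" using eventually_happens'[OF PR.U_bot] by blast
  have "\<forall>\<^sub>F j in U. i < j" using U(1) eventually_gt_at_top[of i] unfolding le_filter_def by blast
  with good have "\<forall>\<^sub>F j in U. good j \<and> i < j" by (rule eventually_conj)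
  then obtain j where j: "good j" "i < j" using eventually_happens'[OF PR.U_bot] by blast
  define G where "G n = F (n + i) - F (n + j)" for n
  have bG: "norm (G n) \<le> 2 * M" for n
    using norm_triangle_ineq4[of "F (n + i)" "F (n + j)"] F(1)[of "n + i"] F(1)[of "n + j"] by (simp add: G_def)
  have "(\<lambda>n. defect (G n)) \<longlonglongrightarrow> 0 - 0"
    unfolding G_def defect_diff by (intro tendsto_diff defect_shift)
  then have subG: "((\<lambda>n. pprt (modulus (G n) - p (modulus (G n)))) \<longlongrightarrow> 0) U"
    by (intro tendsto_mono[OF U(1) subinvariant[OF bG]]) simp
  have "\<forall>\<^sub>F n in U. norm (G n) \<le> 2 * ((4 * \<eta> + \<eta>) * norm v) + \<eta>"
  proof (rule OS.norm_eventually_le[OF bG subG _ \<eta>(1)])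
    fix \<phi> assume \<phi>: "\<phi> \<in> OS.restr ` OS.homs"
    note h = OS.rep_homs[OF \<phi>]
    note V = OS.fst_in_V[OF F(1) sub] OS.snd_in_V[OF F(1) sub]
    have "OS.rep \<phi> (\<lambda>n. fst (G n)) = x \<phi> i - x \<phi> j"
      using OS.hom_diff[OF h V(1)[of i] V(1)[of j]] by (simp add: x_def G_def fun_diff_def)
    moreover have "OS.rep \<phi> (\<lambda>n. snd (G n)) = y \<phi> i - y \<phi> j"
      using OS.hom_diff[OF h V(2)[of i] V(2)[of j]] by (simp add: y_def G_def fun_diff_def)
    moreover have "\<bar>x \<phi> i - a \<phi>\<bar> < \<eta>" "\<bar>y \<phi> i - b \<phi>\<bar> < \<eta>" "\<bar>x \<phi> j - a \<phi>\<bar> < \<eta>" "\<bar>y \<phi> j - b \<phi>\<bar> < \<eta>"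
      using i j(1) \<phi> by (auto simp: good_def)
    ultimately show "\<bar>OS.rep \<phi> (\<lambda>n. fst (G n))\<bar> + \<bar>OS.rep \<phi> (\<lambda>n. snd (G n))\<bar> \<le> 4 * \<eta>" by linarith
  qed
  then obtain n where "norm (G n) \<le> 2 * ((4 * \<eta> + \<eta>) * norm v) + \<eta>"
    using eventually_happens'[OF PR.U_bot] by blast
  moreover have "e0 \<le> norm (G n)" using sep[of "n + i" "n + j"] j(2) by (simp add: G_def)
  ultimately show False using \<eta>(2) by linarith
qed

text \<open>Since no subsequence is separated, every radius admits a term that is close to almost
  all others along \<open>U\<close>. These centres form a Cauchy sequence, and its limit is the
  limit of \<open>F\<close> along \<open>U\<close>.\<close>

lemma approximate_eigenvectors_converge:
  assumes U: "ultrafilter U" "U \<le> sequentially"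
    and F: "\<And>n. norm (F n) \<le> M" "(\<lambda>n. defect (F n)) \<longlonglongrightarrow> 0"
  obtains g where "(F \<longlongrightarrow> g) U" "defect g = 0"
proof -
  have Ub: "U \<noteq> bot" using U(1) by (simp add: ultrafilter_def)
  have near: "\<exists>j. \<forall>\<^sub>F n in U. norm (F n - F j) < e" if e: "0 < e" for e
  proof (rule ccontr)
    assume neg: "\<not> ?thesis"
    have far: "\<forall>\<^sub>F n in U. e \<le> norm (F n - F j)" for j
      using ultrafilter_cases[OF U(1), of "\<lambda>n. norm (F n - F j) < e"] neg by (auto simp: not_less)
    have gt: "\<forall>\<^sub>F n in U. j < n" for j
      using U(2) eventually_gt_at_top[of j] unfolding le_filter_def by blast
    \<comment> \<open>The next index has to meet finitely many conditions, each of which holds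
      eventually along \<open>U\<close>.\<close>
    have "\<exists>\<sigma> :: nat \<Rightarrow> nat. \<forall>k. \<forall>i<k. \<sigma> i < \<sigma> k \<and> e \<le> norm (F (\<sigma> k) - F (\<sigma> i))"
    proof (rule dependent_wf_choice[where R = "{(i::nat, k). i < k}" and
          P = "\<lambda>\<sigma> k n. \<forall>i<k. \<sigma> i < n \<and> e \<le> norm (F n - F (\<sigma> i))"])
      show "wf {(i::nat, k). i < k}" by (rule wf_less)
      fix k and \<sigma> :: "nat \<Rightarrow> nat"
      have "\<forall>\<^sub>F n in U. \<forall>i\<in>{..<k}. \<sigma> i < n \<and> e \<le> norm (F n - F (\<sigma> i))"
        by (rule eventually_ball_finite) (auto intro: eventually_conj gt far)
      from eventually_happens'[OF Ub this]
      show "\<exists>n. \<forall>i<k. \<sigma> i < n \<and> e \<le> norm (F n - F (\<sigma> i))" by auto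
    next
      fix \<sigma> \<tau> :: "nat \<Rightarrow> nat" and k n
      assume "\<And>i. (i, k) \<in> {(i::nat, k). i < k} \<Longrightarrow> \<sigma> i = \<tau> i"
      then have "\<sigma> i = \<tau> i" if "i < k" for i using that by simp
      then show "(\<forall>i<k. \<sigma> i < n \<and> e \<le> norm (F n - F (\<sigma> i))) = (\<forall>i<k. \<tau> i < n \<and> e \<le> norm (F n - F (\<tau> i)))"
        by (simp cong: imp_cong)
    qed
    then obtain \<sigma> :: "nat \<Rightarrow> nat" where \<sigma>: "\<forall>k. \<forall>i<k. \<sigma> i < \<sigma> k \<and> e \<le> norm (F (\<sigma> k) - F (\<sigma> i))" ..
    have "strict_mono \<sigma>" unfolding strict_mono_def using \<sigma> by blast
    from LIMSEQ_subseq_LIMSEQ[OF F(2) this] have "(\<lambda>n. defect (F (\<sigma> n))) \<longlonglongrightarrow> 0" by (simp add: o_def)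
    moreover have "e \<le> norm (F (\<sigma> i) - F (\<sigma> k))" if "i < k" for i k
      using \<sigma> that norm_minus_commute[of "F (\<sigma> i)"] by auto
    ultimately show False
      by (rule no_separated_sequence[of "\<lambda>n. F (\<sigma> n)", OF F(1) _ e])
  qed
  then have "\<exists>j. \<forall>\<^sub>F n in U. norm (F n - F j) < inverse (Suc k)" for k by simp
  then obtain j where j: "\<And>k. \<forall>\<^sub>F n in U. norm (F n - F (j k)) < inverse (Suc k)" by metis
  have diff: "norm (F (j k) - F (j i)) \<le> inverse (Suc k) + inverse (Suc i)" for k i
  proof -
    obtain n where "norm (F n - F (j k)) < inverse (Suc k)" "norm (F n - F (j i)) < inverse (Suc i)"
      using eventually_happens'[OF Ub eventually_conj[OF j[of k] j[of i]]] by blast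
    then show ?thesis using norm_triangle_ineq4[of "F n - F (j i)" "F n - F (j k)"] by simp
  qed
  have "Cauchy (\<lambda>k. F (j k))" by (rule Cauchy_of_inverse_bound[OF diff])
  then obtain g where g: "(\<lambda>k. F (j k)) \<longlonglongrightarrow> g"
    using Cauchy_convergent convergent_def by blast
  have lim: "(F \<longlongrightarrow> g) U"
  proof (rule tendstoI)
    fix e :: real assume e: "0 < e"
    have "\<forall>\<^sub>F k in sequentially. dist (F (j k)) g < e / 2" using e by (intro tendstoD[OF g]) simp
    moreover have "\<forall>\<^sub>F k in sequentially. inverse (real (Suc k)) < e / 2"
      using e by (intro order_tendstoD(2)[OF LIMSEQ_inverse_real_of_nat]) simp
    ultimately have "\<forall>\<^sub>F k in sequentially. dist (F (j k)) g < e / 2 \<and> inverse (real (Suc k)) < e / 2"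
      by (rule eventually_conj)
    then obtain k where k: "dist (F (j k)) g < e / 2" "inverse (real (Suc k)) < e / 2"
      using eventually_happens'[OF sequentially_bot] by blast
    show "\<forall>\<^sub>F n in U. dist (F n) g < e"
      using j[of k]
    proof eventually_elim
      case (elim n)
      then have "dist (F n) (F (j k)) < e / 2" using k(2) by (simp add: dist_norm)
      with k(1) show ?case using dist_triangle[of "F n" g "F (j k)"] by linarith
    qed
  qed
  have "((\<lambda>n. defect (F n)) \<longlongrightarrow> defect g) U"
    by (rule bounded_linear.tendsto[OF defect_bounded_linear lim])
  moreover have "((\<lambda>n. defect (F n)) \<longlongrightarrow> 0) U" by (rule tendsto_mono[OF U(2) F(2)])
  ultimately have "defect g = 0" using tendsto_unique[OF Ub] by blast
  with lim show thesis by (rule that)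
qed

end

section \<open>The pole at a peripheral spectral value\<close>

context peripheral_value
begin

definition w :: complex
  where "w = l / complex_of_real r"

lemma w: "cmod w = 1" "complex_of_real r * w = l"
  using l spec_radius_pos by (auto simp: w_def norm_divide)

definition s :: "nat \<Rightarrow> real"
  where "s k = r + inverse (Suc k)"

lemma s_gt: "r < s k"
  by (simp add: s_def)

lemma s_tendsto: "(\<lambda>k. s k - r) \<longlonglongrightarrow> 0"
  unfolding s_def using LIMSEQ_inverse_real_of_nat by simp

text \<open>These points approach \<open>l\<close> radially from outside the spectral circle, where
  the domination by real resolvents is available.\<close>

definition z :: "nat \<Rightarrow> complex"
  where "z k = complex_of_real (s k) * w"

lemma z_resolvent: "z k \<in> resolvent_set T"
  using s_gt[of k] w(1) spec_radius_pos by (intro resolvent_set_outside) (simp add: z_def norm_mult)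

lemma z_minus_l: "z k - l = complex_of_real (s k - r) * w"
  using w(2) by (simp add: z_def left_diff_distrib)

lemma cmod_z_minus_l: "cmod (z k - l) = s k - r"
  using s_gt[of k] w(1) unfolding z_minus_l norm_mult norm_of_real by simp

definition K :: "nat \<Rightarrow> ('a \<times> 'a) \<Rightarrow>\<^sub>L ('a \<times> 'a)"
  where "K k = cscal (z k - l) o\<^sub>L R (z k)"

lemma K_apply: "K k f = cmult (z k - l) (R (z k) f)"
  by (simp add: K_def)

lemma K_cmult: "K k (cmult c f) = cmult c (K k f)"
  by (simp add: K_apply resolvent_cmult[OF clin z_resolvent] cmult_cmult mult.commute)

lemma K_bounded: obtains M where "0 \<le> M" "\<forall>\<^sub>F k in sequentially. norm (K k) \<le> M"
proof -
  obtain M where M: "\<forall>\<^sub>F s in at_right r. \<forall>f. norm (cmult (complex_of_real (s - r) * w) (R (complex_of_real s * w) f)) \<le> M * norm f"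
    by (rule scaled_resolvent_bounded[OF w(1)])
  have "(\<lambda>k. s k) \<longlonglongrightarrow> r"
    using tendsto_add[OF s_tendsto tendsto_const[of r]] by simp
  then have "filterlim s (at_right r) sequentially"
    using s_gt less_imp_neq[OF s_gt, symmetric] by (auto simp: filterlim_at)
  from eventually_compose_filterlim[OF M this]
  have ev: "\<forall>\<^sub>F k in sequentially. \<forall>f. norm (K k f) \<le> M * norm f"
    by (simp only: K_apply z_minus_l) (simp only: z_def)
  have "\<forall>\<^sub>F k in sequentially. norm (K k) \<le> \<bar>M\<bar>"
    using ev
  proof eventually_elim
    case (elim k)
    have "norm (K k f) \<le> \<bar>M\<bar> * norm f" for f
      using elim[rule_format, of f] mult_right_mono[OF abs_ge_self[of M] norm_ge_zero[of f]] by (rule order_trans)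
    then show ?case by (intro norm_blinfun_bound) auto
  qed
  then show thesis by (intro that[of "\<bar>M\<bar>"]) auto
qed

lemma defect_resolvent: "defect (R (z k) f) = f - K k f"
  using resolvent_right[OF z_resolvent, of k f] by (simp add: defect_def K_apply cmult_diff_left algebra_simps)

lemma resolvent_defect: "R (z k) (defect f) = f - K k f"
  unfolding defect_resolvent[symmetric]
  by (simp add: defect_def blinfun.diff_right resolvent_cmult[OF clin z_resolvent] resolvent_commute[OF clin z_resolvent])

lemma defect_cmult: "defect (cmult c f) = cmult c (defect f)"
  by (simp add: defect_def clinear_opD[OF clin] cmult_diff_right cmult_cmult mult.commute)

lemma defect_K: "defect (K k f) = cmult (z k - l) (f - K k f)"
  unfolding K_apply defect_cmult defect_resolvent ..

lemma K_defect: "K k (defect f) = defect (K k f)"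
  unfolding defect_K by (simp add: K_apply resolvent_defect)

lemma K_eq_self: "defect f = 0 \<Longrightarrow> K k f = f"
  using resolvent_defect[of k f] by simp

text \<open>The operators \<open>K k\<close> produce approximate eigenvectors: by
  \<open>defect_K\<close> the defect carries the vanishing factor \<open>z k - l\<close>.\<close>

lemma norm_defect_K:
  assumes "norm (K k) \<le> M"
  shows "norm (defect (K k f)) \<le> 4 * (s k - r) * ((1 + M) * norm f)"
proof -
  have "norm (f - K k f) \<le> (1 + M) * norm f"
    using norm_triangle_ineq4[of f "K k f"] norm_blinfun[of "K k" f] mult_right_mono[OF assms norm_ge_zero[of f]]
    by (simp add: algebra_simps)
  then have "4 * (s k - r) * norm (f - K k f) \<le> 4 * (s k - r) * ((1 + M) * norm f)"
    using s_gt[of k] by (intro mult_left_mono) auto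
  moreover have "norm (defect (K k f)) \<le> 4 * (s k - r) * norm (f - K k f)"
    unfolding defect_K using norm_cmult_le[of "z k - l" "f - K k f"] by (simp add: cmod_z_minus_l)
  ultimately show ?thesis by linarith
qed

text \<open>A norm limit point of differences of the operators \<open>K k\<close> lies in the kernel of \<open>defect\<close>, where
  every \<open>K k\<close> is the identity, and in the closure of the range of \<open>defect\<close>, where \<open>K k\<close> tends to zero.\<close>
lemma K_Cauchy: "Cauchy K"
proof (rule ccontr)
  assume "\<not> Cauchy K"
  then obtain e where e: "0 < e" "\<And>N. \<exists>m\<ge>N. \<exists>n\<ge>N. \<not> norm (K m - K n) < e"
    unfolding Cauchy_iff by blast
  obtain M where M: "0 \<le> M" "\<forall>\<^sub>F k in sequentially. norm (K k) \<le> M" by (rule K_bounded)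
  obtain k0 where k0: "\<And>k. k \<ge> k0 \<Longrightarrow> norm (K k) \<le> M"
    using M(2) unfolding eventually_sequentially by blast
  have "\<exists>m n f. m \<ge> N + k0 \<and> n \<ge> N + k0 \<and> norm f = 1 \<and> e / 2 \<le> norm (K m f - K n f)" for N
  proof -
    obtain m n where mn: "m \<ge> N + k0" "n \<ge> N + k0" "\<not> norm (K m - K n) < e" using e(2) by blast
    have "\<exists>f. e / 2 * norm f < norm ((K m - K n) f)"
    proof (rule ccontr)
      assume "\<not> ?thesis"
      then have "norm (K m - K n) \<le> e / 2"
        using e(1) by (intro norm_blinfun_bound) (auto simp: not_less)
      with mn(3) e(1) show False by simp
    qed
    then obtain f where f: "e / 2 * norm f < norm ((K m - K n) f)" ..
    have f0: "norm f > 0" using f by (cases "f = 0") auto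
    define g where "g = inverse (norm f) *\<^sub>R f"
    have "norm g = 1" using f0 by (simp add: g_def)
    moreover have "e / 2 \<le> norm (K m g - K n g)"
    proof -
      have "K m g - K n g = inverse (norm f) *\<^sub>R (K m - K n) f"
        by (simp add: g_def blinfun.scaleR_right blinfun.diff_left scaleR_diff_right)
      then have "norm (K m g - K n g) = norm ((K m - K n) f) / norm f"
        using f0 by (simp add: divide_inverse mult.commute)
      with f f0 show ?thesis by (simp only: pos_le_divide_eq less_imp_le)
    qed
    ultimately show ?thesis using mn(1,2) by blast
  qed
  then obtain m n f where mnf: "\<And>N. m N \<ge> N + k0" "\<And>N. n N \<ge> N + k0" "\<And>N. norm (f N) = 1"
    "\<And>N. e / 2 \<le> norm (K (m N) (f N) - K (n N) (f N))" by metis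
  define h where "h N = K (m N) (f N) - K (n N) (f N)" for N
  have Mm: "norm (K (m N)) \<le> M" "norm (K (n N)) \<le> M" for N
    using k0 mnf(1,2)[of N] by auto
  have Kf: "norm (K (m N) (f N)) \<le> M" "norm (K (n N) (f N)) \<le> M" for N
    using norm_blinfun[of "K (m N)" "f N"] norm_blinfun[of "K (n N)" "f N"] Mm[of N] mnf(3)[of N] by auto
  have hM: "norm (h N) \<le> 2 * M" for N
    using norm_triangle_ineq4[of "K (m N) (f N)" "K (n N) (f N)"] Kf[of N] by (simp add: h_def)
  have sN: "s j - r \<le> inverse (real (Suc N))" if "j \<ge> N + k0" for j N
    using that by (auto simp: s_def intro!: le_imp_inverse_le)
  have dh: "(\<lambda>N. defect (h N)) \<longlonglongrightarrow> 0"
  proof (rule Lim_null_comparison)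
    show "(\<lambda>N. inverse (real (Suc N)) * (8 * (1 + M))) \<longlonglongrightarrow> 0"
      using tendsto_mult_right[OF LIMSEQ_inverse_real_of_nat, of "8 * (1 + M)"] by simp
    have "norm (defect (K j (f N))) \<le> inverse (real (Suc N)) * (4 * (1 + M))"
      if j: "j \<ge> N + k0" for j N
    proof -
      have "norm (defect (K j (f N))) \<le> 4 * (s j - r) * ((1 + M) * norm (f N))"
        by (rule norm_defect_K) (use k0 j in auto)
      also have "\<dots> = (s j - r) * (4 * (1 + M))" by (simp add: mnf(3) algebra_simps)
      also have "\<dots> \<le> inverse (real (Suc N)) * (4 * (1 + M))"
        using sN[OF j] M(1) by (intro mult_right_mono) auto
      finally show ?thesis .
    qed
    note D = this
    have "norm (defect (h N)) \<le> inverse (real (Suc N)) * (8 * (1 + M))" for N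
      using norm_triangle_ineq4[of "defect (K (m N) (f N))" "defect (K (n N) (f N))"]
        D[OF mnf(1)[of N]] D[OF mnf(2)[of N]] unfolding h_def defect_diff by linarith
    then show "\<forall>\<^sub>F N in sequentially. norm (defect (h N)) \<le> inverse (real (Suc N)) * (8 * (1 + M))" by simp
  qed
  obtain U where U: "U \<le> sequentially" "ultrafilter U"
    by (rule ex_ultrafilter[of sequentially]) auto
  have Ub: "U \<noteq> bot" using U(2) by (simp add: ultrafilter_def)
  obtain g where g: "(h \<longlongrightarrow> g) U" "defect g = 0"
    by (rule approximate_eigenvectors_converge[OF U(2,1) hM dh])
  have "e / 2 \<le> norm g"
    by (rule tendsto_lowerbound[OF tendsto_norm[OF g(1)] _ Ub]) (use mnf(4) in \<open>simp add: h_def\<close>)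
  moreover have "norm g \<le> 0"
  proof (rule field_le_epsilon)
    fix \<epsilon> :: real assume \<epsilon>: "0 < \<epsilon>"
    define \<delta> where "\<delta> = \<epsilon> / (2 * (M + 1))"
    have \<delta>: "0 < \<delta>" "M * \<delta> < \<epsilon> / 2" using \<epsilon> M(1) by (auto simp: \<delta>_def field_simps)
    obtain N where N: "norm (h N - g) < \<delta>"
      using eventually_happens'[OF Ub tendstoD[OF g(1) \<delta>(1)]] by (auto simp: dist_norm)
    \<comment> \<open>As \<open>K k f\<close> is \<open>f\<close> minus the defect of
      \<open>R (z k) f\<close>, the two copies of \<open>f N\<close> cancel and \<open>h N\<close>
      lies in the range of \<open>defect\<close>.\<close>
    define u where "u = R (z (n N)) (f N) - R (z (m N)) (f N)"
    have hu: "h N = defect u"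
      by (simp add: h_def u_def defect_diff defect_resolvent)
    have "(\<lambda>k. 4 * (s k - r) * ((1 + M) * norm u)) \<longlonglongrightarrow> 4 * 0 * ((1 + M) * norm u)"
      by (intro tendsto_intros s_tendsto)
    then have "\<forall>\<^sub>F k in sequentially. 4 * (s k - r) * ((1 + M) * norm u) < \<epsilon> / 2"
      using \<epsilon> by (intro order_tendstoD) auto
    then obtain k where k: "4 * (s k - r) * ((1 + M) * norm u) < \<epsilon> / 2" "norm (K k) \<le> M"
      using eventually_happens'[OF sequentially_bot eventually_conj[OF _ M(2)]] by blast
    have "g = K k (g - h N) + K k (h N)"
      using K_eq_self[OF g(2), of k] by (simp add: blinfun.diff_right)
    then have "norm g \<le> norm (K k (g - h N)) + norm (K k (h N))"
      by (metis norm_triangle_ineq)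
    also have "norm (K k (g - h N)) \<le> M * \<delta>"
      by (rule order_trans[OF norm_blinfun mult_mono])
        (use k(2) N M(1) in \<open>auto simp: norm_minus_commute\<close>)
    also have "norm (K k (h N)) \<le> 4 * (s k - r) * ((1 + M) * norm u)"
      unfolding hu K_defect by (rule norm_defect_K[OF k(2)])
    finally show "norm g \<le> 0 + \<epsilon>" using k(1) \<delta>(2) by linarith
  qed
  ultimately show False using e(1) by linarith
qed

section \<open>The limit projection and the resolvent near the peripheral value\<close>

definition Q :: "('a \<times> 'a) \<Rightarrow>\<^sub>L ('a \<times> 'a)"
  where "Q = lim K"

lemma K_tendsto: "K \<longlonglongrightarrow> Q"
  using K_Cauchy unfolding Q_def by (simp add: Cauchy_convergent_iff convergent_LIMSEQ_iff)

lemma K_apply_tendsto: "(\<lambda>k. K k f) \<longlonglongrightarrow> Q f"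
  by (rule bounded_linear.tendsto[OF blinfun.bounded_linear_left K_tendsto])

lemma defect_Q: "defect (Q f) = 0"
proof (rule LIMSEQ_unique)
  show "(\<lambda>k. defect (K k f)) \<longlonglongrightarrow> defect (Q f)"
    by (rule bounded_linear.tendsto[OF defect_bounded_linear K_apply_tendsto])
  obtain M where M: "0 \<le> M" "\<forall>\<^sub>F k in sequentially. norm (K k) \<le> M" by (rule K_bounded)
  show "(\<lambda>k. defect (K k f)) \<longlonglongrightarrow> 0"
  proof (rule Lim_null_comparison)
    show "\<forall>\<^sub>F k in sequentially. norm (defect (K k f)) \<le> 4 * (s k - r) * ((1 + M) * norm f)"
      using M(2) by eventually_elim (rule norm_defect_K)
    have "(\<lambda>k. 4 * (s k - r) * ((1 + M) * norm f)) \<longlonglongrightarrow> 4 * 0 * ((1 + M) * norm f)"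
      by (intro tendsto_intros s_tendsto)
    then show "(\<lambda>k. 4 * (s k - r) * ((1 + M) * norm f)) \<longlonglongrightarrow> 0" by simp
  qed
qed

lemma Q_defect: "Q (defect f) = 0"
proof -
  have "(\<lambda>k. K k (defect f)) \<longlonglongrightarrow> defect (Q f)"
    unfolding K_defect by (rule bounded_linear.tendsto[OF defect_bounded_linear K_apply_tendsto])
  with K_apply_tendsto[of "defect f"] show ?thesis
    using LIMSEQ_unique defect_Q by metis
qed

lemma Q_eq_self: "defect f = 0 \<Longrightarrow> Q f = f"
  by (rule LIMSEQ_unique[OF K_apply_tendsto]) (simp add: K_eq_self)

lemma Q_idem: "Q (Q f) = Q f"
  by (rule Q_eq_self[OF defect_Q])

lemma Q_cmult: "Q (cmult c f) = cmult c (Q f)"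
proof (rule LIMSEQ_unique[OF K_apply_tendsto])
  show "(\<lambda>k. K k (cmult c f)) \<longlonglongrightarrow> cmult c (Q f)"
    unfolding K_cmult by (intro tendsto_intros K_apply_tendsto)
qed

lemma T_Q: "T (Q f) = cmult l (Q f)" and Q_T: "Q (T f) = cmult l (Q f)"
  using defect_Q[of f] Q_defect[of f] by (simp_all add: defect_def blinfun.diff_right Q_cmult)

lemma Q_resolvent: "Q (R (z k) f) = R (z k) (Q f)"
proof (rule sym, rule resolvent_eqI[OF z_resolvent])
  have "Q (cmult (z k) (R (z k) f) - T (R (z k) f)) = Q f"
    by (simp add: resolvent_right[OF z_resolvent])
  then show "cmult (z k) (Q (R (z k) f)) - T (Q (R (z k) f)) = Q f"
    by (simp add: blinfun.diff_right Q_cmult Q_T T_Q)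
qed

text \<open>Otherwise there are unit vectors in the kernel of \<open>Q\<close> with vanishing
  defect. Their limit along an ultrafilter is a unit vector that \<open>Q\<close> both fixes and
  annihilates.\<close>

lemma reduced_resolvent_bounded:
  obtains M k0 where "0 < M" "\<And>k f. k \<ge> k0 \<Longrightarrow> norm (R (z k) (f - Q f)) \<le> M * norm f"
proof -
  have "\<exists>n::nat. \<forall>k\<ge>n. \<forall>f. norm (R (z k) (f - Q f)) \<le> real (Suc n) * norm f"
  proof (rule ccontr)
    assume "\<not> ?thesis"
    then have "\<exists>k f. k \<ge> n \<and> real (Suc n) * norm f < norm (R (z k) (f - Q f))" for n
      by (auto simp: not_le)
    then obtain k f where kf: "\<And>n. k n \<ge> n" "\<And>n. real (Suc n) * norm (f n) < norm (R (z (k n)) (f n - Q (f n)))"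
      by metis
    define h where "h n = R (z (k n)) (f n - Q (f n))" for n
    have h0: "0 < norm (h n)" for n
      using kf(2)[of n] unfolding h_def by (rule le_less_trans[rotated]) simp
    define g where "g n = inverse (norm (h n)) *\<^sub>R h n" for n
    have g1: "norm (g n) = 1" for n using h0[of n] by (simp add: g_def)
    \<comment> \<open>The first term is small by the choice of \<open>f n\<close>, the second
      because \<open>k n \<ge> n\<close> brings \<open>z (k n)\<close> close to
      \<open>l\<close>.\<close>
    have dg: "defect (g n) = inverse (norm (h n)) *\<^sub>R (f n - Q (f n)) - cmult (z (k n) - l) (g n)" for n
      using defect_resolvent[of "k n" "f n - Q (f n)"]
      by (simp add: g_def h_def defect_scaleR K_apply cmult_scaleR scaleR_diff_right)
    have fn: "norm (f n) / norm (h n) \<le> inverse (real (Suc n))" for n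
      using kf(2)[of n] h0[of n] unfolding h_def[symmetric] by (simp add: field_simps)
    have "(\<lambda>n. defect (g n)) \<longlonglongrightarrow> 0"
    proof (rule Lim_null_comparison)
      show "(\<lambda>n. inverse (real (Suc n)) * ((1 + norm Q) + 4)) \<longlonglongrightarrow> 0"
        using tendsto_mult_right[OF LIMSEQ_inverse_real_of_nat, of "(1 + norm Q) + 4"] by simp
      have "norm (defect (g n)) \<le> inverse (real (Suc n)) * ((1 + norm Q) + 4)" for n
      proof -
        have "norm (f n - Q (f n)) \<le> (1 + norm Q) * norm (f n)"
          using norm_triangle_ineq4[of "f n" "Q (f n)"] norm_blinfun[of Q "f n"] by (simp add: algebra_simps)
        then have "norm (inverse (norm (h n)) *\<^sub>R (f n - Q (f n))) \<le> inverse (norm (h n)) * ((1 + norm Q) * norm (f n))"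
          using h0[of n] by (simp add: mult_left_mono)
        also have "\<dots> = (norm (f n) / norm (h n)) * (1 + norm Q)" by (simp add: field_simps)
        also have "\<dots> \<le> inverse (real (Suc n)) * (1 + norm Q)"
          by (intro mult_right_mono fn) simp
        finally have 1: "norm (inverse (norm (h n)) *\<^sub>R (f n - Q (f n))) \<le> inverse (real (Suc n)) * (1 + norm Q)" .
        have "norm (cmult (z (k n) - l) (g n)) \<le> 4 * (s (k n) - r)"
          using norm_cmult_le[of "z (k n) - l" "g n"] by (simp add: g1 cmod_z_minus_l)
        also have "\<dots> \<le> inverse (real (Suc n)) * 4"
          using kf(1)[of n] by (auto simp: s_def intro!: le_imp_inverse_le)
        finally show ?thesis
          using 1 norm_triangle_ineq4[of "inverse (norm (h n)) *\<^sub>R (f n - Q (f n))" "cmult (z (k n) - l) (g n)"]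
          unfolding dg by (simp add: distrib_left)
      qed
      then show "\<forall>\<^sub>F n in sequentially. norm (defect (g n)) \<le> inverse (real (Suc n)) * ((1 + norm Q) + 4)" by simp
    qed
    moreover obtain U where U: "U \<le> sequentially" "ultrafilter U"
      by (rule ex_ultrafilter[of sequentially]) auto
    ultimately obtain a where a: "(g \<longlongrightarrow> a) U" "defect a = 0"
      using approximate_eigenvectors_converge[OF U(2,1), of g 1] g1 by (metis order_refl)
    have Ub: "U \<noteq> bot" using U(2) by (simp add: ultrafilter_def)
    have "Q (g n) = 0" for n
      by (simp add: g_def h_def blinfun.scaleR_right Q_resolvent blinfun.diff_right Q_idem blinfun.zero_right)
    then have "((\<lambda>n. Q (g n)) \<longlongrightarrow> 0) U" by simp
    moreover have "((\<lambda>n. Q (g n)) \<longlongrightarrow> Q a) U"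
      by (rule bounded_linear.tendsto[OF blinfun.bounded_linear_right a(1)])
    ultimately have "a = 0"
      using tendsto_unique[OF Ub] Q_eq_self[OF a(2)] by metis
    moreover have "((\<lambda>n. norm (g n)) \<longlongrightarrow> norm a) U" by (rule tendsto_norm[OF a(1)])
    ultimately show False
      using tendsto_unique[OF Ub, of "\<lambda>n. norm (g n)" "norm a" 1] by (simp add: g1)
  qed
  then obtain n :: nat where n: "\<forall>k\<ge>n. \<forall>f. norm (R (z k) (f - Q f)) \<le> real (Suc n) * norm f" ..
  show thesis by (rule that[of "real (Suc n)" n]) (use n in auto)
qed

text \<open>Adding \<open>Q\<close> removes the kernel. The operator \<open>L\<close> acts as
  \<open>cscal (z k) - T\<close> on the kernel of \<open>Q\<close> and as the identity on its range;
  its inverse \<open>A\<close> is bounded uniformly in large \<open>k\<close>, while the difference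
  \<open>D\<close> from the desired operator tends to 0.\<close>

lemma regularised_inverse:
  obtains H where "(cscal l - T + Q) o\<^sub>L H = id_blinfun" "H o\<^sub>L (cscal l - T + Q) = id_blinfun"
proof -
  obtain M k0 where M: "0 < M" "\<And>k f. k \<ge> k0 \<Longrightarrow> norm (R (z k) (f - Q f)) \<le> M * norm f"
    by (rule reduced_resolvent_bounded) (rule that, simp_all)
  \<comment> \<open>\<open>b\<close> is the product of the bounds for \<open>norm A\<close> and
    \<open>norm D\<close> without the factor \<open>s k - r\<close>.\<close>
  define b where "b = (M + norm Q) * (4 * (1 + norm Q))"
  have "(\<lambda>k. (s k - r) * b) \<longlonglongrightarrow> 0 * b" by (intro tendsto_intros s_tendsto)
  then have "\<forall>\<^sub>F k in sequentially. (s k - r) * b < 1 / 2" by (intro order_tendstoD) auto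
  from eventually_happens'[OF sequentially_bot eventually_conj[OF this eventually_ge_at_top[of k0]]]
  obtain k where k: "(s k - r) * b < 1 / 2" "k \<ge> k0" by blast
  define A where "A = (R (z k) o\<^sub>L (id_blinfun - Q)) + Q"
  define D where "D = cscal (z k - l) o\<^sub>L (id_blinfun - Q)"
  define L where "L = cscal l - T + Q + D"
  have A: "A f = R (z k) (f - Q f) + Q f" for f
    by (simp add: A_def blinfun.add_left blinfun.diff_left)
  have D: "D f = cmult (z k - l) (f - Q f)" for f
    by (simp add: D_def blinfun.diff_left)
  have L: "L f = cmult (z k) (f - Q f) - T (f - Q f) + Q f" for f
    by (simp add: L_def D blinfun.add_left blinfun.diff_left blinfun.diff_right T_Q cmult_diff_left cmult_diff_right algebra_simps)
  have QA: "Q (A f) = Q f" for f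
    by (simp add: A blinfun.add_right Q_resolvent blinfun.diff_right Q_idem blinfun.zero_right)
  have QL: "Q (L f) = Q f" for f
    by (simp add: L blinfun.add_right blinfun.diff_right Q_cmult Q_T Q_idem)
  have 1: "L o\<^sub>L A = id_blinfun"
  proof (rule blinfun_eqI)
    fix f
    have "A f - Q (A f) = R (z k) (f - Q f)" unfolding QA by (simp add: A)
    then have "L (A f) = (f - Q f) + Q f"
      unfolding L QA using resolvent_right[OF z_resolvent, of k "f - Q f"] by simp
    then show "(L o\<^sub>L A) f = id_blinfun f" by simp
  qed
  have 2: "A o\<^sub>L L = id_blinfun"
  proof (rule blinfun_eqI)
    fix f
    have "L f - Q (L f) = cmult (z k) (f - Q f) - T (f - Q f)" unfolding QL by (simp add: L)
    then have "A (L f) = (f - Q f) + Q f"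
      unfolding A QL using resolvent_eqI[OF z_resolvent, of k "f - Q f"] by simp
    then show "(A o\<^sub>L L) f = id_blinfun f" by simp
  qed
  have "norm A \<le> M + norm Q"
  proof (rule norm_blinfun_bound)
    fix f
    have "norm (A f) \<le> norm (R (z k) (f - Q f)) + norm (Q f)" unfolding A by (rule norm_triangle_ineq)
    also have "\<dots> \<le> M * norm f + norm Q * norm f" by (intro add_mono M(2) k(2) norm_blinfun)
    finally show "norm (A f) \<le> (M + norm Q) * norm f" by (simp add: distrib_right)
  qed (use M(1) in simp)
  moreover have "norm D \<le> (s k - r) * (4 * (1 + norm Q))"
  proof (rule norm_blinfun_bound)
    fix f
    have "norm (D f) \<le> 4 * (s k - r) * norm (f - Q f)"
      unfolding D using norm_cmult_le[of "z k - l" "f - Q f"] by (simp add: cmod_z_minus_l)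
    also have "\<dots> \<le> 4 * (s k - r) * ((1 + norm Q) * norm f)"
      using norm_triangle_ineq4[of f "Q f"] norm_blinfun[of Q f] s_gt[of k]
      by (intro mult_left_mono) (auto simp: algebra_simps)
    finally show "norm (D f) \<le> (s k - r) * (4 * (1 + norm Q)) * norm f" by (simp add: algebra_simps)
  qed (use s_gt[of k] in simp)
  ultimately have "norm A * norm D \<le> (M + norm Q) * ((s k - r) * (4 * (1 + norm Q)))"
    using M(1) by (intro mult_mono) auto
  also have "\<dots> = (s k - r) * b" by (simp add: b_def mult_ac)
  finally have "norm (A o\<^sub>L D) \<le> 1 / 2"
    using norm_blinfun_compose[of A D] k(1) by linarith
  from inverse_perturbation[OF 1 2 this]
  obtain H where "(L - D) o\<^sub>L H = id_blinfun" "H o\<^sub>L (L - D) = id_blinfun" by blast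
  moreover have "L - D = cscal l - T + Q" by (simp add: L_def)
  ultimately show thesis by (intro that[of H]) simp_all
qed

text \<open>Near \<open>l\<close> the operator \<open>cscal \<zeta> - T + Q\<close> stays
  invertible. Its inverse serves as the resolvent on the kernel of \<open>Q\<close>; on the range
  \<open>T\<close> multiplies by \<open>l\<close>, so there the resolvent is division by
  \<open>\<zeta> - l\<close>.\<close>

lemma resolvent_near_peripheral:
  obtains c \<delta> where "0 < \<delta>" "\<forall>\<zeta>. \<zeta> \<noteq> l \<and> cmod (\<zeta> - l) < \<delta> \<longrightarrow>
    \<zeta> \<in> resolvent_set T \<and> norm ((cscal (\<zeta> - l) o\<^sub>L R \<zeta>) - Q) \<le> c * cmod (\<zeta> - l)"
proof -
  obtain H where H: "(cscal l - T + Q) o\<^sub>L H = id_blinfun" "H o\<^sub>L (cscal l - T + Q) = id_blinfun"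
    by (rule regularised_inverse)
  \<comment> \<open>The 8 combines the factor 4 of \<open>norm_cscal_le\<close> with the bound 1/2
    for the Neumann series; the summand 1 keeps the denominator positive.\<close>
  define \<delta> where "\<delta> = 1 / (8 * (norm H + 1))"
  have \<delta>: "0 < \<delta>" by (simp add: \<delta>_def add_nonneg_pos)
  have main: "\<zeta> \<in> resolvent_set T \<and> norm ((cscal (\<zeta> - l) o\<^sub>L R \<zeta>) - Q) \<le> 8 * norm H * (1 + norm Q) * cmod (\<zeta> - l)"
    if \<zeta>: "\<zeta> \<noteq> l" "cmod (\<zeta> - l) < \<delta>" for \<zeta>
  proof -
    have "norm (H o\<^sub>L cscal (l - \<zeta>)) \<le> norm H * norm (cscal (l - \<zeta>) :: ('a \<times> 'a) \<Rightarrow>\<^sub>L ('a \<times> 'a))"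
      by (rule norm_blinfun_compose)
    also have "\<dots> \<le> norm H * (4 * cmod (\<zeta> - l))"
      using norm_cscal_le[of "l - \<zeta>"] by (intro mult_left_mono) (auto simp: norm_minus_commute)
    also have "\<dots> \<le> norm H * (4 * \<delta>)" using \<zeta>(2) by (intro mult_left_mono) auto
    also have "\<dots> \<le> 1 / 2"
    proof -
      have "0 < 8 + norm H * 8" by (simp add: add_pos_nonneg)
      then show ?thesis by (simp add: \<delta>_def field_simps)
    qed
    finally have "norm (H o\<^sub>L cscal (l - \<zeta>)) \<le> 1 / 2" .
    from inverse_perturbation[OF H this]
    obtain G where G: "(cscal l - T + Q - cscal (l - \<zeta>)) o\<^sub>L G = id_blinfun"
      "G o\<^sub>L (cscal l - T + Q - cscal (l - \<zeta>)) = id_blinfun" "norm G \<le> 2 * norm H" by blast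
    have app: "(cscal l - T + Q - cscal (l - \<zeta>)) f = cmult \<zeta> f - T f + Q f" for f
      by (simp add: blinfun.diff_left blinfun.add_left cmult_diff_left)
    have G1: "cmult \<zeta> (G f) - T (G f) + Q (G f) = f" for f
      using arg_cong[OF G(1), of "\<lambda>A. blinfun_apply A f"] by (simp add: app)
    have G2: "G (cmult \<zeta> f - T f + Q f) = f" for f
      using arg_cong[OF G(2), of "\<lambda>A. blinfun_apply A f"] by (simp add: app)
    have QG: "Q (G f) = G (Q f)" for f
    proof -
      have "Q f = Q (cmult \<zeta> (G f) - T (G f) + Q (G f))" by (simp add: G1)
      also have "\<dots> = cmult \<zeta> (Q (G f)) - T (Q (G f)) + Q (Q (G f))"
        by (simp add: blinfun.diff_right blinfun.add_right Q_cmult Q_T T_Q)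
      finally have "G (Q f) = G (cmult \<zeta> (Q (G f)) - T (Q (G f)) + Q (Q (G f)))" by simp
      then show ?thesis by (simp add: G2)
    qed
    have QG0: "Q (G (f - Q f)) = 0" for f
      by (simp add: QG blinfun.diff_right Q_idem blinfun.zero_right)
    define X where "X = (G o\<^sub>L (id_blinfun - Q)) + (cscal (inverse (\<zeta> - l)) o\<^sub>L Q)"
    have X: "X f = G (f - Q f) + cmult (inverse (\<zeta> - l)) (Q f)" for f
      by (simp add: X_def blinfun.add_left blinfun.diff_left)
    have scal: "cmult \<zeta> (cmult (inverse (\<zeta> - l)) g) - cmult (inverse (\<zeta> - l)) (cmult l g) = g" for g :: "'a \<times> 'a"
    proof -
      have "\<zeta> * inverse (\<zeta> - l) - inverse (\<zeta> - l) * l = (\<zeta> - l) * inverse (\<zeta> - l)"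
        by (simp only: left_diff_distrib mult.commute[of _ l])
      also have "\<dots> = 1" using \<zeta>(1) by simp
      finally have "\<zeta> * inverse (\<zeta> - l) - inverse (\<zeta> - l) * l = 1" .
      then show ?thesis by (simp add: cmult_cmult flip: cmult_diff_left)
    qed
    have r1: "(cscal \<zeta> - T) o\<^sub>L X = id_blinfun"
    proof (rule blinfun_eqI)
      fix f
      have "cmult \<zeta> (G (f - Q f)) - T (G (f - Q f)) = f - Q f"
        using G1[of "f - Q f"] by (simp add: QG0)
      moreover have "cmult \<zeta> (cmult (inverse (\<zeta> - l)) (Q f)) - T (cmult (inverse (\<zeta> - l)) (Q f)) = Q f"
        using scal[of "Q f"] by (simp add: clinear_opD[OF clin] T_Q)
      ultimately have "cmult \<zeta> (X f) - T (X f) = f"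
        unfolding X cmult_add_right blinfun.add_right by (simp add: algebra_simps)
      then show "((cscal \<zeta> - T) o\<^sub>L X) f = id_blinfun f" by (simp add: blinfun.diff_left)
    qed
    have r2: "X o\<^sub>L (cscal \<zeta> - T) = id_blinfun"
    proof (rule blinfun_eqI)
      fix f
      let ?y = "cmult \<zeta> f - T f"
      have Qy: "Q ?y = cmult \<zeta> (Q f) - cmult l (Q f)" by (simp add: blinfun.diff_right Q_cmult Q_T)
      have "G (cmult \<zeta> (f - Q f) - T (f - Q f) + Q (f - Q f)) = f - Q f" by (rule G2)
      moreover have "cmult \<zeta> (f - Q f) - T (f - Q f) + Q (f - Q f) = ?y - Q ?y"
        by (simp add: blinfun.diff_right cmult_diff_right T_Q Q_idem Q_cmult Q_T)
      ultimately have 1: "G (?y - Q ?y) = f - Q f" by simp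
      have 2: "cmult (inverse (\<zeta> - l)) (Q ?y) = Q f"
        using \<zeta>(1) by (simp add: Qy cmult_cmult flip: cmult_diff_left)
      have "X ?y = f" unfolding X 1 2 by simp
      then show "(X o\<^sub>L (cscal \<zeta> - T)) f = id_blinfun f" by (simp add: blinfun.diff_left)
    qed
    have res: "\<zeta> \<in> resolvent_set T" "R \<zeta> = X" using resolventI[OF r1 r2] by auto
    have "norm ((cscal (\<zeta> - l) o\<^sub>L X) - Q) \<le> 8 * norm H * (1 + norm Q) * cmod (\<zeta> - l)"
    proof (rule norm_blinfun_bound)
      fix f
      have "((cscal (\<zeta> - l) o\<^sub>L X) - Q) f = cmult (\<zeta> - l) (G (f - Q f))"
        using \<zeta>(1) by (simp add: blinfun.diff_left X cmult_add_right cmult_cmult)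
      also have "norm \<dots> \<le> 4 * cmod (\<zeta> - l) * norm (G (f - Q f))" by (rule norm_cmult_le)
      also have "\<dots> \<le> 4 * cmod (\<zeta> - l) * (2 * norm H * ((1 + norm Q) * norm f))"
      proof (rule mult_left_mono)
        have "norm (f - Q f) \<le> (1 + norm Q) * norm f"
          using norm_triangle_ineq4[of f "Q f"] norm_blinfun[of Q f] by (simp add: algebra_simps)
        then show "norm (G (f - Q f)) \<le> 2 * norm H * ((1 + norm Q) * norm f)"
          by (intro order_trans[OF norm_blinfun mult_mono] G(3)) auto
      qed simp
      finally show "norm (((cscal (\<zeta> - l) o\<^sub>L X) - Q) f) \<le> 8 * norm H * (1 + norm Q) * cmod (\<zeta> - l) * norm f"
        by (simp add: algebra_simps)
    qed simp
    with res show ?thesis by simp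
  qed
  show thesis by (rule that[OF \<delta>]) (use main in blast)
qed

lemma scaled_resolvent_tendsto_Q: "((\<lambda>\<zeta>. cscal (\<zeta> - l) o\<^sub>L R \<zeta>) \<longlongrightarrow> Q) (at l)"
  and eventually_not_spectrum: "\<forall>\<^sub>F \<zeta> in at l. \<zeta> \<notin> spectrum T"
proof -
  obtain c \<delta> where \<delta>: "0 < \<delta>" "\<forall>\<zeta>. \<zeta> \<noteq> l \<and> cmod (\<zeta> - l) < \<delta> \<longrightarrow>
    \<zeta> \<in> resolvent_set T \<and> norm ((cscal (\<zeta> - l) o\<^sub>L R \<zeta>) - Q) \<le> c * cmod (\<zeta> - l)"
    by (rule resolvent_near_peripheral)
  have near: "\<forall>\<^sub>F \<zeta> in at l. \<zeta> \<noteq> l \<and> cmod (\<zeta> - l) < \<delta>"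
    unfolding eventually_at using \<delta>(1) by (intro exI[of _ \<delta>]) (auto simp: dist_norm)
  then show "\<forall>\<^sub>F \<zeta> in at l. \<zeta> \<notin> spectrum T"
    by eventually_elim (use \<delta>(2) in \<open>auto simp: spectrum_def\<close>)
  have "((\<lambda>\<zeta>. c * cmod (\<zeta> - l)) \<longlongrightarrow> c * cmod (l - l)) (at l)"
    by (intro tendsto_intros)
  then have lim: "((\<lambda>\<zeta>. c * cmod (\<zeta> - l)) \<longlongrightarrow> 0) (at l)" by simp
  have "\<forall>\<^sub>F \<zeta> in at l. norm ((cscal (\<zeta> - l) o\<^sub>L R \<zeta>) - Q) \<le> c * cmod (\<zeta> - l)"
    using near by eventually_elim (use \<delta>(2) in auto)
  from LIM_zero_cancel[OF Lim_null_comparison[OF this lim]]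
  show "((\<lambda>\<zeta>. cscal (\<zeta> - l) o\<^sub>L R \<zeta>) \<longlongrightarrow> Q) (at l)" .
qed

lemma peripheral_pole:
  assumes "l \<in> spectrum T"
  shows "simple_pole T l \<and> finite_dim (spectral_space T l) \<and> dim (spectral_space T l) \<le> dim S"
proof -
  have "simple_pole T l"
    unfolding simple_pole_def using assms scaled_resolvent_tendsto_Q eventually_not_spectrum by blast
  moreover have "spectral_space T l \<subseteq> {F. defect F = 0}"
  proof -
    have "spectral_proj T l = Q"
      unfolding spectral_proj_def by (rule tendsto_Lim[OF _ scaled_resolvent_tendsto_Q]) simp
    then show ?thesis by (auto simp: spectral_space_def defect_Q simp del: split_paired_All)
  qed
  moreover obtain B where B: "finite B" "card B \<le> dim S" "{F. defect F = 0} \<subseteq> span B"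
    using kernel_finite_dim by blast
  ultimately show ?thesis
    using dim_le_card[of "spectral_space T l" B] unfolding finite_dim_def by (meson order_trans)
qed

end

theorem theorem4p1:
  fixes T :: "('a::banach_lattice \<times> 'a) \<Rightarrow>\<^sub>L ('a \<times> 'a)"
  assumes "clinear_op T"
    and "unif_ev_pos T"
    and "simple_pole T (complex_of_real (spec_radius T))"
    and "finite_dim (spectral_space T (complex_of_real (spec_radius T)))"
  shows "\<forall>l\<in>spectrum T. cmod l = spec_radius T \<longrightarrow>
           simple_pole T l \<and> finite_dim (spectral_space T l) \<and>
           dim (spectral_space T l) \<le> dim (spectral_space T (complex_of_real (spec_radius T)))"
proof (intro ballI impI)
  fix l assume lsp: "l \<in> spectrum T" "cmod l = spec_radius T"
  obtain n0 where n0: "\<And>n. n \<ge> n0 \<Longrightarrow> pos_op (blinfun_apply T ^^ n)"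
    using assms(2) by (auto simp: unif_ev_pos_def)
  show "simple_pole T l \<and> finite_dim (spectral_space T l) \<and>
      dim (spectral_space T l) \<le> dim (spectral_space T (complex_of_real (spec_radius T)))"
  proof (cases "spec_radius T = 0")
    \<comment> \<open>For radius 0 the value \<open>l\<close> is 0, the spectral radius itself, so
      the claim follows from the hypotheses. The other case is the one in which division by the
      radius is possible.\<close>
    case True
    then have "l = complex_of_real (spec_radius T)" using lsp(2) by simp
    with assms show ?thesis by simp
  next
    case False
    then have "0 < spec_radius T" using lsp(2) norm_ge_zero[of l] by simp
    then interpret peripheral_value T n0 l
      using assms n0 lsp(2) by unfold_locales auto
    show ?thesis by (rule peripheral_pole[OF lsp(1)])
  qed
qed

end
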